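(* Let $p\ge 1$. Suppose that $X_i=\mu_0+\epsilon_i$ for all $1\le i\le N$ and all $N$ (no change in the mean), where $\mu_0\in\mathbb{R}$ and $E\epsilon_i=0$. Suppose that there are constants $\sigma>0$ and $\zeta<1/2$ such that for each $N$ there are two independent Wiener processes $\{W_{N,1}(t),0\le t\le N/2\}$ and $\{W_{N,2}(t),0\le t\le N/2\}$ with $$\sup_{1\le k\le N/2}k^{-\zeta}\left|\sum_{i=1}^{k}\epsilon_i-\sigma W_{N,1}(k)\right|=O_P(1)$$ and $$\sup_{N/2<k<N}(N-k)^{-\zeta}\left|\sum_{i=k+1}^{N}\epsilon_i-\sigma W_{N,2}(N-k)\right|=O_P(1)$$ as $N\to\infty$. Let $w:[0,1]\to[0,\infty)$ be a measurable weight function such that $\inf_{\delta\le t\le 1-\delta}w(t)>0$ for all $0<\delta<1/2$, and $$\int_0^1\frac{(t(1-t))^{p/2}}{w(t)}\,dt<\infty .$$ Then, as $N\to\infty$, $$\frac{1}{\sigma^p}\int_0^1\frac{|Z_N(t)|^p}{w(t)}\,dt\ \stackrel{\mathcal D}{\to}\ \int_0^1\frac{|B(t)|^p}{w(t)}\,dt,$$ where $\{B(t),0\le t\le 1\}$ is a Brownian bridge.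
   Context: $X_1,X_2,\ldots$ are real-valued random variables (observations) and $\epsilon_1,\epsilon_2,\ldots$ are the corresponding error random variables (one fixed sequence, not depending on $N$). The Wiener processes $W_{N,1},W_{N,2}$ are defined on the same probability space as the errors (suitably enlarged if necessary). The cumulative sum (CUSUM) process is $$Z(x)=\sum_{i=1}^{\lfloor x\rfloor}X_i-\frac{\lfloor x\rfloor}{N}\sum_{i=1}^N X_i,\qquad 0\le x<N+1,$$ where $\lfloor x\rfloor$ is the integer part of $x$, and $$Z_N(t)=N^{-1/2}Z((N+1)t),\quad 0\le t<1,\qquad Z_N(1)=0.$$ Thus $Z_N(t)=0$ for $t\notin[1/(N+1),N/(N+1))$. $\stackrel{\mathcal D}{\to}$ denotes convergence in distribution, and $O_P(1)$ means bounded in probability as $N\to\infty$. *)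

theory Defs
  imports "HOL-Probability.Probability"
begin

text \<open>
  A standard Wiener process on \<open>[0, T]\<close>; nothing is required of \<open>W t\<close> for \<open>t\<close> outside \<open>[0, T]\<close>.
\<close>

definition wiener_process :: "'a measure \<Rightarrow> real \<Rightarrow> (real \<Rightarrow> 'a \<Rightarrow> real) \<Rightarrow> bool" where
  "wiener_process M T W \<longleftrightarrow>
     prob_space M \<and>
     (\<forall>t\<in>{0..T}. W t \<in> borel_measurable M) \<and>
     (AE \<omega> in M. W 0 \<omega> = 0) \<and>
     (\<forall>(t :: nat \<Rightarrow> real) n. 0 \<le> t 0 \<and> (\<forall>i<n. t i < t (Suc i)) \<and> t n \<le> T \<longrightarrow>
        prob_space.indep_vars M (\<lambda>_. borel) (\<lambda>i \<omega>. W (t (Suc i)) \<omega> - W (t i) \<omega>) {..<n}) \<and>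
     (\<forall>s t. 0 \<le> s \<and> s < t \<and> t \<le> T \<longrightarrow>
        distributed M lborel (\<lambda>\<omega>. W t \<omega> - W s \<omega>) (normal_density 0 (sqrt (t - s)))) \<and>
     (AE \<omega> in M. continuous_on {0..T} (\<lambda>t. W t \<omega>))"

text \<open>Independence of the two processes as random elements of the product space \<open>\<real>\<^bsup>[0, T]\<^esup>\<close>.\<close>

definition indep_processes ::
  "'a measure \<Rightarrow> real \<Rightarrow> (real \<Rightarrow> 'a \<Rightarrow> real) \<Rightarrow> (real \<Rightarrow> 'a \<Rightarrow> real) \<Rightarrow> bool" where
  "indep_processes M T U V \<longleftrightarrow>
     prob_space.indep_var M
       (Pi\<^sub>M {0..T} (\<lambda>_. borel)) (\<lambda>\<omega>. \<lambda>t\<in>{0..T}. U t \<omega>)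
       (Pi\<^sub>M {0..T} (\<lambda>_. borel)) (\<lambda>\<omega>. \<lambda>t\<in>{0..T}. V t \<omega>)"

text \<open>The second disjunct covers degenerate normal laws (variance zero).\<close>

definition gaussian_rv :: "'a measure \<Rightarrow> ('a \<Rightarrow> real) \<Rightarrow> bool" where
  "gaussian_rv M Y \<longleftrightarrow>
     Y \<in> borel_measurable M \<and>
     ((\<exists>m s. s > 0 \<and> distributed M lborel Y (normal_density m s)) \<or>
      (\<exists>m. AE \<omega> in M. Y \<omega> = m))"

definition gaussian_process :: "'a measure \<Rightarrow> 'i set \<Rightarrow> ('i \<Rightarrow> 'a \<Rightarrow> real) \<Rightarrow> bool" where
  "gaussian_process M I Y \<longleftrightarrow>
     (\<forall>J c. finite J \<and> J \<subseteq> I \<longrightarrow> gaussian_rv M (\<lambda>\<omega>. \<Sum>t\<in>J. c t * Y t \<omega>))"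

text \<open>
  The process is centred, so the expectation of the product is the covariance. All sample paths are
  required to be continuous (not only almost all of them), so that integral functionals of the path
  are measurable even when \<open>M\<close> is not complete.
\<close>

definition brownian_bridge :: "'a measure \<Rightarrow> (real \<Rightarrow> 'a \<Rightarrow> real) \<Rightarrow> bool" where
  "brownian_bridge M B \<longleftrightarrow>
     prob_space M \<and>
     gaussian_process M {0..1} B \<and>
     (\<forall>t\<in>{0..1}. prob_space.expectation M (B t) = 0) \<and>
     (\<forall>s\<in>{0..1}. \<forall>t\<in>{0..1}.
        prob_space.expectation M (\<lambda>\<omega>. B s \<omega> * B t \<omega>) = min s t - s * t) \<and>
     (\<forall>\<omega>\<in>space M. continuous_on {0..1} (\<lambda>t. B t \<omega>))"

definition bounded_in_probability :: "'a measure \<Rightarrow> (nat \<Rightarrow> 'a \<Rightarrow> real) \<Rightarrow> bool" where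
  "bounded_in_probability M Y \<longleftrightarrow>
     (\<forall>e>0. \<exists>C. \<forall>\<^sub>F N in sequentially. measure M {\<omega> \<in> space M. \<bar>Y N \<omega>\<bar> > C} < e)"

text \<open>
  The limit may live on a different probability space. Measurability is part of the definition,
  since \<^const>\<open>distr\<close> is the law of a function only if the function is measurable.
\<close>

definition converges_in_distribution ::
  "'a measure \<Rightarrow> (nat \<Rightarrow> 'a \<Rightarrow> real) \<Rightarrow> 'b measure \<Rightarrow> ('b \<Rightarrow> real) \<Rightarrow> bool" where
  "converges_in_distribution M Y M' Y' \<longleftrightarrow>
     (\<forall>N. Y N \<in> borel_measurable M) \<and> Y' \<in> borel_measurable M' \<and>
     weak_conv_m (\<lambda>N. distr M borel (Y N)) (distr M' borel Y')"

text \<open>Only the observations \<open>X i\<close> with \<open>i \<ge> 1\<close> are used.\<close>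

definition cusum :: "(nat \<Rightarrow> 'a \<Rightarrow> real) \<Rightarrow> nat \<Rightarrow> real \<Rightarrow> 'a \<Rightarrow> real" where
  "cusum X N x \<omega> =
     (\<Sum>i = 1..nat \<lfloor>x\<rfloor>. X i \<omega>) - of_int \<lfloor>x\<rfloor> / real N * (\<Sum>i = 1..N. X i \<omega>)"

definition cusum_normalized :: "(nat \<Rightarrow> 'a \<Rightarrow> real) \<Rightarrow> nat \<Rightarrow> real \<Rightarrow> 'a \<Rightarrow> real" where
  "cusum_normalized X N t \<omega> =
     (if t < 1 then real N powr (-1/2) * cusum X N ((real N + 1) * t) \<omega> else 0)"

end

(*
  Put S(k) = W1(k) for k <= N/2 and S(k) = W1(N/2) + W2(N/2) - W2(N-k) for k > N/2. By independence S
  is a Gaussian walk on 0..N with independent standard increments, so G(k) = N^(-1/2) (S(k) - (k/N) S(N))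
  has the same law on the grid as B(k/N). The CUSUM process is constant on the cells
  [k/(N+1), (k+1)/(N+1)), so its weighted integral is a finite sum with the weights a(k), the integral
  of 1/w over the k-th cell. Three comparisons give the theorem:
  - the approximation rates yield |Z_N - sigma G| <= K min(k, N-k)^zeta / sqrt N on the k-th cell, with
    probability close to one; as zeta < 1/2 this is negligible after weighting, by dominated convergence
    against (t(1-t))^(p/2) / w;
  - the sums of a(k) |G(k)|^p and of a(k) |B(k/N)|^p have the same law, by equality of the characteristic
    functions of all linear combinations;
  - the sums of a(k) |B(k/N)|^p converge in L1 to the integral of |B|^p / w, by Scheffe's lemma, since
    E |B(t)|^p is a multiple of (t(1-t))^(p/2).
*)

theory Submission
  imports Defs
begin

section \<open>Uniqueness of finite-dimensional laws\<close>

text \<open>The weight may vanish at both ends of \<open>[0, 1]\<close>, and \<open>1 / w\<close>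
  need not be integrable there, so a bound on the supremum of the error
  \<open>Z_N - \<sigma> G\<close> is useless near the ends. The error at \<open>k\<close> is
  compared instead with the standard deviation of the bridge at \<open>k / N\<close>. One dominating
  function, \<open>(t (1 - t))^(p/2) / w\<close>, then serves the coupling error, the moments of the
  bridge sums and the Riemann sums. The Wiener processes change with \<open>N\<close> and live on
  another space than \<open>B\<close>, so the passage to \<open>M'\<close> goes through equality of
  laws for fixed \<open>N\<close>; pathwise convergence in \<open>t\<close> is used only for the
  single process \<open>B\<close>. For \<open>p > 1\<close> the map \<open>x \<mapsto> |x|^p\<close>
  is not uniformly continuous: a small error of the path becomes a small error of the sum only up to
  a small multiple of the sum itself. This is why the sums of \<open>a(k) |G(k)|^p\<close> must be
  tight, which is obtained from their first moment on the bridge side.\<close>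

lemma integrable_bounded_mult:
  fixes u v :: "'a \<Rightarrow> real"
  assumes "finite_measure M" "u \<in> borel_measurable M" "v \<in> borel_measurable M"
    and "\<And>x. x \<in> space M \<Longrightarrow> \<bar>u x\<bar> \<le> K" "\<And>x. x \<in> space M \<Longrightarrow> \<bar>v x\<bar> \<le> L"
  shows "integrable M (\<lambda>x. u x * v x)"
proof -
  interpret finite_measure M by fact
  have "AE x in M. norm (u x * v x) \<le> K * L"
    using assms(4,5) by (intro AE_I2) (auto simp: abs_mult intro!: mult_mono intro: order_trans[OF abs_ge_zero])
  then show ?thesis
    using assms(2,3) by (intro integrable_const_bound) auto
qed

lemma integral_Complex:
  assumes "integrable M f" "integrable M g"
  shows "(CLINT x|M. complex_of_real (f x) + \<i> * complex_of_real (g x)) = Complex (LINT x|M. f x) (LINT x|M. g x)"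
  using assms by (simp add: complex_eq_iff)

text \<open>After division by their common mass the weights are probability densities, and the two
  trigonometric hypotheses say that \<open>X\<close> and \<open>Y\<close> have equal characteristic
  functions under the new measures. General weights are allowed because they carry the coordinates
  already treated in the multivariate case.\<close>

lemma weighted_law_eqI:
  fixes X :: "'a \<Rightarrow> real" and Y :: "'b \<Rightarrow> real"
  assumes M1: "prob_space M1" and M2: "prob_space M2"
    and [measurable]: "X \<in> borel_measurable M1" "Y \<in> borel_measurable M2"
      "g \<in> borel_measurable M1" "h \<in> borel_measurable M2"
    and g: "\<And>x. x \<in> space M1 \<Longrightarrow> 0 \<le> g x \<and> g x \<le> K"
    and h: "\<And>x. x \<in> space M2 \<Longrightarrow> 0 \<le> h x \<and> h x \<le> K"
    and cos: "\<And>t. (LINT x|M1. g x * cos (t * X x)) = (LINT x|M2. h x * cos (t * Y x))"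
    and sin: "\<And>t. (LINT x|M1. g x * sin (t * X x)) = (LINT x|M2. h x * sin (t * Y x))"
    and A [measurable]: "A \<in> sets borel"
  shows "(LINT x|M1. g x * indicator A (X x)) = (LINT x|M2. h x * indicator A (Y x))"
proof -
  interpret M1: prob_space M1 by fact
  interpret M2: prob_space M2 by fact
  have fm: "finite_measure M1" "finite_measure M2" by unfold_locales
  have ig: "integrable M1 (\<lambda>x. g x * v x)" if "v \<in> borel_measurable M1" "\<And>x. \<bar>v x\<bar> \<le> 1" for v
    by (rule integrable_bounded_mult[where K=K and L=1]) (use fm that g in auto)
  have ih: "integrable M2 (\<lambda>x. h x * v x)" if "v \<in> borel_measurable M2" "\<And>x. \<bar>v x\<bar> \<le> 1" for v
    by (rule integrable_bounded_mult[where K=K and L=1]) (use fm that h in auto)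
  \<comment> \<open>At \<open>t = 0\<close> the cosine hypothesis says that the two weights have the
    same total mass.\<close>
  define m where "m = (LINT x|M1. g x)"
  have m2: "m = (LINT x|M2. h x)" using cos[of 0] by (simp add: m_def)
  have ig1: "integrable M1 g" and ih1: "integrable M2 h" using ig[of "\<lambda>_. 1"] ih[of "\<lambda>_. 1"] by auto
  have m0: "m \<ge> 0" unfolding m_def by (rule integral_nonneg_AE) (use g in auto)
  show ?thesis
  \<comment> \<open>A zero mass cannot be normalised; both integrals are then squeezed between 0 and
    \<open>m\<close>.\<close>
  proof (cases "m = 0")
    case True
    have "(LINT x|M1. g x * indicator A (X x)) \<le> (LINT x|M1. g x)"
      by (intro integral_mono ig ig1) (use g in \<open>auto simp: indicator_def\<close>)
    moreover have "(LINT x|M1. g x * indicator A (X x)) \<ge> 0"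
      by (rule integral_nonneg_AE) (use g in auto)
    moreover have "(LINT x|M2. h x * indicator A (Y x)) \<le> (LINT x|M2. h x)"
      by (intro integral_mono ih ih1) (use h in \<open>auto simp: indicator_def\<close>)
    moreover have "(LINT x|M2. h x * indicator A (Y x)) \<ge> 0"
      by (rule integral_nonneg_AE) (use h in auto)
    ultimately show ?thesis using True m2 m_def by simp
  next
    case False
    with m0 have mp: "m > 0" by simp
    \<comment> \<open>Stated for an arbitrary space, as it is applied to \<open>M1\<close> and to
      \<open>M2\<close>, whose types differ.\<close>
    have key: "real_distribution (distr (density M (\<lambda>x. ennreal (f x / m))) borel Z) \<and>
       (\<forall>t. char (distr (density M (\<lambda>x. ennreal (f x / m))) borel Z) t =
          Complex ((LINT x|M. f x * cos (t * Z x)) / m) ((LINT x|M. f x * sin (t * Z x)) / m)) \<and>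
       measure (distr (density M (\<lambda>x. ennreal (f x / m))) borel Z) A
          = (LINT x|M. f x * indicator A (Z x)) / m"
      if M: "prob_space M" and f[measurable]: "f \<in> borel_measurable M"
        and fb: "\<And>x. x \<in> space M \<Longrightarrow> 0 \<le> f x \<and> f x \<le> K"
        and Z[measurable]: "Z \<in> borel_measurable M" and fm: "(LINT x|M. f x) = m"
      for M :: "'c measure" and f Z
    proof -
      interpret prob_space M by fact
      have int: "integrable M (\<lambda>x. f x * v x)" if "v \<in> borel_measurable M" "\<And>x. \<bar>v x\<bar> \<le> 1" for v
        by (rule integrable_bounded_mult[where K=K and L=1]) (use fb that finite_measure_axioms in auto)
      have int1: "integrable M f" using int[of "\<lambda>_. 1"] by auto
      let ?D = "density M (\<lambda>x. ennreal (f x / m))"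
      have "emeasure ?D (space ?D) = (\<integral>\<^sup>+x. ennreal (f x / m) \<partial>M)"
        by (subst emeasure_density) (auto intro!: nn_integral_cong simp: indicator_def)
      also have "\<dots> = ennreal (LINT x|M. f x / m)"
        by (intro nn_integral_eq_integral AE_I2) (use fb int1 mp in auto)
      also have "\<dots> = 1" using fm mp by simp
      finally have D: "prob_space ?D" by (rule prob_spaceI)
      have RD: "real_distribution (distr ?D borel Z)"
        by (intro prob_space.real_distribution_distr D) simp
      have ae: "AE x in M. 0 \<le> f x / m" using fb mp by (intro AE_I2) auto
      have c: "char (distr ?D borel Z) t =
          Complex ((LINT x|M. f x * cos (t * Z x)) / m) ((LINT x|M. f x * sin (t * Z x)) / m)" for t
      proof -
        have "char (distr ?D borel Z) t = (CLINT x|?D. iexp (t * Z x))"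
          unfolding char_def by (rule integral_distr) (auto intro!: measurable_compose[OF Z])
        also have "\<dots> = (CLINT x|M. (f x / m) *\<^sub>R iexp (t * Z x))"
          by (rule integral_density) (use ae in auto)
        also have "\<dots> = (CLINT x|M. complex_of_real (f x * cos (t * Z x) / m) + \<i> * complex_of_real (f x * sin (t * Z x) / m))"
          by (intro Bochner_Integration.integral_cong refl)
             (simp add: complex_eq_iff Re_exp Im_exp)
        also have "\<dots> = Complex (LINT x|M. f x * cos (t * Z x) / m) (LINT x|M. f x * sin (t * Z x) / m)"
          by (intro integral_Complex integrable_divide int) auto
        finally show ?thesis by simp
      qed
      interpret D: prob_space ?D by fact
      have "measure (distr ?D borel Z) A = measure ?D (Z -` A \<inter> space M)"
        by (subst measure_distr) auto
      also have "\<dots> = (LINT x|?D. indicator (Z -` A \<inter> space M) x)"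
        by simp
      also have "\<dots> = (LINT x|M. (f x / m) *\<^sub>R indicator (Z -` A \<inter> space M) x)"
        by (rule integral_density) (use ae in auto)
      also have "\<dots> = (LINT x|M. f x * indicator A (Z x) / m)"
        by (intro Bochner_Integration.integral_cong refl) (auto simp: indicator_def)
      finally show ?thesis using RD c by auto
    qed
    have k1: "real_distribution (distr (density M1 (\<lambda>x. ennreal (g x / m))) borel X) \<and>
       (\<forall>t. char (distr (density M1 (\<lambda>x. ennreal (g x / m))) borel X) t =
          Complex ((LINT x|M1. g x * cos (t * X x)) / m) ((LINT x|M1. g x * sin (t * X x)) / m)) \<and>
       measure (distr (density M1 (\<lambda>x. ennreal (g x / m))) borel X) A
          = (LINT x|M1. g x * indicator A (X x)) / m"
      by (rule key) (use g M1 m_def in auto)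
    have k2: "real_distribution (distr (density M2 (\<lambda>x. ennreal (h x / m))) borel Y) \<and>
       (\<forall>t. char (distr (density M2 (\<lambda>x. ennreal (h x / m))) borel Y) t =
          Complex ((LINT x|M2. h x * cos (t * Y x)) / m) ((LINT x|M2. h x * sin (t * Y x)) / m)) \<and>
       measure (distr (density M2 (\<lambda>x. ennreal (h x / m))) borel Y) A
          = (LINT x|M2. h x * indicator A (Y x)) / m"
      by (rule key) (use h M2 m2 in auto)
    have eq: "distr (density M1 (\<lambda>x. ennreal (g x / m))) borel X = distr (density M2 (\<lambda>x. ennreal (h x / m))) borel Y"
      by (rule Levy_uniqueness) (use k1 k2 cos sin in auto)
    have "(LINT x|M1. g x * indicator A (X x)) / m = measure (distr (density M1 (\<lambda>x. ennreal (g x / m))) borel X) A"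
      using k1 by simp
    also have "\<dots> = (LINT x|M2. h x * indicator A (Y x)) / m"
      unfolding eq using k2 by simp
    finally show ?thesis using mp by simp
  qed
qed

text \<open>Adding a frequency in the single coordinate \<open>k\<close> to a linear combination
  gives a linear combination of the same family, so hypotheses that range over all coefficient
  vectors apply to it again.\<close>

lemma sum_fun_upd_add:
  fixes c :: "'i \<Rightarrow> real"
  assumes "finite I" "k \<in> I"
  shows "(\<Sum>j\<in>I. (c(k := c k + t)) j * x j) = (\<Sum>j\<in>I. c j * x j) + t * x k"
proof -
  have "(\<Sum>j\<in>I. (c(k := c k + t)) j * x j) = (\<Sum>j\<in>I. c j * x j + (if j = k then t * x k else 0))"
    by (intro sum.cong refl) (auto simp: algebra_simps)
  also have "\<dots> = (\<Sum>j\<in>I. c j * x j) + t * x k"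
    using assms by (simp add: sum.distrib)
  finally show ?thesis .
qed

text \<open>To insert the indicator of \<open>X k\<close>, the law of \<open>X k\<close> is
  identified under the weight \<open>u * (1 + cos S)\<close>, where \<open>S\<close> is the linear
  combination, and the part coming from \<open>u\<close> alone is subtracted. Testing this weight
  against \<open>cos (t * X k)\<close> and \<open>sin (t * X k)\<close> leads, by the product-to-sum
  formulas, back to linear combinations with the \<open>k\<close>-th coefficient shifted by
  \<open>t\<close> or \<open>-t\<close>. The sine is treated alike.\<close>

lemma indicator_weight_step:
  fixes X :: "'i \<Rightarrow> 'a \<Rightarrow> real" and Y :: "'i \<Rightarrow> 'b \<Rightarrow> real"
  assumes M1: "prob_space M1" and M2: "prob_space M2" and I: "finite I" "k \<in> I"
    and X [measurable]: "\<And>j. j \<in> I \<Longrightarrow> X j \<in> borel_measurable M1"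
    and Y [measurable]: "\<And>j. j \<in> I \<Longrightarrow> Y j \<in> borel_measurable M2"
    and [measurable]: "u \<in> borel_measurable M1" "v \<in> borel_measurable M2"
    and u: "\<And>x. 0 \<le> u x \<and> u x \<le> 1" and v: "\<And>x. 0 \<le> v x \<and> v x \<le> 1"
    and cos: "\<And>c. (LINT x|M1. u x * cos (\<Sum>j\<in>I. c j * X j x)) = (LINT x|M2. v x * cos (\<Sum>j\<in>I. c j * Y j x))"
    and sin: "\<And>c. (LINT x|M1. u x * sin (\<Sum>j\<in>I. c j * X j x)) = (LINT x|M2. v x * sin (\<Sum>j\<in>I. c j * Y j x))"
    and A [measurable]: "A \<in> sets borel"
  shows "(LINT x|M1. u x * indicator A (X k x) * cos (\<Sum>j\<in>I. c j * X j x))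
       = (LINT x|M2. v x * indicator A (Y k x) * cos (\<Sum>j\<in>I. c j * Y j x))"
    and "(LINT x|M1. u x * indicator A (X k x) * sin (\<Sum>j\<in>I. c j * X j x))
       = (LINT x|M2. v x * indicator A (Y k x) * sin (\<Sum>j\<in>I. c j * Y j x))"
proof -
  interpret M1: prob_space M1 by fact
  interpret M2: prob_space M2 by fact
  have [measurable]: "X k \<in> borel_measurable M1" "Y k \<in> borel_measurable M2" using I X Y by auto
  have i1: "integrable M1 (\<lambda>x. u x * f x)" if "f \<in> borel_measurable M1" "\<And>x. \<bar>f x\<bar> \<le> 1" for f
    by (rule integrable_bounded_mult[where K=1 and L=1]) (use M1.finite_measure_axioms that u in auto)
  have i2: "integrable M2 (\<lambda>x. v x * f x)" if "f \<in> borel_measurable M2" "\<And>x. \<bar>f x\<bar> \<le> 1" for f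
    by (rule integrable_bounded_mult[where K=1 and L=1]) (use M2.finite_measure_axioms that v in auto)
  define S1 where "S1 c x = (\<Sum>j\<in>I. c j * X j x)" for c x
  define S2 where "S2 c x = (\<Sum>j\<in>I. c j * Y j x)" for c x
  have [measurable]: "S1 c \<in> borel_measurable M1" "S2 c \<in> borel_measurable M2" for c
    unfolding S1_def S2_def by (auto intro!: borel_measurable_sum borel_measurable_times)
  have cs: "(LINT x|M1. u x * cos (S1 c x)) = (LINT x|M2. v x * cos (S2 c x))"
    "(LINT x|M1. u x * sin (S1 c x)) = (LINT x|M2. v x * sin (S2 c x))" for c
    unfolding S1_def S2_def by (fact cos sin)+
  have S: "S1 c x + t * X k x = S1 (c(k := c k + t)) x" "S2 c y + t * Y k y = S2 (c(k := c k + t)) y"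
    "S1 c x - t * X k x = S1 (c(k := c k - t)) x" "S2 c y - t * Y k y = S2 (c(k := c k - t)) y" for c t x y
    using sum_fun_upd_add[OF I, of c t "\<lambda>j. X j x"] sum_fun_upd_add[OF I, of c t "\<lambda>j. Y j y"]
      sum_fun_upd_add[OF I, of c "-t" "\<lambda>j. X j x"] sum_fun_upd_add[OF I, of c "-t" "\<lambda>j. Y j y"]
    by (simp_all add: S1_def S2_def)
  have t: "S1 (\<lambda>j. 0) x + t * X k x = t * X k x" "S2 (\<lambda>j. 0) y + t * Y k y = t * Y k y" for t x y
    by (simp_all add: S1_def S2_def)
  note T = t[unfolded S]
  \<comment> \<open>The rewriting with \<open>S\<close> absorbs \<open>t * X k\<close> into the
    coefficients, after which \<open>cs\<close> applies to each summand of the product-to-sum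
    formula.\<close>
  have cc: "(LINT x|M1. u x * (cos (S1 c x) * cos (t * X k x))) = (LINT x|M2. v x * (cos (S2 c x) * cos (t * Y k x)))"
   and sc: "(LINT x|M1. u x * (sin (S1 c x) * cos (t * X k x))) = (LINT x|M2. v x * (sin (S2 c x) * cos (t * Y k x)))"
   and cS: "(LINT x|M1. u x * (cos (S1 c x) * sin (t * X k x))) = (LINT x|M2. v x * (cos (S2 c x) * sin (t * Y k x)))"
   and ss: "(LINT x|M1. u x * (sin (S1 c x) * sin (t * X k x))) = (LINT x|M2. v x * (sin (S2 c x) * sin (t * Y k x)))" for c t
    unfolding cos_times_cos sin_times_cos cos_times_sin sin_times_sin S
    by (simp_all add: distrib_left right_diff_distrib add_divide_distrib diff_divide_distrib i1 i2 cs)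
  have C: "(LINT x|M1. u x * cos (t * X k x)) = (LINT x|M2. v x * cos (t * Y k x))"
   and Sn: "(LINT x|M1. u x * sin (t * X k x)) = (LINT x|M2. v x * sin (t * Y k x))" for t
    unfolding T[symmetric] by (simp_all add: cs)
  \<comment> \<open>A cosine or sine changes sign and is no admissible weight. Adding 1 makes it
    nonnegative and at most 2, whence \<open>K=2\<close> below; the contribution of the 1 is
    \<open>r0\<close>.\<close>
  have b0: "0 \<le> u x * (1 + w) \<and> u x * (1 + w) \<le> 2" if "\<bar>w\<bar> \<le> 1" for w x
    using u[of x] that mult_mono[of "u x" 1 "1+w" 2] by auto
  have b0': "0 \<le> v x * (1 + w) \<and> v x * (1 + w) \<le> 2" if "\<bar>w\<bar> \<le> 1" for w x
    using v[of x] that mult_mono[of "v x" 1 "1+w" 2] by auto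
  have r0: "(LINT x|M1. u x * indicator A (X k x)) = (LINT x|M2. v x * indicator A (Y k x))"
    by (rule weighted_law_eqI[OF M1 M2, where K=1]) (use u v C Sn in auto)
  have fin1: "(LINT x|M1. u x * (1 + w x) * indicator A (X k x)) =
    (LINT x|M1. u x * indicator A (X k x)) + (LINT x|M1. u x * indicator A (X k x) * w x)"
    if "w \<in> borel_measurable M1" "\<And>x. \<bar>w x\<bar> \<le> 1" for w
  proof -
    have "(LINT x|M1. u x * (1 + w x) * indicator A (X k x)) =
      (LINT x|M1. u x * indicator A (X k x) + u x * (indicator A (X k x) * w x))"
      by (intro Bochner_Integration.integral_cong refl) (simp add: algebra_simps)
    also have "\<dots> = (LINT x|M1. u x * indicator A (X k x)) + (LINT x|M1. u x * (indicator A (X k x) * w x))"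
      using that by (intro Bochner_Integration.integral_add i1) (auto simp: indicator_def)
    finally show ?thesis by (simp add: mult.assoc)
  qed
  have fin2: "(LINT x|M2. v x * (1 + w x) * indicator A (Y k x)) =
    (LINT x|M2. v x * indicator A (Y k x)) + (LINT x|M2. v x * indicator A (Y k x) * w x)"
    if "w \<in> borel_measurable M2" "\<And>x. \<bar>w x\<bar> \<le> 1" for w
  proof -
    have "(LINT x|M2. v x * (1 + w x) * indicator A (Y k x)) =
      (LINT x|M2. v x * indicator A (Y k x) + v x * (indicator A (Y k x) * w x))"
      by (intro Bochner_Integration.integral_cong refl) (simp add: algebra_simps)
    also have "\<dots> = (LINT x|M2. v x * indicator A (Y k x)) + (LINT x|M2. v x * (indicator A (Y k x) * w x))"
      using that by (intro Bochner_Integration.integral_add i2) (auto simp: indicator_def)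
    finally show ?thesis by (simp add: mult.assoc)
  qed
  have ab: "\<bar>a * b\<bar> \<le> 1" if "\<bar>a\<bar> \<le> 1" "\<bar>b\<bar> \<le> 1" for a b :: real
    using that by (simp add: abs_mult mult_le_one)
  have ex1: "(LINT x|M1. u x * (1 + w x) * z x) = (LINT x|M1. u x * z x) + (LINT x|M1. u x * (w x * z x))"
    if "w \<in> borel_measurable M1" "\<And>x. \<bar>w x\<bar> \<le> 1" "z \<in> borel_measurable M1" "\<And>x. \<bar>z x\<bar> \<le> 1" for w z
    using that by (subst Bochner_Integration.integral_add[symmetric]) (auto intro!: i1 ab simp: algebra_simps)
  have ex2: "(LINT x|M2. v x * (1 + w x) * z x) = (LINT x|M2. v x * z x) + (LINT x|M2. v x * (w x * z x))"
    if "w \<in> borel_measurable M2" "\<And>x. \<bar>w x\<bar> \<le> 1" "z \<in> borel_measurable M2" "\<And>x. \<bar>z x\<bar> \<le> 1" for w z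
    using that by (subst Bochner_Integration.integral_add[symmetric]) (auto intro!: i2 ab simp: algebra_simps)
  have "(LINT x|M1. u x * (1 + cos (S1 c x)) * indicator A (X k x)) = (LINT x|M2. v x * (1 + cos (S2 c x)) * indicator A (Y k x))"
    by (rule weighted_law_eqI[OF M1 M2, where K=2]) (auto simp: b0 b0' ex1 ex2 C Sn cc cS)
  then show "(LINT x|M1. u x * indicator A (X k x) * cos (\<Sum>j\<in>I. c j * X j x))
       = (LINT x|M2. v x * indicator A (Y k x) * cos (\<Sum>j\<in>I. c j * Y j x))"
    unfolding S1_def[symmetric] S2_def[symmetric] by (simp add: fin1 fin2 r0)
  have "(LINT x|M1. u x * (1 + sin (S1 c x)) * indicator A (X k x)) = (LINT x|M2. v x * (1 + sin (S2 c x)) * indicator A (Y k x))"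
    by (rule weighted_law_eqI[OF M1 M2, where K=2]) (auto simp: b0 b0' ex1 ex2 C Sn sc ss)
  then show "(LINT x|M1. u x * indicator A (X k x) * sin (\<Sum>j\<in>I. c j * X j x))
       = (LINT x|M2. v x * indicator A (Y k x) * sin (\<Sum>j\<in>I. c j * Y j x))"
    unfolding S1_def[symmetric] S2_def[symmetric] by (simp add: fin1 fin2 r0)
qed

text \<open>The coordinates are moved one at a time from the characteristic function to an indicator weight;
  each move is an instance of the one-dimensional uniqueness theorem, applied to the positive
  weights \<open>1 + cos\<close> and \<open>1 + sin\<close>.\<close>

theorem Cramer_Wold_uniqueness:
  fixes X :: "'i \<Rightarrow> 'a \<Rightarrow> real" and Y :: "'i \<Rightarrow> 'b \<Rightarrow> real"
  assumes M1: "prob_space M1" and M2: "prob_space M2" and I: "finite I"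
    and X: "\<And>j. j \<in> I \<Longrightarrow> X j \<in> borel_measurable M1"
    and Y: "\<And>j. j \<in> I \<Longrightarrow> Y j \<in> borel_measurable M2"
    and char: "\<And>c. char (distr M1 borel (\<lambda>x. \<Sum>j\<in>I. c j * X j x)) 1
                = char (distr M2 borel (\<lambda>x. \<Sum>j\<in>I. c j * Y j x)) 1"
  shows "distr M1 (Pi\<^sub>M I (\<lambda>_. borel)) (\<lambda>x. \<lambda>j\<in>I. X j x) = distr M2 (Pi\<^sub>M I (\<lambda>_. borel)) (\<lambda>x. \<lambda>j\<in>I. Y j x)"
proof -
  interpret M1: prob_space M1 by fact
  interpret M2: prob_space M2 by fact
  note [measurable] = X Y
  have [measurable]: "(\<lambda>x. \<Sum>j\<in>I. c j * X j x) \<in> borel_measurable M1" "(\<lambda>x. \<Sum>j\<in>I. c j * Y j x) \<in> borel_measurable M2" for c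
    by (auto intro!: borel_measurable_sum borel_measurable_times)
  have ch: "char (distr N borel Z) 1 = Complex (LINT x|N. cos (Z x)) (LINT x|N. sin (Z x))"
    if N: "prob_space N" and Z[measurable]: "Z \<in> borel_measurable N" for N :: "'c measure" and Z
  proof -
    interpret prob_space N by fact
    have "char (distr N borel Z) 1 = (CLINT x|N. iexp (1 * Z x))"
      unfolding char_def by (rule integral_distr) auto
    also have "\<dots> = (CLINT x|N. complex_of_real (cos (Z x)) + \<i> * complex_of_real (sin (Z x)))"
      by (intro Bochner_Integration.integral_cong refl) (simp add: complex_eq_iff Re_exp Im_exp)
    also have "\<dots> = Complex (LINT x|N. cos (Z x)) (LINT x|N. sin (Z x))"
      by (intro integral_Complex integrable_const_bound[where B=1]) auto
    finally show ?thesis .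
  qed
  have base: "(LINT x|M1. cos (\<Sum>j\<in>I. c j * X j x)) = (LINT x|M2. cos (\<Sum>j\<in>I. c j * Y j x))"
    "(LINT x|M1. sin (\<Sum>j\<in>I. c j * X j x)) = (LINT x|M2. sin (\<Sum>j\<in>I. c j * Y j x))" for c
    using char[of c] by (simp_all add: ch M1 M2)
  have ind: "(LINT x|M1. (\<Prod>j\<in>K. indicator (A j) (X j x)) * cos (\<Sum>j\<in>I. c j * X j x))
           = (LINT x|M2. (\<Prod>j\<in>K. indicator (A j) (Y j x)) * cos (\<Sum>j\<in>I. c j * Y j x)) \<and>
       (LINT x|M1. (\<Prod>j\<in>K. indicator (A j) (X j x)) * sin (\<Sum>j\<in>I. c j * X j x))
           = (LINT x|M2. (\<Prod>j\<in>K. indicator (A j) (Y j x)) * sin (\<Sum>j\<in>I. c j * Y j x))"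
    if "finite K" "K \<subseteq> I" and A: "\<And>j. j \<in> I \<Longrightarrow> A j \<in> sets borel" for K A c
    using that(1,2)
  \<comment> \<open>The coefficients stay arbitrary, because moving the coordinate \<open>k\<close>
    uses the induction hypothesis at all frequencies.\<close>
  proof (induction K arbitrary: c rule: finite_induct)
    case empty
    then show ?case using base by simp
  next
    case (insert k K)
    have [measurable]: "j \<in> K \<Longrightarrow> A j \<in> sets borel" "j \<in> K \<Longrightarrow> X j \<in> borel_measurable M1" "j \<in> K \<Longrightarrow> Y j \<in> borel_measurable M2" for j
      using insert A by auto
    have m: "(\<lambda>x. \<Prod>j\<in>K. indicator (A j) (X j x) :: real) \<in> borel_measurable M1"
      "(\<lambda>x. \<Prod>j\<in>K. indicator (A j) (Y j x) :: real) \<in> borel_measurable M2"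
      by (auto intro!: borel_measurable_prod)
    have b: "0 \<le> (\<Prod>j\<in>K. indicator (A j) (Z j) :: real) \<and> (\<Prod>j\<in>K. indicator (A j) (Z j) :: real) \<le> 1" for Z
      by (auto intro!: prod_nonneg prod_le_1)
    have k: "k \<in> I" "K \<subseteq> I" using insert by auto
    note st = indicator_weight_step[OF M1 M2 I k(1) X Y m b b, where A="A k" and c=c]
    have "(LINT x|M1. (\<Prod>j\<in>K. indicator (A j) (X j x)) * indicator (A k) (X k x) * cos (\<Sum>j\<in>I. c j * X j x))
        = (LINT x|M2. (\<Prod>j\<in>K. indicator (A j) (Y j x)) * indicator (A k) (Y k x) * cos (\<Sum>j\<in>I. c j * Y j x))"
      by (rule st) (use insert.IH k A in auto)
    moreover have "(LINT x|M1. (\<Prod>j\<in>K. indicator (A j) (X j x)) * indicator (A k) (X k x) * sin (\<Sum>j\<in>I. c j * X j x))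
        = (LINT x|M2. (\<Prod>j\<in>K. indicator (A j) (Y j x)) * indicator (A k) (Y k x) * sin (\<Sum>j\<in>I. c j * Y j x))"
      by (rule st) (use insert.IH k A in auto)
    ultimately show ?case using insert.hyps by (simp add: mult_ac)
  qed
  show ?thesis
  proof (rule measure_eqI_PiM_finite[OF I, where A="\<lambda>_. Pi\<^sub>E I (\<lambda>_. UNIV)" and M="\<lambda>_. borel"])
    fix A :: "'i \<Rightarrow> real set" assume A: "\<And>i. i \<in> I \<Longrightarrow> A i \<in> sets borel"
    have e: "emeasure (distr N (Pi\<^sub>M I (\<lambda>_. borel)) (\<lambda>x. \<lambda>j\<in>I. Z j x)) (Pi\<^sub>E I A)
        = ennreal (LINT x|N. (\<Prod>j\<in>I. indicator (A j) (Z j x)))"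
      if N: "prob_space N" and Z[measurable]: "\<And>j. j \<in> I \<Longrightarrow> Z j \<in> borel_measurable N" for N :: "'c measure" and Z
    proof -
      interpret prob_space N by fact
      have [measurable]: "Pi\<^sub>E I A \<in> sets (Pi\<^sub>M I (\<lambda>_. borel))" using A I by (intro sets_PiM_I_finite) auto
      have "emeasure (distr N (Pi\<^sub>M I (\<lambda>_. borel)) (\<lambda>x. \<lambda>j\<in>I. Z j x)) (Pi\<^sub>E I A)
         = emeasure N ((\<lambda>x. \<lambda>j\<in>I. Z j x) -` Pi\<^sub>E I A \<inter> space N)"
        by (rule emeasure_distr) auto
      also have "\<dots> = ennreal (LINT x|N. indicator ((\<lambda>x. \<lambda>j\<in>I. Z j x) -` Pi\<^sub>E I A \<inter> space N) x)"
        by (simp add: emeasure_eq_measure)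
      also have "(LINT x|N. indicator ((\<lambda>x. \<lambda>j\<in>I. Z j x) -` Pi\<^sub>E I A \<inter> space N) x) =
        (LINT x|N. (\<Prod>j\<in>I. indicator (A j) (Z j x) :: real))"
      proof (intro Bochner_Integration.integral_cong refl)
        fix x assume x: "x \<in> space N"
        show "indicator ((\<lambda>x. \<lambda>j\<in>I. Z j x) -` Pi\<^sub>E I A \<inter> space N) x = (\<Prod>j\<in>I. indicator (A j) (Z j x) :: real)"
        proof (cases "\<forall>j\<in>I. Z j x \<in> A j")
          case False
          then obtain j where "j \<in> I" "Z j x \<notin> A j" by auto
          then have "(\<Prod>j\<in>I. indicator (A j) (Z j x) :: real) = 0" using I by (intro prod_zero bexI[of _ j]) auto
          moreover have "x \<notin> (\<lambda>x. \<lambda>j\<in>I. Z j x) -` Pi\<^sub>E I A \<inter> space N" using False by (auto simp: PiE_iff)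
          ultimately show ?thesis by simp
        next
          case True
          then have "(\<Prod>j\<in>I. indicator (A j) (Z j x) :: real) = 1" by (intro prod.neutral) auto
          moreover have "x \<in> (\<lambda>x. \<lambda>j\<in>I. Z j x) -` Pi\<^sub>E I A \<inter> space N" using True x by (auto simp: PiE_iff)
          ultimately show ?thesis by simp
        qed
      qed
      finally show ?thesis .
    qed
    \<comment> \<open>With all coordinates moved and \<open>c = 0\<close> the cosine is 1, and what
      remains is the probability of the box.\<close>
    show "emeasure (distr M1 (Pi\<^sub>M I (\<lambda>_. borel)) (\<lambda>x. \<lambda>j\<in>I. X j x)) (Pi\<^sub>E I A)
        = emeasure (distr M2 (Pi\<^sub>M I (\<lambda>_. borel)) (\<lambda>x. \<lambda>j\<in>I. Y j x)) (Pi\<^sub>E I A)"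
      using ind[of I A "\<lambda>_. 0", OF I order_refl A] by (simp add: e M1 M2 X Y)
  next
    show "range (\<lambda>n::nat. Pi\<^sub>E I (\<lambda>_. UNIV :: real set)) \<subseteq> prod_algebra I (\<lambda>_. borel)"
      using I by (auto intro!: prod_algebraI_finite)
    show "(\<Union>n::nat. Pi\<^sub>E I (\<lambda>_. UNIV :: real set)) = space (Pi\<^sub>M I (\<lambda>_. borel))"
      by (auto simp: space_PiM)
    interpret D: prob_space "distr M1 (Pi\<^sub>M I (\<lambda>_. borel)) (\<lambda>x. \<lambda>j\<in>I. X j x)"
      by (rule M1.prob_space_distr) measurable
    show "emeasure (distr M1 (Pi\<^sub>M I (\<lambda>_. borel)) (\<lambda>x. \<lambda>j\<in>I. X j x)) (Pi\<^sub>E I (\<lambda>_. UNIV)) \<noteq> \<infinity>"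
      by simp
  qed auto
qed

section \<open>The bridge built from two Wiener processes\<close>

lemma (in prob_space) char_scaled_normal:
  assumes X: "distributed M lborel X (normal_density 0 s)" and s: "0 < s"
  shows "char (distr M borel (\<lambda>x. c * X x)) t = complex_of_real (exp (- (c * s * t)\<^sup>2 / 2))"
proof -
  have [measurable]: "X \<in> borel_measurable M" using distributed_measurable[OF X] by simp
  have D: "distributed M lborel (\<lambda>x. X x / s) std_normal_density"
    using X normal_standard_normal_convert[OF s, of X 0] by simp
  have "char (distr M borel (\<lambda>x. c * X x)) t = (CLINT x|M. iexp (t * (c * X x)))"
    unfolding char_def by (rule integral_distr) auto
  also have "\<dots> = (CLINT x|M. iexp ((c * s * t) * (X x / s)))"
    using s by (intro Bochner_Integration.integral_cong refl) (simp add: field_simps)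
  also have "\<dots> = char (distr M lborel (\<lambda>x. X x / s)) (c * s * t)"
    unfolding char_def by (rule integral_distr[symmetric]) auto
  also have "distr M lborel (\<lambda>x. X x / s) = std_normal_distribution"
    by (rule distributed_distr_eq_density[OF D])
  finally show ?thesis by (simp add: char_std_normal_distribution)
qed

text \<open>Written through the second moment, the formula also covers the degenerate law: mean 0
  forces the constant to be 0, and both sides are 1. Such laws do occur among linear combinations of
  bridge values, for instance at the times 0 and 1 or with zero coefficients.\<close>

lemma (in prob_space) gaussian_rv_char:
  assumes Y: "gaussian_rv M Y" and mean: "expectation Y = 0"
  shows "integrable M (\<lambda>x. (Y x)\<^sup>2)"
    and "integrable M Y"
    and "char (distr M borel Y) 1 = complex_of_real (exp (- expectation (\<lambda>x. (Y x)\<^sup>2) / 2))"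
proof -
  have [measurable]: "Y \<in> borel_measurable M" using Y by (simp add: gaussian_rv_def)
  have "integrable M (\<lambda>x. (Y x)\<^sup>2) \<and> char (distr M borel Y) 1 = complex_of_real (exp (- expectation (\<lambda>x. (Y x)\<^sup>2) / 2))"
  proof (cases "\<exists>m s. s > 0 \<and> distributed M lborel Y (normal_density m s)")
    case True
    then obtain m s where s: "s > 0" and D: "distributed M lborel Y (normal_density m s)" by auto
    with mean have m: "m = 0" using normal_distributed_expectation by auto
    have "integrable M (\<lambda>x. (Y x)\<^sup>2)"
      using integrable_normal_moment[OF s, of m 2] m
      by (subst distributed_integrable[OF D, symmetric]) auto
    moreover have "expectation (\<lambda>x. (Y x)\<^sup>2) = s\<^sup>2"
      using normal_distributed_variance[OF s D] mean by simp
    ultimately show ?thesis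
      using char_scaled_normal[of Y s 1 1] D s m by simp
  next
    case False
    then obtain m where m: "AE x in M. Y x = m" using Y by (auto simp: gaussian_rv_def)
    have "expectation Y = expectation (\<lambda>x. m)" by (rule integral_cong_AE) (use m in auto)
    then have m0: "m = 0" using mean by (simp add: prob_space)
    have sq: "AE x in M. (Y x)\<^sup>2 = 0" using m m0 by auto
    have "integrable M (\<lambda>x. (Y x)\<^sup>2)" using sq by (subst integrable_cong_AE[where g="\<lambda>_. 0"]) auto
    moreover have "expectation (\<lambda>x. (Y x)\<^sup>2) = 0"
      using integral_cong_AE[of "\<lambda>x. (Y x)\<^sup>2" M "\<lambda>_. 0"] sq by simp
    moreover have "char (distr M borel Y) 1 = (CLINT x|M. iexp (1 * Y x))"
      unfolding char_def by (rule integral_distr) auto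
    moreover have "(CLINT x|M. iexp (1 * Y x)) = (CLINT x|M. 1)"
      by (rule integral_cong_AE) (use m m0 in auto)
    ultimately show ?thesis by (simp add: prob_space)
  qed
  then show "integrable M (\<lambda>x. (Y x)\<^sup>2)"
    "char (distr M borel Y) 1 = complex_of_real (exp (- expectation (\<lambda>x. (Y x)\<^sup>2) / 2))" by auto
  then have "integrable M (\<lambda>x. 1 + (Y x)\<^sup>2)" by simp
  then show "integrable M Y"
  proof (rule Bochner_Integration.integrable_bound)
    have "\<bar>y\<bar> \<le> 1 + y\<^sup>2" for y :: real
      using zero_le_power2[of "\<bar>y\<bar> - 1"] zero_le_power2[of y]
      unfolding power2_diff by (simp add: algebra_simps)
    then show "AE x in M. norm (Y x) \<le> norm (1 + (Y x)\<^sup>2)" by (auto intro!: AE_I2)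
  qed simp
qed

section \<open>Characteristic functions of the glued Wiener increments\<close>

lemma wiener_measurable:
  "wiener_process M T W \<Longrightarrow> 0 \<le> t \<Longrightarrow> t \<le> T \<Longrightarrow> W t \<in> borel_measurable M"
  by (simp add: wiener_process_def)

lemma wiener_increments_char:
  assumes W: "wiener_process M T W"
    and t: "0 \<le> t 0" "\<And>i. i < n \<Longrightarrow> t i < t (Suc i)" "t n \<le> T"
  shows "char (distr M borel (\<lambda>\<omega>. \<Sum>i<n. c i * (W (t (Suc i)) \<omega> - W (t i) \<omega>))) 1
    = complex_of_real (exp (- (\<Sum>i<n. (c i)\<^sup>2 * (t (Suc i) - t i)) / 2))"
proof -
  interpret prob_space M using W by (simp add: wiener_process_def)
  have le: "t i \<le> t j" if "i \<le> j" "j \<le> n" for i j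
    using that
  proof (induction j)
    case (Suc j)
    then show ?case using t(2)[of j] by (cases "i = Suc j") auto
  qed simp
  have "indep_vars (\<lambda>_. borel) (\<lambda>i \<omega>. W (t (Suc i)) \<omega> - W (t i) \<omega>) {..<n}"
    using W t by (auto simp: wiener_process_def)
  then have "indep_vars (\<lambda>_. borel) (\<lambda>i \<omega>. c i * (W (t (Suc i)) \<omega> - W (t i) \<omega>)) {..<n}"
    by (rule indep_vars_compose2) auto
  then have "char (distr M borel (\<lambda>\<omega>. \<Sum>i<n. c i * (W (t (Suc i)) \<omega> - W (t i) \<omega>))) 1
     = (\<Prod>i<n. char (distr M borel (\<lambda>\<omega>. c i * (W (t (Suc i)) \<omega> - W (t i) \<omega>))) 1)"
    by (rule char_distr_sum)
  also have "\<dots> = (\<Prod>i<n. complex_of_real (exp (- ((c i)\<^sup>2 * (t (Suc i) - t i)) / 2)))"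
  proof (rule prod.cong[OF refl])
    fix i assume i: "i \<in> {..<n}"
    have "distributed M lborel (\<lambda>\<omega>. W (t (Suc i)) \<omega> - W (t i) \<omega>) (normal_density 0 (sqrt (t (Suc i) - t i)))"
      using W t(1) t(3) t(2)[of i] i le[of 0 i] le[of "Suc i" n] by (auto simp: wiener_process_def)
    from char_scaled_normal[OF this, of "c i" 1] t(2)[of i] i
    show "char (distr M borel (\<lambda>\<omega>. c i * (W (t (Suc i)) \<omega> - W (t i) \<omega>))) 1
      = complex_of_real (exp (- ((c i)\<^sup>2 * (t (Suc i) - t i)) / 2))"
      by (simp add: power_mult_distrib)
  qed
  also have "\<dots> = complex_of_real (exp (\<Sum>i<n. - ((c i)\<^sup>2 * (t (Suc i) - t i)) / 2))"
    by (simp add: exp_sum)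
  finally show ?thesis by (simp add: sum_negf sum_divide_distrib)
qed

text \<open>Half-integer steps are used because \<open>N / 2\<close>, where the two processes are glued together,
  need not be an integer.\<close>

definition half_step ::
  "nat \<Rightarrow> (real \<Rightarrow> 'a \<Rightarrow> real) \<Rightarrow> (real \<Rightarrow> 'a \<Rightarrow> real) \<Rightarrow> nat \<Rightarrow> 'a \<Rightarrow> real" where
  "half_step N W1 W2 l \<omega> =
     (if l < N then W1 (real (Suc l) / 2) \<omega> - W1 (real l / 2) \<omega>
      else W2 (real (2 * N - l) / 2) \<omega> - W2 (real (2 * N - Suc l) / 2) \<omega>)"

lemma half_step_measurable:
  assumes "wiener_process M (real N / 2) W1" "wiener_process M (real N / 2) W2" "l < 2 * N"
  shows "half_step N W1 W2 l \<in> borel_measurable M"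
  using assms unfolding half_step_def
  by (cases "l < N") (auto intro!: borel_measurable_diff wiener_measurable)

text \<open>Each half step is centred normal with variance 1/2, which together with the 1/2 in the
  exponent gives the 4. Independence within each half is independence of increments; between the
  halves it is independence of the two processes, transferred to measurable functionals of the
  restricted paths.\<close>

lemma half_steps_char:
  assumes W1: "wiener_process M (real N / 2) W1" and W2: "wiener_process M (real N / 2) W2"
    and ind: "indep_processes M (real N / 2) W1 W2"
  shows "char (distr M borel (\<lambda>\<omega>. \<Sum>l<2*N. d l * half_step N W1 W2 l \<omega>)) 1
    = complex_of_real (exp (- (\<Sum>l<2*N. (d l)\<^sup>2) / 4))"
proof -
  interpret prob_space M using W1 by (simp add: wiener_process_def)
  define P where "P = Pi\<^sub>M {0..real N / 2} (\<lambda>_. borel :: real measure)"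
  \<comment> \<open>Both halves are values of this one functional. \<open>W2\<close> is run from the
    right end, so its increment number \<open>l\<close> is the half step
    \<open>2 * N - Suc l\<close>, and its coefficients are the reversed ones
    \<open>d'\<close>.\<close>
  define F where "F d f = (\<Sum>l<N. d l * (f (real (Suc l) / 2) - f (real l / 2)))" for d :: "nat \<Rightarrow> real" and f :: "real \<Rightarrow> real"
  define d' where "d' l = d (2 * N - Suc l)" for l
  have F [measurable]: "F d \<in> borel_measurable P" for d
    unfolding F_def P_def
    by (intro borel_measurable_sum borel_measurable_times borel_measurable_diff measurable_component_singleton) auto
  have "(\<Sum>l<2*N. d l * half_step N W1 W2 l \<omega>) = F d (\<lambda>t. W1 t \<omega>) + F d' (\<lambda>t. W2 t \<omega>)" for \<omega>
  proof -
    have "(\<Sum>l<2*N. d l * half_step N W1 W2 l \<omega>) =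
       (\<Sum>l<N. d l * half_step N W1 W2 l \<omega>) + (\<Sum>l\<in>{N..<2*N}. d l * half_step N W1 W2 l \<omega>)"
      by (subst sum.union_disjoint[symmetric]) (auto intro!: sum.cong)
    also have "(\<Sum>l<N. d l * half_step N W1 W2 l \<omega>) = F d (\<lambda>t. W1 t \<omega>)"
      unfolding F_def by (intro sum.cong) (auto simp: half_step_def)
    also have "(\<Sum>l\<in>{N..<2*N}. d l * half_step N W1 W2 l \<omega>) = F d' (\<lambda>t. W2 t \<omega>)"
      unfolding F_def
      by (rule sum.reindex_bij_witness[where i="\<lambda>l. 2*N - Suc l" and j="\<lambda>l. 2*N - Suc l"])
         (auto simp: half_step_def d'_def Suc_diff_Suc)
    finally show ?thesis .
  qed
  moreover have "indep_var borel (\<lambda>\<omega>. F d (\<lambda>t. W1 t \<omega>)) borel (\<lambda>\<omega>. F d' (\<lambda>t. W2 t \<omega>))"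
  proof -
    have "indep_var borel (F d \<circ> (\<lambda>\<omega>. \<lambda>t\<in>{0..real N / 2}. W1 t \<omega>)) borel (F d' \<circ> (\<lambda>\<omega>. \<lambda>t\<in>{0..real N / 2}. W2 t \<omega>))"
      using ind unfolding indep_processes_def P_def[symmetric] by (rule indep_var_compose) auto
    also have "F d \<circ> (\<lambda>\<omega>. \<lambda>t\<in>{0..real N / 2}. W1 t \<omega>) = (\<lambda>\<omega>. F d (\<lambda>t. W1 t \<omega>))"
      by (auto simp: F_def fun_eq_iff intro!: sum.cong)
    also have "F d' \<circ> (\<lambda>\<omega>. \<lambda>t\<in>{0..real N / 2}. W2 t \<omega>) = (\<lambda>\<omega>. F d' (\<lambda>t. W2 t \<omega>))"
      by (auto simp: F_def fun_eq_iff intro!: sum.cong)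
    finally show ?thesis .
  qed
  ultimately have "char (distr M borel (\<lambda>\<omega>. \<Sum>l<2*N. d l * half_step N W1 W2 l \<omega>)) 1 =
    char (distr M borel (\<lambda>\<omega>. F d (\<lambda>t. W1 t \<omega>))) 1 * char (distr M borel (\<lambda>\<omega>. F d' (\<lambda>t. W2 t \<omega>))) 1"
    by (simp add: char_distr_add)
  also have "char (distr M borel (\<lambda>\<omega>. F d (\<lambda>t. W1 t \<omega>))) 1 = complex_of_real (exp (- (\<Sum>l<N. (d l)\<^sup>2 * (real (Suc l) / 2 - real l / 2)) / 2))"
    unfolding F_def by (rule wiener_increments_char[OF W1]) auto
  also have "char (distr M borel (\<lambda>\<omega>. F d' (\<lambda>t. W2 t \<omega>))) 1 = complex_of_real (exp (- (\<Sum>l<N. (d' l)\<^sup>2 * (real (Suc l) / 2 - real l / 2)) / 2))"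
    unfolding F_def by (rule wiener_increments_char[OF W2]) auto
  also have "(\<Sum>l<N. (d' l)\<^sup>2 * (real (Suc l) / 2 - real l / 2)) = (\<Sum>l\<in>{N..<2*N}. (d l)\<^sup>2 * (1/2))"
    by (rule sum.reindex_bij_witness[where i="\<lambda>l. 2*N - Suc l" and j="\<lambda>l. 2*N - Suc l"])
       (auto simp: d'_def Suc_diff_Suc add_divide_distrib)
  also have "(\<Sum>l<N. (d l)\<^sup>2 * (real (Suc l) / 2 - real l / 2)) = (\<Sum>l<N. (d l)\<^sup>2 * (1/2))"
    by (simp add: add_divide_distrib)
  finally have "char (distr M borel (\<lambda>\<omega>. \<Sum>l<2*N. d l * half_step N W1 W2 l \<omega>)) 1 =
    complex_of_real (exp (- (\<Sum>l<N. (d l)\<^sup>2 * (1/2)) / 2 + - (\<Sum>l\<in>{N..<2*N}. (d l)\<^sup>2 * (1/2)) / 2))"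
    by (simp only: exp_add of_real_mult)
  also have "- (\<Sum>l<N. (d l)\<^sup>2 * (1/2)) / 2 + - (\<Sum>l\<in>{N..<2*N}. (d l)\<^sup>2 * (1/2)) / 2 = - ((\<Sum>l<N. (d l)\<^sup>2) + (\<Sum>l\<in>{N..<2*N}. (d l)\<^sup>2)) / 4"
    by (simp add: sum_divide_distrib[symmetric])
  also have "(\<Sum>l<N. (d l)\<^sup>2) + (\<Sum>l\<in>{N..<2*N}. (d l)\<^sup>2) = (\<Sum>l<2*N. (d l)\<^sup>2)"
    by (subst sum.union_disjoint[symmetric]) (auto intro!: sum.cong)
  finally show ?thesis .
qed

text \<open>The \<open>G(k)\<close> of the overview; the integer time \<open>k\<close> is reached
  after \<open>2 * k\<close> half steps. Using increments only, one formula serves both halves and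
  the law can be read off from \<open>half_steps_char\<close>; the starting values of the Wiener
  processes enter later, in the pathwise comparison with the partial sums.\<close>

definition walk_bridge ::
  "nat \<Rightarrow> (real \<Rightarrow> 'a \<Rightarrow> real) \<Rightarrow> (real \<Rightarrow> 'a \<Rightarrow> real) \<Rightarrow> nat \<Rightarrow> 'a \<Rightarrow> real" where
  "walk_bridge N W1 W2 k \<omega> =
     ((\<Sum>l<2*k. half_step N W1 W2 l \<omega>) - real k / real N * (\<Sum>l<2*N. half_step N W1 W2 l \<omega>)) / sqrt (real N)"

lemma walk_bridge_measurable:
  assumes "wiener_process M (real N / 2) W1" "wiener_process M (real N / 2) W2" "k \<le> N"
  shows "walk_bridge N W1 W2 k \<in> borel_measurable M"
proof -
  have "(\<lambda>\<omega>. \<Sum>l<2*j. half_step N W1 W2 l \<omega>) \<in> borel_measurable M" if "j \<le> N" for j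
    using that by (intro borel_measurable_sum half_step_measurable[OF assms(1,2)]) auto
  from this[of k] this[of N] assms(3) show ?thesis
    unfolding walk_bridge_def by simp
qed

text \<open>Bridge values are linear in the half steps, so the covariance reduces to inner products
  of coefficient vectors. These equal \<open>2 * N\<close> times the bridge covariance; the factor
  is cancelled by the normalisation \<open>1 / N\<close> and by the variance 1/2 of a half
  step.\<close>

lemma walk_bridge_char:
  assumes W1: "wiener_process M (real N / 2) W1" and W2: "wiener_process M (real N / 2) W2"
    and ind: "indep_processes M (real N / 2) W1 W2" and K: "K \<subseteq> {..N}" and N: "N > 0"
  shows "char (distr M borel (\<lambda>\<omega>. \<Sum>k\<in>K. c k * walk_bridge N W1 W2 k \<omega>)) 1
    = complex_of_real (exp (- (\<Sum>j\<in>K. \<Sum>k\<in>K. c j * c k *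
        (min (real j / real N) (real k / real N) - real j / real N * (real k / real N))) / 2))"
proof -
  \<comment> \<open>\<open>e k l\<close> is the coefficient of the half step \<open>l\<close> in
    \<open>sqrt N * walk_bridge k\<close>, and \<open>d l\<close> its coefficient in the whole
    linear combination.\<close>
  define e where "e k l = of_bool (l < 2 * k) - real k / real N" for k l :: nat
  define d where "d l = (\<Sum>k\<in>K. c k * e k l) / sqrt (real N)" for l
  have wb: "walk_bridge N W1 W2 k \<omega> = (\<Sum>l<2*N. e k l * half_step N W1 W2 l \<omega>) / sqrt (real N)" if "k \<le> N" for k \<omega>
  proof -
    have "(\<Sum>l<2*k. half_step N W1 W2 l \<omega>) = (\<Sum>l<2*N. of_bool (l < 2 * k) * half_step N W1 W2 l \<omega>)"
      by (rule sum.mono_neutral_cong_left) (use that in auto)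
    then show ?thesis
      by (simp add: walk_bridge_def e_def left_diff_distrib sum_subtractf sum_distrib_left mult.assoc)
  qed
  have ee: "(\<Sum>l<2*N. e j l * e k l) = 2 * real N * (min (real j / real N) (real k / real N) - real j / real N * (real k / real N))"
    if "j \<le> N" "k \<le> N" for j k
  proof -
    have ob: "(\<Sum>l<2*N. of_bool (l < 2 * i) :: real) = 2 * real i" if "i \<le> N" for i
    proof -
      have "(\<Sum>l<2*N. of_bool (l < 2 * i) :: real) = (\<Sum>l<2*i. 1)"
        by (rule sum.mono_neutral_cong_right) (use that in auto)
      then show ?thesis by simp
    qed
    have "(\<Sum>l<2*N. e j l * e k l) = (\<Sum>l<2*N. of_bool (l < 2 * min j k) - real k / real N * of_bool (l < 2 * j)
        - real j / real N * of_bool (l < 2 * k) + real j / real N * (real k / real N))"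
      by (intro sum.cong refl) (auto simp: e_def algebra_simps min_def)
    also have "\<dots> = 2 * real (min j k) - real k / real N * (2 * real j) - real j / real N * (2 * real k) + 2 * real N * (real j / real N * (real k / real N))"
      using that by (simp add: sum.distrib sum_subtractf sum_distrib_left[symmetric] sum_divide_distrib[symmetric] ob del: sum_of_bool_eq)
    also have "\<dots> = 2 * real N * (min (real j / real N) (real k / real N) - real j / real N * (real k / real N))"
      using N by (auto simp: field_simps min_def)
    finally show ?thesis .
  qed
  have "(\<Sum>k\<in>K. c k * walk_bridge N W1 W2 k \<omega>) = (\<Sum>l<2*N. d l * half_step N W1 W2 l \<omega>)" for \<omega>
  proof -
    have "(\<Sum>k\<in>K. c k * walk_bridge N W1 W2 k \<omega>) = (\<Sum>k\<in>K. \<Sum>l<2*N. c k * e k l * half_step N W1 W2 l \<omega> / sqrt (real N))"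
      using K by (intro sum.cong refl) (auto simp: wb subset_eq sum_distrib_left sum_divide_distrib mult_ac)
    also have "\<dots> = (\<Sum>l<2*N. \<Sum>k\<in>K. c k * e k l * half_step N W1 W2 l \<omega> / sqrt (real N))"
      by (rule sum.swap)
    finally show ?thesis
      by (simp add: d_def sum_distrib_left sum_distrib_right sum_divide_distrib mult_ac)
  qed
  then have "char (distr M borel (\<lambda>\<omega>. \<Sum>k\<in>K. c k * walk_bridge N W1 W2 k \<omega>)) 1 = complex_of_real (exp (- (\<Sum>l<2*N. (d l)\<^sup>2) / 4))"
    using half_steps_char[OF W1 W2 ind, of d] by simp
  also have "(\<Sum>l<2*N. (d l)\<^sup>2) = (\<Sum>l<2*N. \<Sum>j\<in>K. \<Sum>k\<in>K. c j * c k * (e j l * e k l) / real N)"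
  proof (intro sum.cong refl)
    fix l
    have "(d l)\<^sup>2 = (\<Sum>j\<in>K. c j * e j l) * (\<Sum>k\<in>K. c k * e k l) / real N"
      by (simp add: d_def power_divide power2_eq_square)
    then show "(d l)\<^sup>2 = (\<Sum>j\<in>K. \<Sum>k\<in>K. c j * c k * (e j l * e k l) / real N)"
      by (simp add: sum_product sum_divide_distrib mult_ac)
  qed
  also have "\<dots> = (\<Sum>j\<in>K. \<Sum>l<2*N. \<Sum>k\<in>K. c j * c k * (e j l * e k l) / real N)"
    by (rule sum.swap)
  also have "\<dots> = (\<Sum>j\<in>K. \<Sum>k\<in>K. \<Sum>l<2*N. c j * c k * (e j l * e k l) / real N)"
    by (intro sum.cong refl sum.swap)
  also have "\<dots> = (\<Sum>j\<in>K. \<Sum>k\<in>K. c j * c k / real N * (\<Sum>l<2*N. e j l * e k l))"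
    by (intro sum.cong refl) (simp add: sum_distrib_left)
  also have "\<dots> = (\<Sum>j\<in>K. \<Sum>k\<in>K. 2 * (c j * c k * (min (real j / real N) (real k / real N) - real j / real N * (real k / real N))))"
    using K N by (intro sum.cong refl) (simp add: ee subset_eq)
  also have "\<dots> = 2 * (\<Sum>j\<in>K. \<Sum>k\<in>K. c j * c k * (min (real j / real N) (real k / real N) - real j / real N * (real k / real N)))"
    by (simp add: sum_distrib_left)
  finally show ?thesis by simp
qed

section \<open>Finite-dimensional laws of the bridge on the grid\<close>

lemma brownian_bridge_gaussian_sum:
  assumes "brownian_bridge M B" "finite J" "J \<subseteq> {0..1}"
  shows "gaussian_rv M (\<lambda>\<omega>. \<Sum>s\<in>J. c s * B s \<omega>)"
  using assms by (simp add: brownian_bridge_def gaussian_process_def)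

lemma brownian_bridge_mean:
  assumes "brownian_bridge M B" "t \<in> {0..1}"
  shows "prob_space.expectation M (B t) = 0"
  using assms by (simp add: brownian_bridge_def)

lemma brownian_bridge_covariance:
  assumes B: "brownian_bridge M B" and st: "s \<in> {0..1}" "t \<in> {0..1}"
  shows "prob_space.expectation M (\<lambda>\<omega>. B s \<omega> * B t \<omega>) = min s t - s * t"
proof -
  have "\<forall>s\<in>{0..1}. \<forall>t\<in>{0..1}. prob_space.expectation M (\<lambda>\<omega>. B s \<omega> * B t \<omega>) = min s t - s * t"
    using B by (simp add: brownian_bridge_def)
  then show ?thesis using st by blast
qed

lemma brownian_bridge_gaussian_rv:
  assumes B: "brownian_bridge M B" and t: "t \<in> {0..1}"
  shows "gaussian_rv M (B t)"
  using brownian_bridge_gaussian_sum[OF B, of "{t}" "\<lambda>_. 1"] t by simp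

text \<open>A centred Gaussian combination is determined by its variance, which expands into
  covariances. The right-hand side is literally that of \<open>walk_bridge_char\<close>, so that the
  two can be equated.\<close>

lemma brownian_bridge_char:
  assumes B: "brownian_bridge M B" and K: "K \<subseteq> {..N}" and N: "N > 0"
  shows "char (distr M borel (\<lambda>\<omega>. \<Sum>k\<in>K. c k * B (real k / real N) \<omega>)) 1
    = complex_of_real (exp (- (\<Sum>j\<in>K. \<Sum>k\<in>K. c j * c k *
        (min (real j / real N) (real k / real N) - real j / real N * (real k / real N))) / 2))"
proof -
  interpret prob_space M using B by (simp add: brownian_bridge_def)
  have fin: "finite K" using K finite_subset by blast
  let ?t = "\<lambda>k. real k / real N"
  have t: "?t k \<in> {0..1}" if "k \<in> K" for k using that K N by auto
  have inj: "inj_on ?t K" using N by (auto simp: inj_on_def)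
  let ?Y = "\<lambda>\<omega>. \<Sum>k\<in>K. c k * B (?t k) \<omega>"
  \<comment> \<open>\<open>gaussian_process\<close> speaks of sums over sets of times; the
    coefficients are carried from indices to times along the injection
    \<open>k \<mapsto> k / N\<close>.\<close>
  have "gaussian_rv M (\<lambda>\<omega>. \<Sum>s\<in>?t ` K. c (inv_into K ?t s) * B s \<omega>)"
    by (rule brownian_bridge_gaussian_sum[OF B]) (use fin t in auto)
  also have "(\<lambda>\<omega>. \<Sum>s\<in>?t ` K. c (inv_into K ?t s) * B s \<omega>) = ?Y"
    using inv_into_f_f[OF inj] by (intro ext) (simp add: sum.reindex[OF inj])
  finally have g: "gaussian_rv M ?Y" .
  have mB: "expectation (B (?t k)) = 0" if "k \<in> K" for k
    by (rule brownian_bridge_mean[OF B t[OF that]])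
  have cov: "expectation (\<lambda>\<omega>. B (?t j) \<omega> * B (?t k) \<omega>) = min (?t j) (?t k) - ?t j * ?t k" if "j \<in> K" "k \<in> K" for j k
    by (rule brownian_bridge_covariance[OF B t[OF that(1)] t[OF that(2)]])
  note gB = gaussian_rv_char[OF brownian_bridge_gaussian_rv[OF B t] mB]
  have [measurable]: "B (?t k) \<in> borel_measurable M" if "k \<in> K" for k
    using gB(2)[OF that that] by simp
  have ii: "integrable M (\<lambda>\<omega>. B (?t j) \<omega> * B (?t k) \<omega>)" if "j \<in> K" "k \<in> K" for j k
  proof (rule Bochner_Integration.integrable_bound)
    show "integrable M (\<lambda>\<omega>. (B (?t j) \<omega>)\<^sup>2 + (B (?t k) \<omega>)\<^sup>2)" using gB(1) that by auto
    have "\<bar>a * b\<bar> \<le> a\<^sup>2 + b\<^sup>2" for a b :: real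
      using sum_squares_bound[of "\<bar>a\<bar>" "\<bar>b\<bar>"] mult_nonneg_nonneg[of "\<bar>a\<bar>" "\<bar>b\<bar>"]
      unfolding abs_mult power2_abs by linarith
    then show "AE \<omega> in M. norm (B (?t j) \<omega> * B (?t k) \<omega>) \<le> norm ((B (?t j) \<omega>)\<^sup>2 + (B (?t k) \<omega>)\<^sup>2)" by auto
  qed (use that in measurable)
  have "expectation ?Y = (\<Sum>k\<in>K. c k * expectation (B (?t k)))"
    using gB(2) by (subst Bochner_Integration.integral_sum) auto
  then have mean: "expectation ?Y = 0" using mB by simp
  have "expectation (\<lambda>\<omega>. (?Y \<omega>)\<^sup>2) = expectation (\<lambda>\<omega>. \<Sum>j\<in>K. \<Sum>k\<in>K. c j * c k * (B (?t j) \<omega> * B (?t k) \<omega>))"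
    by (simp add: power2_eq_square sum_product mult_ac)
  also have "\<dots> = (\<Sum>j\<in>K. expectation (\<lambda>\<omega>. \<Sum>k\<in>K. c j * c k * (B (?t j) \<omega> * B (?t k) \<omega>)))"
    by (intro Bochner_Integration.integral_sum Bochner_Integration.integrable_sum integrable_mult_right ii)
  also have "\<dots> = (\<Sum>j\<in>K. \<Sum>k\<in>K. expectation (\<lambda>\<omega>. c j * c k * (B (?t j) \<omega> * B (?t k) \<omega>)))"
    by (intro sum.cong refl Bochner_Integration.integral_sum integrable_mult_right ii)
  also have "\<dots> = (\<Sum>j\<in>K. \<Sum>k\<in>K. c j * c k * expectation (\<lambda>\<omega>. B (?t j) \<omega> * B (?t k) \<omega>))"
    by (intro sum.cong refl integral_mult_right_zero)
  also have "\<dots> = (\<Sum>j\<in>K. \<Sum>k\<in>K. c j * c k * (min (?t j) (?t k) - ?t j * ?t k))"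
    using cov by (intro sum.cong refl) simp
  finally show ?thesis using gaussian_rv_char(3)[OF g mean] by simp
qed

text \<open>The two grids agree in all linear combinations, hence in joint law, hence in the law of
  every measurable function of the grid values. This is the only bridge between \<open>M\<close> and
  \<open>M'\<close>.\<close>

theorem walk_bridge_law:
  assumes W1: "wiener_process M (real N / 2) W1" and W2: "wiener_process M (real N / 2) W2"
    and ind: "indep_processes M (real N / 2) W1 W2" and B: "brownian_bridge M' B"
    and K: "K \<subseteq> {..N}" and N: "N > 0" and F: "F \<in> borel_measurable (Pi\<^sub>M K (\<lambda>_. borel))"
  shows "distr M borel (\<lambda>\<omega>. F (\<lambda>k\<in>K. walk_bridge N W1 W2 k \<omega>)) = distr M' borel (\<lambda>\<omega>. F (\<lambda>k\<in>K. B (real k / real N) \<omega>))"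
proof -
  have [measurable]: "k \<in> K \<Longrightarrow> walk_bridge N W1 W2 k \<in> borel_measurable M" for k
    using K walk_bridge_measurable[OF W1 W2] by auto
  have [measurable]: "k \<in> K \<Longrightarrow> B (real k / real N) \<in> borel_measurable M'" for k
    using K N brownian_bridge_gaussian_rv[OF B, of "real k / real N"] by (auto simp: gaussian_rv_def)
  have "distr M (Pi\<^sub>M K (\<lambda>_. borel)) (\<lambda>\<omega>. \<lambda>k\<in>K. walk_bridge N W1 W2 k \<omega>) = distr M' (Pi\<^sub>M K (\<lambda>_. borel)) (\<lambda>\<omega>. \<lambda>k\<in>K. B (real k / real N) \<omega>)"
  proof (rule Cramer_Wold_uniqueness)
    show "prob_space M" "prob_space M'" using W1 B by (auto simp: wiener_process_def brownian_bridge_def)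
    show "finite K" using K finite_subset by blast
  qed (simp_all add: walk_bridge_char[OF W1 W2 ind K N] brownian_bridge_char[OF B K N])
  then have "distr (distr M (Pi\<^sub>M K (\<lambda>_. borel)) (\<lambda>\<omega>. \<lambda>k\<in>K. walk_bridge N W1 W2 k \<omega>)) borel F = distr (distr M' (Pi\<^sub>M K (\<lambda>_. borel)) (\<lambda>\<omega>. \<lambda>k\<in>K. B (real k / real N) \<omega>)) borel F"
    by simp
  then show ?thesis using F by (simp add: distr_distr comp_def)
qed

section \<open>Weighted integrals of step functions\<close>

definition cell :: "nat \<Rightarrow> real \<Rightarrow> nat" where
  "cell N t = nat \<lfloor>(real N + 1) * t\<rfloor>"

text \<open>The indices 0 and \<open>N\<close> are cut off because the CUSUM process vanishes there;
  on \<open>[0, 1]\<close> the index \<open>N + 1\<close> arises only at \<open>t = 1\<close>. The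
  cut confines the function to times between \<open>1 / (N + 1)\<close> and
  \<open>N / (N + 1)\<close>, away from the zeros of the weight.\<close>

definition step :: "nat \<Rightarrow> (nat \<Rightarrow> real) \<Rightarrow> real \<Rightarrow> real" where
  "step N G t = (if cell N t \<in> {1..<N} then G (cell N t) else 0)"

lemma step_eq_sum: "step N G t = (\<Sum>k\<in>{1..<N}. G k * of_bool (cell N t = k))"
proof -
  have "(\<Sum>k\<in>{1..<N}. G k * of_bool (cell N t = k)) = (\<Sum>k\<in>{1..<N}. if k = cell N t then G k else 0)"
    by (intro sum.cong) auto
  then show ?thesis by (simp add: step_def)
qed

lemma measurable_cell [measurable]: "cell N \<in> measurable borel (count_space UNIV)"
  unfolding cell_def by measurable

lemma measurable_step [measurable]: "step N G \<in> borel_measurable borel"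
  unfolding step_def[abs_def]
  by (rule measurable_compose[OF measurable_cell, where g="\<lambda>k. if k \<in> {1..<N} then G k else 0"]) simp

lemma measurable_lebesgue_on_borel: "(\<lambda>t::'a::euclidean_space. t) \<in> borel_measurable (lebesgue_on S)"
  by (intro measurable_restrict_space1 measurable_completion) simp

lemma measurable_step_lebesgue_on [measurable]: "step N G \<in> borel_measurable (lebesgue_on S)"
  by (rule measurable_compose[OF measurable_lebesgue_on_borel measurable_step])

lemma measurable_cell_lebesgue_on [measurable]: "cell N \<in> measurable (lebesgue_on S) (count_space UNIV)"
  by (rule measurable_compose[OF measurable_lebesgue_on_borel measurable_cell])

lemma cell_bounds:
  assumes "0 \<le> t"
  shows "real (cell N t) \<le> (real N + 1) * t" "(real N + 1) * t < real (cell N t) + 1"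
  using assms by (simp_all add: cell_def)

text \<open>The last estimate passes from the variance of the bridge at the grid point
  \<open>k / N\<close> to the variance at any \<open>t\<close> of the cell. Each of the two factors
  loses \<open>(N + 1) / N \<le> 2\<close>, hence the 4.\<close>

lemma cell_interior:
  assumes t: "0 \<le> t" and k: "cell N t \<in> {1..<N}"
  shows "1 / (real N + 1) \<le> t" "t \<le> 1 - 1 / (real N + 1)"
    and "real (cell N t) / real N * (1 - real (cell N t) / real N) \<le> 4 * (t * (1 - t))"
proof -
  note b = cell_bounds[OF t, of N]
  have N: "real N \<ge> 2" using k by auto
  have k1: "1 \<le> real (cell N t)" "real (cell N t) + 1 \<le> real N" using k by auto
  have "1 \<le> (real N + 1) * t" using b(1) k1 by linarith
  then show "1 / (real N + 1) \<le> t" using N by (simp add: field_simps)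
  have "(real N + 1) * t \<le> real N" using b(2) k1 by linarith
  then show t1: "t \<le> 1 - 1 / (real N + 1)" using N by (simp add: field_simps)
  have "real (cell N t) / real N \<le> (real N + 1) / real N * t"
    using b(1) N by (simp add: field_simps)
  also have "\<dots> \<le> 2 * t" using N t by (intro mult_right_mono) (auto simp: field_simps)
  finally have h1: "real (cell N t) / real N \<le> 2 * t" .
  have "real N - real (cell N t) \<le> (real N + 1) * (1 - t)"
    using b(2) by (simp add: algebra_simps)
  then have "(real N - real (cell N t)) / real N \<le> (real N + 1) * (1 - t) / real N"
    by (rule divide_right_mono) simp
  then have "1 - real (cell N t) / real N \<le> (real N + 1) / real N * (1 - t)"
    using N by (simp add: diff_divide_distrib)
  also have "\<dots> \<le> 2 * (1 - t)" using N order_trans[OF t1, of 1]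
    by (intro mult_right_mono) (auto simp: field_simps)
  finally have h2: "1 - real (cell N t) / real N \<le> 2 * (1 - t)" .
  have "real (cell N t) / real N * (1 - real (cell N t) / real N) \<le> (2 * t) * (2 * (1 - t))"
    using h1 h2 k1 N t by (intro mult_mono) (auto simp: field_simps)
  also have "\<dots> = 4 * (t * (1 - t))" by simp
  finally show "real (cell N t) / real N * (1 - real (cell N t) / real N) \<le> 4 * (t * (1 - t))" .
qed

lemma cell_tendsto:
  assumes t: "0 \<le> t"
  shows "(\<lambda>N. real (cell N t) / real N) \<longlonglongrightarrow> t"
proof (rule tendsto_sandwich)
  show "(\<lambda>N. ((real N + 1) * t - 1) / real N) \<longlonglongrightarrow> t" "(\<lambda>N. (real N + 1) * t / real N) \<longlonglongrightarrow> t"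
    by real_asymp+
  show "\<forall>\<^sub>F N in sequentially. ((real N + 1) * t - 1) / real N \<le> real (cell N t) / real N"
    "\<forall>\<^sub>F N in sequentially. real (cell N t) / real N \<le> (real N + 1) * t / real N"
    using cell_bounds[OF t] by (auto intro!: always_eventually divide_right_mono simp: less_imp_le algebra_simps)
qed

lemma filterlim_cell:
  assumes t: "0 < t" "t < 1"
  shows "filterlim (\<lambda>N. min (real (cell N t)) (real N - real (cell N t))) at_top sequentially"
proof (rule filterlim_at_top_mono)
  have "filterlim (\<lambda>N. real N * min t (1 - t) - 1) at_top sequentially"
    using t by real_asymp
  then show "filterlim (\<lambda>N. real N * min t (1 - t) - 1) at_top sequentially" .
  have "real N * min t (1 - t) - 1 \<le> min (real (cell N t)) (real N - real (cell N t))" for N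
  proof -
    have "real N * min t (1 - t) \<le> real N * t" "real N * min t (1 - t) \<le> real N * (1 - t)"
      by (auto intro!: mult_left_mono)
    then show ?thesis using cell_bounds[of t N] t by (auto simp: algebra_simps)
  qed
  then show "\<forall>\<^sub>F N in sequentially. real N * min t (1 - t) - 1 \<le> min (real (cell N t)) (real N - real (cell N t))"
    by simp
qed

lemma eventually_cell_interior:
  assumes t: "0 < t" "t < 1"
  shows "\<forall>\<^sub>F N in sequentially. cell N t \<in> {1..<N}"
proof -
  have "\<forall>\<^sub>F N in sequentially. 1 \<le> min (real (cell N t)) (real N - real (cell N t))"
    using filterlim_cell[OF t] unfolding filterlim_at_top by blast
  then show ?thesis by eventually_elim auto
qed

text \<open>Up to a constant, \<open>(t * (1 - t)) powr (p / 2)\<close> is the absolute moment of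
  order \<open>p\<close> of the bridge at \<open>t\<close>, so \<open>w_integrable\<close> says that
  the limit functional has finite expectation. By \<open>w_inf\<close> the weight can vanish only at
  0 and 1.\<close>

locale weight_function =
  fixes w :: "real \<Rightarrow> real" and p :: real
  assumes p: "p \<ge> 1"
    and w_meas [measurable]: "w \<in> borel_measurable (lebesgue_on {0..1})"
    and w_nonneg: "\<And>t. t \<in> {0..1} \<Longrightarrow> w t \<ge> 0"
    and w_inf: "\<And>\<delta>. 0 < \<delta> \<Longrightarrow> \<delta> < 1/2 \<Longrightarrow> (INF t \<in> {\<delta>..1 - \<delta>}. w t) > 0"
    and w_integrable: "integrable (lebesgue_on {0..1}) (\<lambda>t. (t * (1 - t)) powr (p / 2) / w t)"
begin

lemma w_lower_bound:
  assumes "0 < \<delta>" "\<delta> < 1/2"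
  obtains c where "c > 0" "\<And>t. t \<in> {\<delta>..1 - \<delta>} \<Longrightarrow> c \<le> w t"
proof
  show "(INF t \<in> {\<delta>..1 - \<delta>}. w t) > 0" using w_inf assms .
  have "bdd_below (w ` {\<delta>..1 - \<delta>})" using w_nonneg assms by (intro bdd_belowI2[of _ 0]) auto
  then show "(INF t \<in> {\<delta>..1 - \<delta>}. w t) \<le> w t" if "t \<in> {\<delta>..1 - \<delta>}" for t
    using that by (rule cINF_lower)
qed

text \<open>The step function lives where \<open>w\<close> is bounded away from 0, so the quotient
  is bounded on a finite measure space. For \<open>N \<ge> 2\<close> the margin
  \<open>1 / (N + 1)\<close> is below 1/2; for smaller \<open>N\<close> there is no interior
  index.\<close>

lemma integrable_step: "integrable (lebesgue_on {0..1}) (\<lambda>t. step N G t / w t)"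
proof (cases "N \<ge> 2")
  case True
  define \<delta> where "\<delta> = 1 / (real N + 1)"
  have "0 < \<delta>" "\<delta> < 1/2" using True by (auto simp: \<delta>_def field_simps)
  then obtain c where c: "c > 0" "\<And>t. t \<in> {\<delta>..1 - \<delta>} \<Longrightarrow> c \<le> w t" using w_lower_bound by blast
  define C where "C = (\<Sum>k\<in>{1..<N}. \<bar>G k\<bar>)"
  interpret finite_measure "lebesgue_on {0..1::real}" by (rule finite_measure_lebesgue_on) auto
  have "norm (step N G t / w t) \<le> C / c" if t: "t \<in> {0..1}" for t
  proof (cases "cell N t \<in> {1..<N}")
    case True
    then have "t \<in> {\<delta>..1 - \<delta>}" using cell_interior[of t N] t by (auto simp: \<delta>_def)
    then have "c \<le> w t" by (rule c)
    moreover have "\<bar>G (cell N t)\<bar> \<le> C" unfolding C_def using True by (intro member_le_sum) auto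
    ultimately show ?thesis using c(1) True by (auto simp: step_def intro!: frac_le)
  next
    case False
    moreover have "C \<ge> 0" unfolding C_def by (intro sum_nonneg) auto
    ultimately show ?thesis using c(1) by (auto simp: step_def)
  qed
  then show ?thesis by (intro integrable_const_bound[where B="C / c"] AE_I2) auto
next
  case False
  then have "step N G = (\<lambda>_. 0)" by (auto simp: step_def fun_eq_iff)
  then show ?thesis by simp
qed

text \<open>For \<open>k = 0\<close> and \<open>k = N\<close> the integrand may fail to be
  integrable, and the value is then the default 0; the sums below run over
  \<open>1 \<le> k < N\<close> only.\<close>

definition cell_mass :: "nat \<Rightarrow> nat \<Rightarrow> real" where
  "cell_mass N k = (LINT t|lebesgue_on {0..1}. of_bool (cell N t = k) / w t)"

lemma cell_mass_nonneg: "cell_mass N k \<ge> 0"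
  unfolding cell_mass_def using w_nonneg by (intro Bochner_Integration.integral_nonneg) auto

lemma integral_step: "(LINT t|lebesgue_on {0..1}. step N G t / w t) = (\<Sum>k\<in>{1..<N}. G k * cell_mass N k)"
proof -
  have i: "integrable (lebesgue_on {0..1}) (\<lambda>t. of_bool (cell N t = k) / w t)" if "k \<in> {1..<N}" for k
  proof -
    have "step N (\<lambda>j. of_bool (j = k)) = (\<lambda>t. of_bool (cell N t = k))"
      using that by (auto simp: step_def fun_eq_iff)
    then show ?thesis using integrable_step[of N "\<lambda>j. of_bool (j = k)"] by simp
  qed
  have "(LINT t|lebesgue_on {0..1}. step N G t / w t) = (LINT t|lebesgue_on {0..1}. (\<Sum>k\<in>{1..<N}. G k * (of_bool (cell N t = k) / w t)))"
    by (simp only: step_eq_sum sum_divide_distrib times_divide_eq_right)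
  also have "\<dots> = (\<Sum>k\<in>{1..<N}. LINT t|lebesgue_on {0..1}. G k * (of_bool (cell N t = k) / w t))"
    by (intro Bochner_Integration.integral_sum integrable_mult_right i)
  also have "\<dots> = (\<Sum>k\<in>{1..<N}. G k * cell_mass N k)"
    unfolding cell_mass_def by (intro sum.cong refl integral_mult_right_zero)
  finally show ?thesis .
qed

text \<open>A bound on the grid in terms of the bridge variance turns into a bound by the function
  of \<open>w_integrable\<close>; the constant \<open>4 powr (p / 2)\<close> comes from
  \<open>cell_interior\<close>.\<close>

lemma norm_step_le:
  assumes G: "\<And>k. k \<in> {1..<N} \<Longrightarrow> \<bar>G k\<bar> \<le> C * (real k / real N * (1 - real k / real N)) powr (p / 2)"
    and C: "C \<ge> 0" and t: "t \<in> {0..1}"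
  shows "norm (step N G t / w t) \<le> C * 4 powr (p / 2) * ((t * (1 - t)) powr (p / 2) / w t)"
proof (cases "cell N t \<in> {1..<N}")
  case True
  let ?h = "real (cell N t) / real N"
  have "\<bar>G (cell N t)\<bar> \<le> C * (?h * (1 - ?h)) powr (p / 2)" by (rule G[OF True])
  also have "\<dots> \<le> C * (4 * (t * (1 - t))) powr (p / 2)"
    using cell_interior(3)[of t N] True t p C
    by (intro mult_left_mono powr_mono2) (auto simp: field_simps)
  also have "\<dots> = C * 4 powr (p / 2) * (t * (1 - t)) powr (p / 2)"
    using t by (simp add: powr_mult)
  finally have "\<bar>step N G t\<bar> / w t \<le> C * 4 powr (p / 2) * (t * (1 - t)) powr (p / 2) / w t"
    using True w_nonneg[OF t] by (intro divide_right_mono) (auto simp: step_def)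
  then show ?thesis using w_nonneg[OF t] by simp
next
  case False
  then have "step N G t = 0" by (auto simp: step_def)
  then show ?thesis using w_nonneg[OF t] C by simp
qed

text \<open>The bound does not depend on \<open>N\<close>; applied to the moments of the bridge it
  gives tightness.\<close>

lemma sum_cell_mass_le:
  assumes G: "\<And>k. k \<in> {1..<N} \<Longrightarrow> \<bar>G k\<bar> \<le> C * (real k / real N * (1 - real k / real N)) powr (p / 2)"
    and C: "C \<ge> 0"
  shows "(\<Sum>k\<in>{1..<N}. G k * cell_mass N k) \<le> C * 4 powr (p / 2) * (LINT t|lebesgue_on {0..1}. (t * (1 - t)) powr (p / 2) / w t)"
proof -
  have "(LINT t|lebesgue_on {0..1}. step N G t / w t) \<le> (LINT t|lebesgue_on {0..1}. C * 4 powr (p / 2) * ((t * (1 - t)) powr (p / 2) / w t))"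
  proof (rule integral_mono)
    show "integrable (lebesgue_on {0..1}) (\<lambda>t. C * 4 powr (p / 2) * ((t * (1 - t)) powr (p / 2) / w t))"
      by (intro integrable_mult_right w_integrable)
    show "step N G t / w t \<le> C * 4 powr (p / 2) * ((t * (1 - t)) powr (p / 2) / w t)" if "t \<in> space (lebesgue_on {0..1})" for t
      using order_trans[OF abs_ge_self norm_step_le[OF G C, of t, unfolded real_norm_def]] that by simp
  qed (rule integrable_step)
  then show ?thesis by (simp only: integral_step integral_mult_right_zero)
qed

text \<open>Dominated convergence with the majorant of \<open>norm_step_le\<close>. The end points
  form a null set; at any other time \<open>w\<close> is positive and the cell index is eventually
  interior, so the cut in \<open>step\<close> disappears in the limit.\<close>

lemma sum_cell_mass_tendsto:
  assumes G: "\<And>N k. k \<in> {1..<N} \<Longrightarrow> \<bar>G N k\<bar> \<le> C * (real k / real N * (1 - real k / real N)) powr (p / 2)"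
    and C: "C \<ge> 0"
    and g [measurable]: "g \<in> borel_measurable (lebesgue_on {0..1})"
    and lim: "\<And>t. 0 < t \<Longrightarrow> t < 1 \<Longrightarrow> (\<lambda>N. G N (cell N t)) \<longlonglongrightarrow> g t"
  shows "(\<lambda>N. \<Sum>k\<in>{1..<N}. G N k * cell_mass N k) \<longlonglongrightarrow> (LINT t|lebesgue_on {0..1}. g t / w t)"
  unfolding integral_step[symmetric]
proof (rule integral_dominated_convergence)
  show "integrable (lebesgue_on {0..1}) (\<lambda>t. C * 4 powr (p / 2) * ((t * (1 - t)) powr (p / 2) / w t))"
    by (intro integrable_mult_right w_integrable)
  show "AE t in lebesgue_on {0..1}. norm (step N (G N) t / w t) \<le> C * 4 powr (p / 2) * ((t * (1 - t)) powr (p / 2) / w t)" for N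
    using norm_step_le[OF G C] by (intro AE_I2) auto
  have "AE t in lebesgue_on {0..1::real}. t \<notin> {0, 1}"
    by (rule AE_I'[of "{0, 1}"]) (auto simp: null_sets_restrict_space)
  moreover have "AE t in lebesgue_on {0..1::real}. t \<in> {0..1}" by (intro AE_I2) auto
  ultimately show "AE t in lebesgue_on {0..1}. (\<lambda>N. step N (G N) t / w t) \<longlonglongrightarrow> g t / w t"
  proof eventually_elim
    case (elim t)
    then have t: "0 < t" "t < 1" by auto
    \<comment> \<open>Halving the distance of \<open>t\<close> to the ends gives a margin of at most
      1/4 whose interval still contains \<open>t\<close>.\<close>
    obtain c where "c > 0" "\<And>s. s \<in> {min t (1 - t) / 2..1 - min t (1 - t) / 2} \<Longrightarrow> c \<le> w s"
      by (rule w_lower_bound[of "min t (1 - t) / 2"]) (use t in \<open>auto simp: min_def\<close>)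
    moreover have "t \<in> {min t (1 - t) / 2..1 - min t (1 - t) / 2}" using t by (auto simp: min_def field_simps)
    ultimately have "w t > 0" by (meson less_le_trans)
    then have "w t \<noteq> 0" by simp
    moreover have "(\<lambda>N. step N (G N) t) \<longlonglongrightarrow> g t"
      by (rule Lim_transform_eventually[OF lim[OF t]])
         (use eventually_cell_interior[OF t] in \<open>auto elim!: eventually_mono simp: step_def\<close>)
    ultimately show ?case by (intro tendsto_divide tendsto_const)
  qed
qed measurable

end

section \<open>Riemann sums of the Brownian bridge\<close>

definition std_normal_abs_moment :: "real \<Rightarrow> real" where
  "std_normal_abs_moment p = (LBINT x. std_normal_density x * \<bar>x\<bar> powr p)"

lemma integrable_std_normal_abs_powr:
  assumes p: "p > 0"
  shows "integrable lborel (\<lambda>x. std_normal_density x * \<bar>x\<bar> powr p)"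
proof (rule Bochner_Integration.integrable_bound)
  \<comment> \<open>A real exponent is dominated by the next integer one where
    \<open>|x| > 1\<close>, and by the constant 1 elsewhere.\<close>
  define n where "n = nat \<lceil>p\<rceil>"
  show "integrable lborel (\<lambda>x. std_normal_density x + std_normal_density x * \<bar>x\<bar> ^ n)"
    by (intro Bochner_Integration.integrable_add integrable_normal_density integrable_std_normal_moment_abs) simp
  have "\<bar>x\<bar> powr p \<le> 1 + \<bar>x\<bar> ^ n" for x :: real
  proof (cases "\<bar>x\<bar> \<le> 1")
    case True
    then have "\<bar>x\<bar> powr p \<le> 1 powr p" using p by (intro powr_mono2) auto
    moreover have "\<bar>x\<bar> ^ n \<ge> 0" by simp
    ultimately show ?thesis unfolding powr_one_eq_one by linarith
  next
    case False
    then have "\<bar>x\<bar> powr p \<le> \<bar>x\<bar> powr real n" using p by (intro powr_mono) (auto simp: n_def)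
    also have "\<dots> = \<bar>x\<bar> ^ n" using False by (intro powr_realpow) auto
    finally show ?thesis by simp
  qed
  then have "norm (std_normal_density x * \<bar>x\<bar> powr p) \<le> norm (std_normal_density x + std_normal_density x * \<bar>x\<bar> ^ n)" for x
    using mult_left_mono[of "\<bar>x\<bar> powr p" "1 + \<bar>x\<bar> ^ n" "std_normal_density x"]
    by (simp add: abs_mult distrib_left)
  then show "AE x in lborel. norm (std_normal_density x * \<bar>x\<bar> powr p) \<le> norm (std_normal_density x + std_normal_density x * \<bar>x\<bar> ^ n)"
    by simp
qed simp

lemma std_normal_abs_moment_nonneg: "std_normal_abs_moment p \<ge> 0"
  unfolding std_normal_abs_moment_def by (intro Bochner_Integration.integral_nonneg) auto

text \<open>Scaling by the standard deviation reduces to the standard normal law. In terms of the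
  second moment the degenerate law fits in too, since \<open>0 powr (p / 2) = 0\<close>.\<close>

lemma (in prob_space) gaussian_rv_abs_moment:
  assumes Y: "gaussian_rv M Y" and mean: "expectation Y = 0" and p: "p > 0"
  shows "integrable M (\<lambda>x. \<bar>Y x\<bar> powr p) \<and>
    expectation (\<lambda>x. \<bar>Y x\<bar> powr p) = std_normal_abs_moment p * expectation (\<lambda>x. (Y x)\<^sup>2) powr (p / 2)"
proof -
  have [measurable]: "Y \<in> borel_measurable M" using Y by (simp add: gaussian_rv_def)
  show ?thesis
  proof (cases "\<exists>m s. s > 0 \<and> distributed M lborel Y (normal_density m s)")
    case True
    then obtain m s where s: "s > 0" and D: "distributed M lborel Y (normal_density m s)" by auto
    with mean have m: "m = 0" using normal_distributed_expectation by auto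
    have v: "expectation (\<lambda>x. (Y x)\<^sup>2) powr (p / 2) = s powr p"
      using normal_distributed_variance[OF s D] mean s by (simp flip: powr_numeral add: powr_powr)
    have Z: "distributed M lborel (\<lambda>x. Y x / s) std_normal_density"
      using D m normal_standard_normal_convert[OF s, of Y 0] by simp
    have i: "integrable M (\<lambda>x. \<bar>Y x / s\<bar> powr p)"
      using integrable_std_normal_abs_powr[OF p] by (subst distributed_integrable[OF Z, symmetric]) auto
    have e: "expectation (\<lambda>x. \<bar>Y x / s\<bar> powr p) = std_normal_abs_moment p"
      unfolding std_normal_abs_moment_def by (subst distributed_integral[OF Z, symmetric]) auto
    have "\<bar>Y x\<bar> powr p = s powr p * \<bar>Y x / s\<bar> powr p" for x
      using s by (simp add: powr_divide)
    then show ?thesis unfolding v using i e by simp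
  next
    case False
    then obtain m where m: "AE x in M. Y x = m" using Y by (auto simp: gaussian_rv_def)
    have "expectation Y = expectation (\<lambda>x. m)" by (rule integral_cong_AE) (use m in auto)
    then have m0: "m = 0" using mean by (simp add: prob_space)
    have sq: "AE x in M. (Y x)\<^sup>2 = 0" and pw: "AE x in M. \<bar>Y x\<bar> powr p = 0" using m m0 by auto
    have "expectation (\<lambda>x. (Y x)\<^sup>2) = 0"
      using integral_cong_AE[of "\<lambda>x. (Y x)\<^sup>2" M "\<lambda>_. 0"] sq by simp
    moreover have "expectation (\<lambda>x. \<bar>Y x\<bar> powr p) = 0"
      using integral_cong_AE[of "\<lambda>x. \<bar>Y x\<bar> powr p" M "\<lambda>_. 0"] pw by simp
    moreover have "integrable M (\<lambda>x. \<bar>Y x\<bar> powr p)"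
      using pw by (subst integrable_cong_AE[where g="\<lambda>_. 0"]) auto
    ultimately show ?thesis by simp
  qed
qed

lemma brownian_bridge_abs_moment:
  assumes B: "brownian_bridge M B" and t: "t \<in> {0..1}" and p: "p > 0"
  shows "integrable M (\<lambda>\<omega>. \<bar>B t \<omega>\<bar> powr p)"
    and "(LINT \<omega>|M. \<bar>B t \<omega>\<bar> powr p) = std_normal_abs_moment p * (t * (1 - t)) powr (p / 2)"
proof -
  interpret prob_space M using B by (simp add: brownian_bridge_def)
  have "expectation (\<lambda>\<omega>. (B t \<omega>)\<^sup>2) = t * (1 - t)"
    using brownian_bridge_covariance[OF B t t] by (simp add: power2_eq_square algebra_simps)
  then show "integrable M (\<lambda>\<omega>. \<bar>B t \<omega>\<bar> powr p)"
    "(LINT \<omega>|M. \<bar>B t \<omega>\<bar> powr p) = std_normal_abs_moment p * (t * (1 - t)) powr (p / 2)"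
    using gaussian_rv_abs_moment[OF brownian_bridge_gaussian_rv[OF B t] brownian_bridge_mean[OF B t] p] by auto
qed

section \<open>Joint measurability of the bridge\<close>

lemma brownian_bridge_continuous:
  assumes "brownian_bridge M B" "\<omega> \<in> space M"
  shows "continuous_on {0..1} (\<lambda>t. B t \<omega>)"
  using assms by (simp add: brownian_bridge_def)

lemma brownian_bridge_tendsto:
  assumes B: "brownian_bridge M B" and \<omega>: "\<omega> \<in> space M" and u: "u \<longlonglongrightarrow> t" "\<And>n. u n \<in> {0..1}" and t: "t \<in> {0..1}"
  shows "(\<lambda>n. B (u n) \<omega>) \<longlonglongrightarrow> B t \<omega>"
  using continuous_on_tendsto_compose[OF brownian_bridge_continuous[OF B \<omega>] u(1) t] u(2) by simp

text \<open>By continuity, \<open>B\<close> is the limit of its discretisations at the grid points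
  to the left of \<open>t\<close>. Each of them is a finite sum of products of a function of
  \<open>t\<close> and a function of the sample point. As every path is continuous, the limit holds
  at every point of the product space.\<close>

lemma brownian_bridge_jointly_measurable:
  fixes M :: "'a measure"
  assumes B: "brownian_bridge M B"
  shows "(\<lambda>x. B (fst x) (snd x)) \<in> borel_measurable (lebesgue_on {0..1} \<Otimes>\<^sub>M M)"
proof (rule borel_measurable_LIMSEQ_real)
  define c where "c n t = nat \<lfloor>real (Suc n) * t\<rfloor>" for n and t :: real
  have c: "real (c n t) / real (Suc n) \<in> {0..1}" "c n t \<le> Suc n" if "t \<in> {0..1}" for n t
  proof -
    have "real (c n t) \<le> real (Suc n) * t" using that by (simp add: c_def)
    also have "\<dots> \<le> real (Suc n) * 1" using that by (intro mult_left_mono) auto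
    finally have "real (c n t) \<le> real (Suc n)" by simp
    then show "c n t \<le> Suc n" "real (c n t) / real (Suc n) \<in> {0..1}" by (auto simp: divide_le_eq_1)
  qed
  have lim: "(\<lambda>n. real (c n t) / real (Suc n)) \<longlonglongrightarrow> t" if "t \<in> {0..1}" for t
  proof (rule tendsto_sandwich)
    have b: "real (Suc n) * t - 1 \<le> real (c n t)" "real (c n t) \<le> real (Suc n) * t" for n
      using that by (simp_all add: c_def)
    show "(\<lambda>n. (real (Suc n) * t - 1) / real (Suc n)) \<longlonglongrightarrow> t" "(\<lambda>n. real (Suc n) * t / real (Suc n)) \<longlonglongrightarrow> t"
      by real_asymp+
    show "\<forall>\<^sub>F n in sequentially. (real (Suc n) * t - 1) / real (Suc n) \<le> real (c n t) / real (Suc n)"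
      "\<forall>\<^sub>F n in sequentially. real (c n t) / real (Suc n) \<le> real (Suc n) * t / real (Suc n)"
      by (rule always_eventually, intro allI divide_right_mono b, simp)+
  qed
  show "(\<lambda>x. \<Sum>k\<le>Suc n. B (real k / real (Suc n)) (snd x) * of_bool (c n (fst x) = k)) \<in> borel_measurable (lebesgue_on {0..1} \<Otimes>\<^sub>M M)" for n
  proof (intro borel_measurable_sum borel_measurable_times)
    fix k assume k: "k \<in> {..Suc n}"
    have "B (real k / real (Suc n)) \<in> borel_measurable M"
      using brownian_bridge_gaussian_rv[OF B, of "real k / real (Suc n)"] k by (auto simp: gaussian_rv_def simp del: of_nat_Suc)
    then show "(\<lambda>x. B (real k / real (Suc n)) (snd x)) \<in> borel_measurable (lebesgue_on {0..1} \<Otimes>\<^sub>M M)"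
      by measurable
    have "(\<lambda>t. of_bool (c n t = k) :: real) \<in> borel_measurable borel"
      unfolding c_def by measurable
    then have "(\<lambda>t. of_bool (c n t = k) :: real) \<in> borel_measurable (lebesgue_on {0..1})"
      by (rule measurable_compose[OF measurable_lebesgue_on_borel])
    then show "(\<lambda>x. of_bool (c n (fst x) = k) :: real) \<in> borel_measurable (lebesgue_on {0..1} \<Otimes>\<^sub>M M)"
      by (rule measurable_compose[OF measurable_fst])
  qed
  fix x :: "real \<times> 'a" assume "x \<in> space (lebesgue_on {0..1} \<Otimes>\<^sub>M M)"
  then have x: "fst x \<in> {0..1}" "snd x \<in> space M" by (auto simp: space_pair_measure)
  have "(\<Sum>k\<le>Suc n. B (real k / real (Suc n)) (snd x) * of_bool (c n (fst x) = k)) = B (real (c n (fst x)) / real (Suc n)) (snd x)" for n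
  proof -
    have "(\<Sum>k\<le>Suc n. B (real k / real (Suc n)) (snd x) * of_bool (c n (fst x) = k)) =
       (\<Sum>k\<le>Suc n. if k = c n (fst x) then B (real k / real (Suc n)) (snd x) else 0)"
      by (intro sum.cong) auto
    also have "\<dots> = B (real (c n (fst x)) / real (Suc n)) (snd x)"
      by (subst sum.delta) (use c(2)[OF x(1), of n] in auto)
    finally show ?thesis .
  qed
  then show "(\<lambda>n. \<Sum>k\<le>Suc n. B (real k / real (Suc n)) (snd x) * of_bool (c n (fst x) = k)) \<longlonglongrightarrow> B (fst x) (snd x)"
    using brownian_bridge_tendsto[OF B x(2) lim[OF x(1)] c(1)[OF x(1)] x(1)] by simp
qed

context weight_function
begin

lemma brownian_bridge_functional_measurable:
  assumes B: "brownian_bridge M B"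
  shows "(\<lambda>\<omega>. LINT t|lebesgue_on {0..1}. \<bar>B t \<omega>\<bar> powr p / w t) \<in> borel_measurable M"
proof -
  interpret L: finite_measure "lebesgue_on {0..1::real}" by (rule finite_measure_lebesgue_on) auto
  have [measurable]: "(\<lambda>x. B (snd x) (fst x)) \<in> borel_measurable (M \<Otimes>\<^sub>M lebesgue_on {0..1})"
    using measurable_pair_swap[OF brownian_bridge_jointly_measurable[OF B]] by (simp add: case_prod_beta')
  show ?thesis
    by (rule L.borel_measurable_lebesgue_integral) (simp add: case_prod_beta')
qed

text \<open>No majorant for the discretised paths themselves is at hand. Scheffe's lemma replaces
  it: almost everywhere convergence on the product space comes from continuity of the paths, and
  convergence of the integrals involves only the explicit moments, for which dominated convergence
  is available.\<close>

lemma brownian_bridge_riemann_sum_L1: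
  assumes B: "brownian_bridge M B"
  shows "(\<lambda>N. \<integral>\<^sup>+\<omega>. ennreal \<bar>(\<Sum>k\<in>{1..<N}. \<bar>B (real k / real N) \<omega>\<bar> powr p * cell_mass N k)
      - (LINT t|lebesgue_on {0..1}. \<bar>B t \<omega>\<bar> powr p / w t)\<bar> \<partial>M) \<longlonglongrightarrow> 0"
proof -
  let ?L = "lebesgue_on {0..1::real}"
  interpret L: finite_measure ?L by (rule finite_measure_lebesgue_on) auto
  interpret M: prob_space M using B by (simp add: brownian_bridge_def)
  interpret P: pair_sigma_finite ?L M by unfold_locales
  have p0: "p > 0" using p by simp
  define c where "c = std_normal_abs_moment p"
  have c: "c \<ge> 0" unfolding c_def by (rule std_normal_abs_moment_nonneg)
  define g where "g t \<omega> = \<bar>B t \<omega>\<bar> powr p / w t" for t \<omega>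
  define G where "G N t \<omega> = step N (\<lambda>k. \<bar>B (real k / real N) \<omega>\<bar> powr p) t / w t" for N t \<omega>
  have Bt [measurable]: "B t \<in> borel_measurable M" if "t \<in> {0..1}" for t
    using brownian_bridge_gaussian_rv[OF B that] by (simp add: gaussian_rv_def)
  note [measurable] = brownian_bridge_jointly_measurable[OF B]
  have w: "w t \<ge> 0" if "t \<in> space ?L" for t using w_nonneg that by auto
  have g0: "g t \<omega> \<ge> 0" and G0: "G N t \<omega> \<ge> 0" if "t \<in> space ?L" for t \<omega> N
    using w[OF that] by (auto simp: g_def G_def step_def)
  have gm [measurable]: "(\<lambda>x. g (fst x) (snd x)) \<in> borel_measurable (?L \<Otimes>\<^sub>M M)"
    unfolding g_def by measurable
  have Gm [measurable]: "(\<lambda>x. G N (fst x) (snd x)) \<in> borel_measurable (?L \<Otimes>\<^sub>M M)" for N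
  proof -
    have "(\<lambda>x. \<Sum>k\<in>{1..<N}. \<bar>B (real k / real N) (snd x)\<bar> powr p * of_bool (cell N (fst x) = k)) \<in> borel_measurable (?L \<Otimes>\<^sub>M M)"
    proof (intro borel_measurable_sum borel_measurable_times)
      fix k assume "k \<in> {1..<N}"
      then have [measurable]: "B (real k / real N) \<in> borel_measurable M" by (intro Bt) auto
      show "(\<lambda>x. \<bar>B (real k / real N) (snd x)\<bar> powr p) \<in> borel_measurable (?L \<Otimes>\<^sub>M M)" by measurable
      show "(\<lambda>x. of_bool (cell N (fst x) = k) :: real) \<in> borel_measurable (?L \<Otimes>\<^sub>M M)"
        by (rule measurable_compose[OF measurable_compose[OF measurable_fst measurable_cell_lebesgue_on],
              where g="\<lambda>j. of_bool (j = k)"]) simp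
    qed
    then show ?thesis unfolding G_def step_eq_sum by measurable
  qed
  \<comment> \<open>Integrating over the sample point first leaves deterministic functions of
    \<open>t\<close>: the majorant for \<open>g\<close>, and a step function of the same shape for
    \<open>G N\<close>.\<close>
  have int_g: "(LINT \<omega>|M. g t \<omega>) = c * ((t * (1 - t)) powr (p / 2) / w t)" "integrable M (g t)" if "t \<in> space ?L" for t
    using brownian_bridge_abs_moment[OF B _ p0, of t] that by (auto simp: g_def[abs_def] c_def)
  have int_G: "(LINT \<omega>|M. G N t \<omega>) = step N (\<lambda>k. c * (real k / real N * (1 - real k / real N)) powr (p / 2)) t / w t"
    "integrable M (G N t)" for t N
    using brownian_bridge_abs_moment[OF B _ p0, of "real (cell N t) / real N"]
    by (cases "cell N t \<in> {1..<N}"; auto simp: G_def[abs_def] c_def step_def divide_le_eq_1)+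
  have P_g: "integrable (?L \<Otimes>\<^sub>M M) (\<lambda>x. g (fst x) (snd x))"
  proof (rule P.Fubini_integrable[OF gm])
    have "integrable ?L (\<lambda>t. c * ((t * (1 - t)) powr (p / 2) / w t))"
      by (intro integrable_mult_right w_integrable)
    then show "integrable ?L (\<lambda>t. LINT \<omega>|M. norm (g (fst (t, \<omega>)) (snd (t, \<omega>))))"
      by (rule Bochner_Integration.integrable_cong[THEN iffD1, rotated 2]) (auto simp: g0 int_g(1))
  qed (auto intro!: AE_I2 int_g simp: eta_contract_eq)
  have P_G: "integrable (?L \<Otimes>\<^sub>M M) (\<lambda>x. G N (fst x) (snd x))" for N
  proof (rule P.Fubini_integrable[OF Gm])
    have "integrable ?L (\<lambda>t. step N (\<lambda>k. c * (real k / real N * (1 - real k / real N)) powr (p / 2)) t / w t)"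
      by (rule integrable_step)
    then show "integrable ?L (\<lambda>t. LINT \<omega>|M. norm (G N (fst (t, \<omega>)) (snd (t, \<omega>))))"
      by (rule Bochner_Integration.integrable_cong[THEN iffD1, rotated 2]) (auto simp: G0 int_G(1))
  qed (auto intro!: AE_I2 int_G)
  have LIM: "(\<lambda>N. LINT x|(?L \<Otimes>\<^sub>M M). G N (fst x) (snd x)) \<longlonglongrightarrow> (LINT x|(?L \<Otimes>\<^sub>M M). g (fst x) (snd x))"
  proof -
    have "(LINT x|(?L \<Otimes>\<^sub>M M). G N (fst x) (snd x)) = (\<Sum>k\<in>{1..<N}. c * (real k / real N * (1 - real k / real N)) powr (p / 2) * cell_mass N k)" for N
      unfolding P.integral_fst'[OF P_G, symmetric] by (simp add: int_G integral_step)
    moreover have "(LINT x|(?L \<Otimes>\<^sub>M M). g (fst x) (snd x)) = (LINT t|?L. c * (t * (1 - t)) powr (p / 2) / w t)"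
      unfolding P.integral_fst'[OF P_g, symmetric]
      by (intro Bochner_Integration.integral_cong refl) (simp add: int_g)
    moreover have "(\<lambda>N. \<Sum>k\<in>{1..<N}. c * (real k / real N * (1 - real k / real N)) powr (p / 2) * cell_mass N k)
        \<longlonglongrightarrow> (LINT t|?L. c * (t * (1 - t)) powr (p / 2) / w t)"
    proof (rule sum_cell_mass_tendsto[where C=c])
      show "(\<lambda>t. c * (t * (1 - t)) powr (p / 2)) \<in> borel_measurable ?L"
        by (rule measurable_compose[OF measurable_lebesgue_on_borel]) simp
      show "(\<lambda>N. c * (real (cell N t) / real N * (1 - real (cell N t) / real N)) powr (p / 2)) \<longlonglongrightarrow> c * (t * (1 - t)) powr (p / 2)"
        if "0 < t" "t < 1" for t
        using that by (intro tendsto_intros cell_tendsto) auto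
    qed (use c in auto)
    ultimately show ?thesis by simp
  qed
  have nn_g: "(\<integral>\<^sup>+x. norm (g (fst x) (snd x)) \<partial>(?L \<Otimes>\<^sub>M M)) = ennreal (LINT x|(?L \<Otimes>\<^sub>M M). g (fst x) (snd x))"
    using P_g g0 by (subst nn_integral_eq_integral[symmetric]) (auto intro!: nn_integral_cong simp: space_pair_measure)
  have nn_G: "(\<integral>\<^sup>+x. norm (G N (fst x) (snd x)) \<partial>(?L \<Otimes>\<^sub>M M)) = ennreal (LINT x|(?L \<Otimes>\<^sub>M M). G N (fst x) (snd x))" for N
    using P_G[of N] G0 by (subst nn_integral_eq_integral[symmetric]) (auto intro!: nn_integral_cong simp: space_pair_measure)
  have S: "(\<lambda>N. \<integral>\<^sup>+x. norm (G N (fst x) (snd x) - g (fst x) (snd x)) \<partial>(?L \<Otimes>\<^sub>M M)) \<longlonglongrightarrow> 0"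
  proof (rule Scheffe_lemma1[OF P_G P_g])
    have "(\<lambda>N. \<integral>\<^sup>+x. norm (G N (fst x) (snd x)) \<partial>(?L \<Otimes>\<^sub>M M)) \<longlonglongrightarrow> (\<integral>\<^sup>+x. norm (g (fst x) (snd x)) \<partial>(?L \<Otimes>\<^sub>M M))"
      unfolding nn_g nn_G by (intro tendsto_ennrealI LIM)
    then show "limsup (\<lambda>N. \<integral>\<^sup>+x. norm (G N (fst x) (snd x)) \<partial>(?L \<Otimes>\<^sub>M M)) \<le> (\<integral>\<^sup>+x. norm (g (fst x) (snd x)) \<partial>(?L \<Otimes>\<^sub>M M))"
      by (simp add: lim_imp_Limsup)
    have "AE t in ?L. t \<notin> {0, 1}"
      by (rule AE_I'[of "{0, 1}"]) (auto simp: null_sets_restrict_space)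
    moreover have "{x \<in> space (?L \<Otimes>\<^sub>M M). fst x \<notin> {0, 1}} \<in> sets (?L \<Otimes>\<^sub>M M)"
    proof -
      have "{x \<in> space (?L \<Otimes>\<^sub>M M). fst x \<notin> {0, 1}} = (space ?L - {0, 1}) \<times> space M"
        by (auto simp: space_pair_measure)
      moreover have "{0, 1} \<in> sets ?L" by (auto simp: sets_restrict_space_iff)
      ultimately show ?thesis by (simp add: pair_measureI sets.Diff)
    qed
    ultimately have "AE x in ?L \<Otimes>\<^sub>M M. fst x \<notin> {0, 1}"
      by (intro P.AE_pair_measure) auto
    moreover have "AE x in ?L \<Otimes>\<^sub>M M. x \<in> space (?L \<Otimes>\<^sub>M M)" by (rule AE_space)
    ultimately show "AE x in ?L \<Otimes>\<^sub>M M. (\<lambda>N. G N (fst x) (snd x)) \<longlonglongrightarrow> g (fst x) (snd x)"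
    proof eventually_elim
      case (elim x)
      then have t: "0 < fst x" "fst x < 1" and om: "snd x \<in> space M" by (auto simp: space_pair_measure)
      have "cell N (fst x) \<le> N" for N
      proof -
        have "(real N + 1) * fst x < (real N + 1) * 1" using t by (intro mult_strict_left_mono) auto
        then have "real (cell N (fst x)) < real N + 1"
          using le_less_trans[OF cell_bounds(1)[OF less_imp_le[OF t(1)], of N]] by simp
        then show ?thesis by linarith
      qed
      then have "real (cell N (fst x)) / real N \<in> {0..1}" for N by (auto simp: divide_le_eq_1)
      then have "(\<lambda>N. B (real (cell N (fst x)) / real N) (snd x)) \<longlonglongrightarrow> B (fst x) (snd x)"
        using t by (intro brownian_bridge_tendsto[OF B om] cell_tendsto) auto
      \<comment> \<open>The limit path may be zero at this time, so continuity of
        \<open>powr\<close> at base 0 is involved, which relies on the positive exponent.\<close>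
      then have "(\<lambda>N. \<bar>B (real (cell N (fst x)) / real N) (snd x)\<bar> powr p) \<longlonglongrightarrow> \<bar>B (fst x) (snd x)\<bar> powr p"
        using p0 by (intro tendsto_powr' tendsto_rabs tendsto_const) auto
      then have "(\<lambda>N. step N (\<lambda>k. \<bar>B (real k / real N) (snd x)\<bar> powr p) (fst x)) \<longlonglongrightarrow> \<bar>B (fst x) (snd x)\<bar> powr p"
        by (rule Lim_transform_eventually)
           (use eventually_cell_interior[OF t] in \<open>auto elim!: eventually_mono simp: step_def\<close>)
      then show ?case unfolding G_def g_def divide_inverse by (intro tendsto_mult tendsto_const)
    qed
  qed
  show ?thesis
  proof (rule tendsto_sandwich[OF _ _ tendsto_const S])
    show "\<forall>\<^sub>F N in sequentially. (\<integral>\<^sup>+\<omega>. ennreal \<bar>(\<Sum>k\<in>{1..<N}. \<bar>B (real k / real N) \<omega>\<bar> powr p * cell_mass N k)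
      - (LINT t|lebesgue_on {0..1}. \<bar>B t \<omega>\<bar> powr p / w t)\<bar> \<partial>M) \<le> (\<integral>\<^sup>+x. norm (G N (fst x) (snd x) - g (fst x) (snd x)) \<partial>(?L \<Otimes>\<^sub>M M))"
    proof (rule always_eventually, rule allI)
      fix N
      have "(\<integral>\<^sup>+\<omega>. ennreal \<bar>(\<Sum>k\<in>{1..<N}. \<bar>B (real k / real N) \<omega>\<bar> powr p * cell_mass N k)
          - (LINT t|lebesgue_on {0..1}. \<bar>B t \<omega>\<bar> powr p / w t)\<bar> \<partial>M)
        \<le> (\<integral>\<^sup>+\<omega>. (\<integral>\<^sup>+t. norm (G N t \<omega> - g t \<omega>) \<partial>?L) \<partial>M)"
      proof (rule nn_integral_mono_AE)
        \<comment> \<open>Splitting the integral of a difference requires an integrable path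
          functional, which Fubini gives for almost every sample point only; elsewhere the integral
          of \<open>g\<close> takes its default value.\<close>
        have "AE \<omega> in M. integrable ?L (\<lambda>t. g t \<omega>)"
          using P.AE_integrable_snd[of g] P_g by (simp add: case_prod_beta')
        then show "AE \<omega> in M. ennreal \<bar>(\<Sum>k\<in>{1..<N}. \<bar>B (real k / real N) \<omega>\<bar> powr p * cell_mass N k)
          - (LINT t|lebesgue_on {0..1}. \<bar>B t \<omega>\<bar> powr p / w t)\<bar> \<le> (\<integral>\<^sup>+t. norm (G N t \<omega> - g t \<omega>) \<partial>?L)"
        proof eventually_elim
          case (elim \<omega>)
          have iG: "integrable ?L (\<lambda>t. G N t \<omega>)" unfolding G_def by (rule integrable_step)
          have "(\<Sum>k\<in>{1..<N}. \<bar>B (real k / real N) \<omega>\<bar> powr p * cell_mass N k) - (LINT t|?L. \<bar>B t \<omega>\<bar> powr p / w t)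
             = (LINT t|?L. G N t \<omega> - g t \<omega>)"
            using iG elim by (subst Bochner_Integration.integral_diff) (auto simp: G_def g_def integral_step)
          then show ?case
            using integral_norm_bound_ennreal[of ?L "\<lambda>t. G N t \<omega> - g t \<omega>"] iG elim by simp
        qed
      qed
      also have "\<dots> = (\<integral>\<^sup>+x. norm (G N (fst x) (snd x) - g (fst x) (snd x)) \<partial>(?L \<Otimes>\<^sub>M M))"
        using P.nn_integral_snd[of "\<lambda>x. ennreal (norm (G N (fst x) (snd x) - g (fst x) (snd x)))"] by simp
      finally show "(\<integral>\<^sup>+\<omega>. ennreal \<bar>(\<Sum>k\<in>{1..<N}. \<bar>B (real k / real N) \<omega>\<bar> powr p * cell_mass N k)
          - (LINT t|lebesgue_on {0..1}. \<bar>B t \<omega>\<bar> powr p / w t)\<bar> \<partial>M) \<le> (\<integral>\<^sup>+x. norm (G N (fst x) (snd x) - g (fst x) (snd x)) \<partial>(?L \<Otimes>\<^sub>M M))" .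
    qed
  qed simp
qed

end

section \<open>The coupling error\<close>

text \<open>If the error is at most \<open>\<eta> * |g|\<close>, both powers lie between
  \<open>(1 - \<eta>) powr p\<close> and \<open>(1 + \<eta>) powr p\<close> times that of
  \<open>g\<close>; otherwise both numbers are at most \<open>(1 + 1 / \<eta>)\<close> times the
  error. The first coefficient tends to 0 with \<open>\<eta>\<close>; the second grows, but it
  multiplies the error, which vanishes for fixed \<open>\<eta>\<close>.\<close>

lemma abs_powr_diff_le:
  fixes z g \<eta> p :: real
  assumes p: "p \<ge> 0" and \<eta>: "0 < \<eta>" "\<eta> < 1"
  shows "\<bar>\<bar>z\<bar> powr p - \<bar>g\<bar> powr p\<bar> \<le> ((1 + \<eta>) powr p - (1 - \<eta>) powr p) * \<bar>g\<bar> powr p + (1 + 1 / \<eta>) powr p * \<bar>z - g\<bar> powr p"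
proof (cases "\<bar>z - g\<bar> \<le> \<eta> * \<bar>g\<bar>")
  case True
  have "(1 - \<eta>) powr p * \<bar>g\<bar> powr p \<le> \<bar>y\<bar> powr p \<and> \<bar>y\<bar> powr p \<le> (1 + \<eta>) powr p * \<bar>g\<bar> powr p"
    if "(1 - \<eta>) * \<bar>g\<bar> \<le> \<bar>y\<bar>" "\<bar>y\<bar> \<le> (1 + \<eta>) * \<bar>g\<bar>" for y
    using that p \<eta> by (auto simp flip: powr_mult intro!: powr_mono2)
  note bounds = this
  have "(1 - \<eta>) * \<bar>g\<bar> \<le> \<bar>z\<bar>" "\<bar>z\<bar> \<le> (1 + \<eta>) * \<bar>g\<bar>"
    unfolding left_diff_distrib distrib_right using True by linarith+
  from bounds[OF this] have z: "(1 - \<eta>) powr p * \<bar>g\<bar> powr p \<le> \<bar>z\<bar> powr p" "\<bar>z\<bar> powr p \<le> (1 + \<eta>) powr p * \<bar>g\<bar> powr p"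
    by auto
  have "0 \<le> \<eta> * \<bar>g\<bar>" using \<eta> by simp
  then have "(1 - \<eta>) * \<bar>g\<bar> \<le> \<bar>g\<bar>" "\<bar>g\<bar> \<le> (1 + \<eta>) * \<bar>g\<bar>"
    unfolding left_diff_distrib distrib_right by linarith+
  from bounds[OF this] z
  have "\<bar>\<bar>z\<bar> powr p - \<bar>g\<bar> powr p\<bar> \<le> (1 + \<eta>) powr p * \<bar>g\<bar> powr p - (1 - \<eta>) powr p * \<bar>g\<bar> powr p"
    by linarith
  moreover have "0 \<le> (1 + 1 / \<eta>) powr p * \<bar>z - g\<bar> powr p" by simp
  ultimately show ?thesis unfolding left_diff_distrib by linarith
next
  case False
  have gz: "\<bar>g\<bar> \<le> (1 / \<eta>) * \<bar>z - g\<bar>" using False \<eta> by (simp add: field_simps)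
  have "\<bar>z\<bar> \<le> \<bar>z - g\<bar> + \<bar>g\<bar>" by linarith
  also have "\<dots> \<le> \<bar>z - g\<bar> + (1 / \<eta>) * \<bar>z - g\<bar>" using gz by (rule add_left_mono)
  also have "\<dots> = (1 + 1 / \<eta>) * \<bar>z - g\<bar>" by (simp add: distrib_right)
  finally have "\<bar>z\<bar> \<le> (1 + 1 / \<eta>) * \<bar>z - g\<bar>" .
  moreover have "\<bar>g\<bar> \<le> (1 + 1 / \<eta>) * \<bar>z - g\<bar>"
    using gz by (rule order_trans) (simp add: distrib_right)
  ultimately have "\<bar>g\<bar> powr p \<le> ((1 + 1 / \<eta>) * \<bar>z - g\<bar>) powr p" "\<bar>z\<bar> powr p \<le> ((1 + 1 / \<eta>) * \<bar>z - g\<bar>) powr p"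
    using p by (auto intro!: powr_mono2)
  then have "\<bar>\<bar>z\<bar> powr p - \<bar>g\<bar> powr p\<bar> \<le> (1 + 1 / \<eta>) powr p * \<bar>z - g\<bar> powr p"
    using \<eta> by (auto simp: powr_mult abs_le_iff intro: order_trans[rotated])
  moreover have "(1 - \<eta>) powr p \<le> (1 + \<eta>) powr p" using p \<eta> by (intro powr_mono2) auto
  then have "0 \<le> ((1 + \<eta>) powr p - (1 - \<eta>) powr p) * \<bar>g\<bar> powr p" by simp
  ultimately show ?thesis by linarith
qed

lemma sum_half_step_left:
  assumes "n \<le> N"
  shows "(\<Sum>l<n. half_step N W1 W2 l \<omega>) = W1 (real n / 2) \<omega> - W1 0 \<omega>"
proof -
  have "(\<Sum>l<n. half_step N W1 W2 l \<omega>) = (\<Sum>l<n. W1 (real (Suc l) / 2) \<omega> - W1 (real l / 2) \<omega>)"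
    using assms by (intro sum.cong) (auto simp: half_step_def)
  also have "\<dots> = W1 (real n / 2) \<omega> - W1 0 \<omega>"
    using sum_lessThan_telescope[of "\<lambda>l. W1 (real l / 2) \<omega>" n] by simp
  finally show ?thesis .
qed

lemma sum_half_step_right:
  assumes "N \<le> n" "n \<le> 2 * N"
  shows "(\<Sum>l<2*N. half_step N W1 W2 l \<omega>) = (\<Sum>l<n. half_step N W1 W2 l \<omega>) + (W2 (real (2 * N - n) / 2) \<omega> - W2 0 \<omega>)"
proof -
  have "(\<Sum>l<2*N. half_step N W1 W2 l \<omega>) = (\<Sum>l<n. half_step N W1 W2 l \<omega>) + (\<Sum>l\<in>{n..<2*N}. half_step N W1 W2 l \<omega>)"
    using assms by (subst sum.union_disjoint[symmetric]) (auto intro!: sum.cong)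
  also have "(\<Sum>l\<in>{n..<2*N}. half_step N W1 W2 l \<omega>) = (\<Sum>l\<in>{n..<2*N}. (- W2 (real (2 * N - Suc l) / 2) \<omega>) - (- W2 (real (2 * N - l) / 2) \<omega>))"
    using assms by (intro sum.cong) (auto simp: half_step_def)
  also have "\<dots> = W2 (real (2 * N - n) / 2) \<omega> - W2 0 \<omega>"
    using sum_Suc_diff'[OF assms(2), of "\<lambda>l. - W2 (real (2 * N - l) / 2) \<omega>"] by simp
  finally show ?thesis .
qed

text \<open>The hypotheses say nothing about \<open>\<epsilon> (N div 2 + 1)\<close> along the sequence with index \<open>N\<close>: the left
  sums stop before it and the right sums start after it. It is controlled by the left sums of
  index \<open>N + 2\<close>, whose Wiener process is called \<open>W'\<close>.\<close>

lemma cusum_walk_bridge_bound: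
  fixes e :: "nat \<Rightarrow> real"
  assumes N: "N \<ge> 3" and z: "0 \<le> \<zeta>" "\<zeta> \<le> 1" and C: "C \<ge> 0" and s: "\<sigma> \<ge> 0"
    and W0: "W1 0 \<omega> = 0" "W2 0 \<omega> = 0"
    and left: "\<And>k. 1 \<le> k \<Longrightarrow> real k \<le> real N / 2 \<Longrightarrow> \<bar>(\<Sum>i = 1..k. e i) - \<sigma> * W1 (real k) \<omega>\<bar> \<le> C * real k powr \<zeta>"
    and right: "\<And>k. real N / 2 < real k \<Longrightarrow> k < N \<Longrightarrow> \<bar>(\<Sum>i = k + 1..N. e i) - \<sigma> * W2 (real (N - k)) \<omega>\<bar> \<le> C * real (N - k) powr \<zeta>"
    and left': "\<And>k. 1 \<le> k \<Longrightarrow> real k \<le> real (N + 2) / 2 \<Longrightarrow> \<bar>(\<Sum>i = 1..k. e i) - \<sigma> * W' (real k)\<bar> \<le> C * real k powr \<zeta>"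
    and incr: "\<bar>W1 (real N / 2) \<omega> - W1 (real (N div 2)) \<omega>\<bar> \<le> C" "\<bar>W2 (real N / 2) \<omega> - W2 (real (N - (N div 2 + 1))) \<omega>\<bar> \<le> C"
      "\<bar>W' (real (N div 2 + 1)) - W' (real (N div 2))\<bar> \<le> C"
    and k: "k \<in> {1..<N}"
  shows "\<bar>((\<Sum>i = 1..k. e i) - real k / real N * (\<Sum>i = 1..N. e i)) / sqrt (real N) - \<sigma> * walk_bridge N W1 W2 k \<omega>\<bar>
     \<le> C * (5 + 3 * \<sigma>) * (real (min k (N - k)) powr \<zeta> / sqrt (real N))"
proof -
  define m where "m = N div 2"
  define S where "S j = (\<Sum>l<2*j. half_step N W1 W2 l \<omega>)" for j
  define T where "T j = (\<Sum>i = 1..j. e i)" for j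
  \<comment> \<open>\<open>D\<close> is the error of the uncentred sums; that of the centred ones is
    \<open>D k - k / N * D N\<close>.\<close>
  define D where "D j = T j - \<sigma> * S j" for j
  have m: "1 \<le> m" "m + 1 < N" "real m \<le> real N / 2" "real N / 2 < real (m + 1)" "2 * m \<le> N"
    using N by (auto simp: m_def)
  have Nz: "1 \<le> real N powr \<zeta>" using N z by (intro ge_one_powr_ge_zero) auto
  have pm: "real j powr \<zeta> \<le> real N powr \<zeta>" if "j \<le> N" for j
    using that z by (intro powr_mono2) auto
  have Cp: "C * real j powr \<zeta> \<le> C * real N powr \<zeta>" if "j \<le> N" for j
    using pm[OF that] C by (rule mult_left_mono)
  have C1: "C \<le> C * real N powr \<zeta>" using mult_left_mono[OF Nz C] by simp
  have SN: "S N = W1 (real N / 2) \<omega> + W2 (real N / 2) \<omega>"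
    using sum_half_step_left[of N N W1 W2 \<omega>] sum_half_step_right[of N N W1 W2 \<omega>] W0 by (simp add: S_def)
  have sC: "\<bar>\<sigma> * a\<bar> \<le> \<sigma> * C" if "\<bar>a\<bar> \<le> C" for a
    using that s by (simp add: abs_mult mult_left_mono)
  \<comment> \<open>A difference of two left sums of index \<open>N + 2\<close>, which reach
    \<open>m + 1\<close>. The constant counts two approximation errors and one increment of
    \<open>W'\<close>, multiplied by \<open>\<sigma>\<close>.\<close>
  have e: "\<bar>e (m + 1)\<bar> \<le> (2 + \<sigma>) * C * real N powr \<zeta>"
  proof -
    have "e (m + 1) = (T (m + 1) - \<sigma> * W' (real (m + 1))) - (T m - \<sigma> * W' (real m)) + \<sigma> * (W' (real (m + 1)) - W' (real m))"
      by (simp add: T_def algebra_simps)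
    moreover have "\<bar>T (m + 1) - \<sigma> * W' (real (m + 1))\<bar> \<le> C * real N powr \<zeta>"
      unfolding T_def by (rule order_trans[OF left' Cp]) (use m in auto)
    moreover have "\<bar>T m - \<sigma> * W' (real m)\<bar> \<le> C * real N powr \<zeta>"
      unfolding T_def by (rule order_trans[OF left' Cp]) (use m in auto)
    moreover have "\<bar>\<sigma> * (W' (real (m + 1)) - W' (real m))\<bar> \<le> \<sigma> * C"
      by (rule sC) (use incr(3) in \<open>simp add: m_def\<close>)
    moreover have "\<sigma> * C \<le> \<sigma> * (C * real N powr \<zeta>)" using C1 s by (rule mult_left_mono)
    ultimately have "\<bar>e (m + 1)\<bar> \<le> 2 * (C * real N powr \<zeta>) + \<sigma> * (C * real N powr \<zeta>)" by linarith
    then show ?thesis by (simp add: algebra_simps)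
  qed
  \<comment> \<open>The constant \<open>4 + 3 * \<sigma>\<close> adds two approximation errors, the
    middle error term with \<open>2 + \<sigma>\<close>, and the increments of \<open>W1\<close> and
    \<open>W2\<close> between their last controlled integer times and \<open>N / 2\<close>.\<close>
  have DN: "\<bar>D N\<bar> \<le> C * (4 + 3 * \<sigma>) * real N powr \<zeta>"
  proof -
    have "{1..N} = {1..m} \<union> {m + 1} \<union> {m + 1 + 1..N}" using m by auto
    then have "T N = T m + e (m + 1) + (\<Sum>i = m + 1 + 1..N. e i)"
      by (simp add: T_def sum.union_disjoint)
    then have "D N = (T m - \<sigma> * W1 (real m) \<omega>) + e (m + 1) + ((\<Sum>i = m + 1 + 1..N. e i) - \<sigma> * W2 (real (N - (m + 1))) \<omega>)
        - \<sigma> * (W1 (real N / 2) \<omega> - W1 (real m) \<omega>) - \<sigma> * (W2 (real N / 2) \<omega> - W2 (real (N - (m + 1))) \<omega>)"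
      by (simp add: D_def SN algebra_simps)
    moreover have "\<bar>T m - \<sigma> * W1 (real m) \<omega>\<bar> \<le> C * real N powr \<zeta>"
      unfolding T_def by (rule order_trans[OF left Cp]) (use m in auto)
    moreover have "\<bar>(\<Sum>i = m + 1 + 1..N. e i) - \<sigma> * W2 (real (N - (m + 1))) \<omega>\<bar> \<le> C * real N powr \<zeta>"
      by (rule order_trans[OF right Cp]) (use m in auto)
    moreover have "\<bar>\<sigma> * (W1 (real N / 2) \<omega> - W1 (real m) \<omega>)\<bar> \<le> \<sigma> * C" "\<bar>\<sigma> * (W2 (real N / 2) \<omega> - W2 (real (N - (m + 1))) \<omega>)\<bar> \<le> \<sigma> * C"
      using incr by (auto intro!: sC simp: m_def)
    moreover have "\<sigma> * C \<le> \<sigma> * (C * real N powr \<zeta>)" using C1 s by (rule mult_left_mono)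
    ultimately have "\<bar>D N\<bar> \<le> 2 * (C * real N powr \<zeta>) + (2 + \<sigma>) * C * real N powr \<zeta> + 2 * (\<sigma> * (C * real N powr \<zeta>))"
      using e unfolding abs_le_iff by linarith
    then show ?thesis by (simp add: algebra_simps)
  qed
  \<comment> \<open>The error at \<open>N\<close> has order \<open>N powr \<zeta>\<close>, too large
    near the ends. Its prefactor \<open>j / N\<close> repairs this:
    \<open>j / N \<le> (j / N) powr \<zeta>\<close> as \<open>\<zeta> \<le> 1\<close>. It is used
    for \<open>j = k\<close> and for \<open>j = N - k\<close>.\<close>
  have frac: "real j / real N * \<bar>D N\<bar> \<le> C * (4 + 3 * \<sigma>) * real j powr \<zeta>" if "1 \<le> j" "j \<le> N" for j
  proof -
    have "real j / real N = (real j / real N) powr 1" using that by simp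
    also have "\<dots> \<le> (real j / real N) powr \<zeta>" using that z by (intro powr_mono') auto
    finally have "real j / real N * real N powr \<zeta> \<le> (real j / real N) powr \<zeta> * real N powr \<zeta>"
      by (intro mult_right_mono) auto
    also have "\<dots> = real j powr \<zeta>" using that by (simp flip: powr_mult)
    finally have a: "real j / real N * real N powr \<zeta> \<le> real j powr \<zeta>" .
    have "real j / real N * \<bar>D N\<bar> \<le> real j / real N * (C * (4 + 3 * \<sigma>) * real N powr \<zeta>)"
      using DN by (rule mult_left_mono) auto
    also have "\<dots> = C * (4 + 3 * \<sigma>) * (real j / real N * real N powr \<zeta>)" by simp
    also have "\<dots> \<le> C * (4 + 3 * \<sigma>) * real j powr \<zeta>" using a C s by (intro mult_left_mono) auto
    finally show ?thesis .
  qed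
  have k': "1 \<le> k" "k < N" using k by auto
  have num: "\<bar>D k - real k / real N * D N\<bar> \<le> C * (5 + 3 * \<sigma>) * real (min k (N - k)) powr \<zeta>"
  proof (cases "2 * k \<le> N")
    case True
    then have "S k = W1 (real k) \<omega>" using sum_half_step_left[of "2 * k" N W1 W2 \<omega>] W0 by (simp add: S_def)
    then have d: "\<bar>D k\<bar> \<le> C * real k powr \<zeta>" using left[of k] k' True by (simp add: D_def T_def)
    have tri: "\<bar>D k - real k / real N * D N\<bar> \<le> \<bar>D k\<bar> + real k / real N * \<bar>D N\<bar>"
      using abs_triangle_ineq4[of "D k" "real k / real N * D N"] by (simp add: abs_mult)
    have f: "real k / real N * \<bar>D N\<bar> \<le> C * (4 + 3 * \<sigma>) * real k powr \<zeta>" using k' by (intro frac) auto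
    have "\<bar>D k - real k / real N * D N\<bar> \<le> C * real k powr \<zeta> + C * (4 + 3 * \<sigma>) * real k powr \<zeta>"
      by (rule order_trans[OF tri add_mono[OF d f]])
    moreover have "min k (N - k) = k" using True by auto
    ultimately show ?thesis by (simp add: algebra_simps)
  next
    case False
    have "S N = S k + W2 (real (N - k)) \<omega>"
    proof -
      have "real (2 * N - 2 * k) / 2 = real (N - k)" using k' by (simp add: of_nat_diff)
      then show ?thesis using sum_half_step_right[of N "2 * k" W1 W2 \<omega>] W0 False k'
        by (simp add: S_def diff_divide_distrib)
    qed
    moreover have "T N = T k + (\<Sum>i = k + 1..N. e i)"
    proof -
      have "{1..N} = {1..k} \<union> {k + 1..N}" using k' by auto
      then show ?thesis by (simp add: T_def sum.union_disjoint)
    qed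
    ultimately have "D N - D k = (\<Sum>i = k + 1..N. e i) - \<sigma> * W2 (real (N - k)) \<omega>"
      by (simp add: D_def algebra_simps)
    then have d: "\<bar>D N - D k\<bar> \<le> C * real (N - k) powr \<zeta>" using right[of k] k' False by simp
    \<comment> \<open>Seen from the right end: the prefactor of \<open>D N\<close> becomes the
      distance to that end, and \<open>D N - D k\<close> is controlled by the right sums.\<close>
    have eq: "D k - real k / real N * D N = real (N - k) / real N * D N - (D N - D k)"
      using k' by (simp add: of_nat_diff diff_divide_distrib algebra_simps)
    have tri: "\<bar>real (N - k) / real N * D N - (D N - D k)\<bar> \<le> real (N - k) / real N * \<bar>D N\<bar> + \<bar>D N - D k\<bar>"
      using abs_triangle_ineq4[of "real (N - k) / real N * D N" "D N - D k"] by (simp add: abs_mult)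
    have f: "real (N - k) / real N * \<bar>D N\<bar> \<le> C * (4 + 3 * \<sigma>) * real (N - k) powr \<zeta>" using k' by (intro frac) auto
    have "\<bar>D k - real k / real N * D N\<bar> \<le> C * (4 + 3 * \<sigma>) * real (N - k) powr \<zeta> + C * real (N - k) powr \<zeta>"
      unfolding eq by (rule order_trans[OF tri add_mono[OF f d]])
    moreover have "min k (N - k) = N - k" using False by auto
    ultimately show ?thesis by (simp add: algebra_simps)
  qed
  have "(T k - real k / real N * T N) / sqrt (real N) - \<sigma> * walk_bridge N W1 W2 k \<omega> = (D k - real k / real N * D N) / sqrt (real N)"
    by (simp add: walk_bridge_def D_def S_def diff_divide_distrib[symmetric] algebra_simps)
  moreover have "\<bar>(D k - real k / real N * D N) / sqrt (real N)\<bar> \<le> C * (5 + 3 * \<sigma>) * real (min k (N - k)) powr \<zeta> / sqrt (real N)"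
    using divide_right_mono[OF num, of "sqrt (real N)"] by simp
  ultimately show ?thesis by (simp add: T_def)
qed

section \<open>Weak convergence through a coupling and equality of laws\<close>

lemma (in prob_space) prob_le_shift:
  fixes x d :: real
  assumes [measurable]: "X \<in> borel_measurable M" "Y \<in> borel_measurable M"
  shows "prob {\<omega> \<in> space M. X \<omega> \<le> x} \<le> prob {\<omega> \<in> space M. Y \<omega> \<le> x + d} + prob {\<omega> \<in> space M. \<bar>X \<omega> - Y \<omega>\<bar> > d}"
proof -
  have "prob {\<omega> \<in> space M. X \<omega> \<le> x} \<le> prob ({\<omega> \<in> space M. Y \<omega> \<le> x + d} \<union> {\<omega> \<in> space M. \<bar>X \<omega> - Y \<omega>\<bar> > d})"
  proof (rule finite_measure_mono)
    have "a \<le> x \<Longrightarrow> \<not> d < \<bar>a - b\<bar> \<Longrightarrow> b \<le> x + d" for a b :: real by linarith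
    then show "{\<omega> \<in> space M. X \<omega> \<le> x} \<subseteq> {\<omega> \<in> space M. Y \<omega> \<le> x + d} \<union> {\<omega> \<in> space M. \<bar>X \<omega> - Y \<omega>\<bar> > d}"
      by blast
  qed measurable
  also have "\<dots> \<le> prob {\<omega> \<in> space M. Y \<omega> \<le> x + d} + prob {\<omega> \<in> space M. \<bar>X \<omega> - Y \<omega>\<bar> > d}"
    by (rule measure_Un_le) measurable
  finally show ?thesis .
qed

lemma cdf_distr:
  assumes [measurable]: "X \<in> borel_measurable M"
  shows "cdf (distr M borel X) x = measure M {\<omega> \<in> space M. X \<omega> \<le> x}"
  unfolding cdf_def by (subst measure_distr) (auto intro!: arg_cong[where f="measure M"])

text \<open>A Slutsky argument that changes the probability space in the middle. Each of the
  comparisons of \<open>Y\<close> with \<open>V\<close> and of \<open>U\<close> with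
  \<open>U'\<close> shifts the argument of the distribution function by \<open>d\<close> and costs
  one exceptional probability; the law equality between them is exact.\<close>

lemma weak_conv_of_coupled:
  fixes Y V :: "nat \<Rightarrow> 'a \<Rightarrow> real" and U :: "nat \<Rightarrow> 'b \<Rightarrow> real" and U' :: "'b \<Rightarrow> real"
  assumes M: "prob_space M" and M': "prob_space M'"
    and meas: "\<And>N. Y N \<in> borel_measurable M" "\<And>N. N \<ge> 1 \<Longrightarrow> V N \<in> borel_measurable M"
      "\<And>N. N \<ge> 1 \<Longrightarrow> U N \<in> borel_measurable M'" "U' \<in> borel_measurable M'"
    and law: "\<And>N. N \<ge> 1 \<Longrightarrow> distr M borel (V N) = distr M' borel (U N)"
    and YV: "\<And>d. d > 0 \<Longrightarrow> (\<lambda>N. measure M {\<omega> \<in> space M. \<bar>Y N \<omega> - V N \<omega>\<bar> > d}) \<longlonglongrightarrow> 0"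
    and UU: "\<And>d. d > 0 \<Longrightarrow> (\<lambda>N. measure M' {\<omega> \<in> space M'. \<bar>U N \<omega> - U' \<omega>\<bar> > d}) \<longlonglongrightarrow> 0"
  shows "weak_conv_m (\<lambda>N. distr M borel (Y N)) (distr M' borel U')"
  unfolding weak_conv_m_def weak_conv_def
proof (intro allI impI)
  interpret M: prob_space M by fact
  interpret M': prob_space M' by fact
  let ?F = "cdf (distr M' borel U')"
  fix x assume cont: "isCont ?F x"
  show "(\<lambda>N. cdf (distr M borel (Y N)) x) \<longlonglongrightarrow> ?F x"
  proof (rule LIMSEQ_I)
    fix r :: real assume r: "r > 0"
    then obtain s where s: "s > 0" "\<And>y. \<bar>y - x\<bar> < s \<Longrightarrow> \<bar>?F y - ?F x\<bar> < r / 3"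
      using cont[unfolded continuous_at_eps_delta, rule_format, of "r / 3"] by (auto simp: dist_real_def)
    \<comment> \<open>Two shifts by \<open>d\<close> remain within the continuity window
      \<open>s\<close>. The three parts of \<open>r\<close> go to continuity and to the two
      exceptional probabilities.\<close>
    define d where "d = s / 4"
    have d: "d > 0" using s by (simp add: d_def)
    have Fx: "\<bar>?F (x + 2 * d) - ?F x\<bar> < r / 3" "\<bar>?F (x - 2 * d) - ?F x\<bar> < r / 3"
      using s(2)[of "x + 2 * d"] s(2)[of "x - 2 * d"] s(1) by (simp_all add: d_def)
    then have Fx': "?F (x + 2 * d) < ?F x + r / 3" "?F x - r / 3 < ?F (x - 2 * d)" by linarith+
    have "\<forall>\<^sub>F N in sequentially. measure M {\<omega> \<in> space M. \<bar>Y N \<omega> - V N \<omega>\<bar> > d} < r / 3"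
      by (rule order_tendstoD(2)[OF YV[OF d]]) (use r in auto)
    moreover have "\<forall>\<^sub>F N in sequentially. measure M' {\<omega> \<in> space M'. \<bar>U N \<omega> - U' \<omega>\<bar> > d} < r / 3"
      by (rule order_tendstoD(2)[OF UU[OF d]]) (use r in auto)
    moreover have "\<forall>\<^sub>F N in sequentially. (N::nat) \<ge> 1" by (rule eventually_ge_at_top)
    ultimately have "\<forall>\<^sub>F N in sequentially. norm (cdf (distr M borel (Y N)) x - ?F x) < r"
    proof eventually_elim
      case (elim N)
      have [measurable]: "Y N \<in> borel_measurable M" "V N \<in> borel_measurable M" "U N \<in> borel_measurable M'" "U' \<in> borel_measurable M'"
        using meas elim(3) by auto
      have VU: "measure M {\<omega> \<in> space M. V N \<omega> \<le> y} = measure M' {\<omega> \<in> space M'. U N \<omega> \<le> y}" for y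
        using law[OF elim(3)] cdf_distr[of "V N" M y] cdf_distr[of "U N" M' y] by simp
      have "measure M {\<omega> \<in> space M. Y N \<omega> \<le> x} \<le> measure M {\<omega> \<in> space M. V N \<omega> \<le> x + d} + measure M {\<omega> \<in> space M. \<bar>Y N \<omega> - V N \<omega>\<bar> > d}"
        by (rule M.prob_le_shift) auto
      moreover have "measure M' {\<omega> \<in> space M'. U N \<omega> \<le> x + d} \<le> measure M' {\<omega> \<in> space M'. U' \<omega> \<le> x + d + d} + measure M' {\<omega> \<in> space M'. \<bar>U N \<omega> - U' \<omega>\<bar> > d}"
        by (rule M'.prob_le_shift) auto
      moreover have "measure M' {\<omega> \<in> space M'. U' \<omega> \<le> x - 2 * d} \<le> measure M' {\<omega> \<in> space M'. U N \<omega> \<le> x - 2 * d + d} + measure M' {\<omega> \<in> space M'. \<bar>U' \<omega> - U N \<omega>\<bar> > d}"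
        by (rule M'.prob_le_shift) auto
      moreover have "measure M {\<omega> \<in> space M. V N \<omega> \<le> x - d} \<le> measure M {\<omega> \<in> space M. Y N \<omega> \<le> x - d + d} + measure M {\<omega> \<in> space M. \<bar>V N \<omega> - Y N \<omega>\<bar> > d}"
        by (rule M.prob_le_shift) auto
      moreover have "x + d + d = x + 2 * d" "x - 2 * d + d = x - d" "x - d + d = x" by auto
      ultimately show ?case
        using elim(1,2) Fx' VU[of "x + d"] VU[of "x - d"]
        by (simp add: cdf_distr abs_minus_commute abs_less_iff)
    qed
    then show "\<exists>no. \<forall>n\<ge>no. norm (cdf (distr M borel (Y n)) x - ?F x) < r"
      by (simp add: eventually_sequentially)
  qed
qed

text \<open>Chebyshev's inequality, uniform over all increments of length at most 1; it bounds the
  gaps between \<open>N / 2\<close> and neighbouring integers. The case \<open>s = t\<close> is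
  separate because the normal law is given for \<open>s < t\<close>.\<close>

lemma wiener_increment_tail:
  assumes W: "wiener_process M T W" and st: "0 \<le> s" "s \<le> t" "t \<le> T" "t - s \<le> 1" and C: "C > 0"
  shows "measure M {\<omega> \<in> space M. \<bar>W t \<omega> - W s \<omega>\<bar> > C} \<le> 1 / C\<^sup>2"
proof (cases "s = t")
  case False
  interpret prob_space M using W by (simp add: wiener_process_def)
  have [measurable]: "W s \<in> borel_measurable M" "W t \<in> borel_measurable M"
    using wiener_measurable[OF W] st by auto
  have D: "distributed M lborel (\<lambda>\<omega>. W t \<omega> - W s \<omega>) (normal_density 0 (sqrt (t - s)))"
    using W st False by (auto simp: wiener_process_def)
  then have g: "gaussian_rv M (\<lambda>\<omega>. W t \<omega> - W s \<omega>)"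
    unfolding gaussian_rv_def using st False
    by (intro conjI disjI1 exI[of _ 0] exI[of _ "sqrt (t - s)"]) auto
  have e: "expectation (\<lambda>\<omega>. W t \<omega> - W s \<omega>) = 0"
    using normal_distributed_expectation[OF _ D] st False by simp
  have v: "variance (\<lambda>\<omega>. W t \<omega> - W s \<omega>) = t - s"
    using normal_distributed_variance[OF _ D] st False by simp
  have "prob {\<omega> \<in> space M. \<bar>W t \<omega> - W s \<omega>\<bar> > C} \<le> prob {\<omega> \<in> space M. C \<le> \<bar>(W t \<omega> - W s \<omega>) - expectation (\<lambda>\<omega>. W t \<omega> - W s \<omega>)\<bar>}"
    unfolding e by (rule finite_measure_mono) auto
  also have "\<dots> \<le> variance (\<lambda>\<omega>. W t \<omega> - W s \<omega>) / C\<^sup>2"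
    by (rule Chebyshev_inequality) (use gaussian_rv_char(1)[OF g e] C in auto)
  also have "\<dots> \<le> 1 / C\<^sup>2" unfolding v using st by (intro divide_right_mono) auto
  finally show ?thesis .
qed (use C in simp)

text \<open>Tail probabilities decrease in \<open>C\<close>, so the constant may be enlarged at
  will; this lets several sequences share one constant.\<close>

lemma bounded_in_probabilityD:
  assumes M: "prob_space M" and Y: "bounded_in_probability M Y"
    and meas: "\<And>N. N \<ge> 1 \<Longrightarrow> Y N \<in> borel_measurable M" and e: "e > 0"
  shows "\<exists>C0. \<forall>C\<ge>C0. \<forall>\<^sub>F N in sequentially. measure M {\<omega> \<in> space M. \<bar>Y N \<omega>\<bar> > C} < e"
proof -
  interpret prob_space M by fact
  obtain C0 where C0: "\<forall>\<^sub>F N in sequentially. measure M {\<omega> \<in> space M. \<bar>Y N \<omega>\<bar> > C0} < e"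
    using Y e by (auto simp: bounded_in_probability_def)
  have "\<forall>\<^sub>F N in sequentially. measure M {\<omega> \<in> space M. \<bar>Y N \<omega>\<bar> > C} < e" if "C \<ge> C0" for C
    using C0 eventually_ge_at_top[of 1]
  proof eventually_elim
    case (elim N)
    have [measurable]: "Y N \<in> borel_measurable M" using meas elim by auto
    have "measure M {\<omega> \<in> space M. \<bar>Y N \<omega>\<bar> > C} \<le> measure M {\<omega> \<in> space M. \<bar>Y N \<omega>\<bar> > C0}"
      using that by (intro finite_measure_mono) auto
    then show ?case using elim by simp
  qed
  then show ?thesis by blast
qed

text \<open>The exponent is raised to \<open>max \<zeta> 0\<close>, at no cost since
  \<open>r k \<ge> 1\<close>. The pathwise bound replaces \<open>j powr \<zeta>\<close> by
  \<open>N powr \<zeta>\<close>, which asks for a nonnegative exponent.\<close>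

lemma powr_weighted_SUP_le:
  fixes A :: "nat set" and f :: "nat \<Rightarrow> real" and r :: "nat \<Rightarrow> nat"
  assumes A: "finite A" "k \<in> A" and r: "r k \<ge> 1" and f: "f k \<ge> 0"
    and C: "\<bar>SUP k\<in>A. real (r k) powr (- \<zeta>) * f k\<bar> \<le> C"
  shows "f k \<le> C * real (r k) powr (max \<zeta> 0)"
proof -
  have "real (r k) powr (- \<zeta>) * f k \<le> (SUP k\<in>A. real (r k) powr (- \<zeta>) * f k)"
    using A by (intro cSUP_upper) auto
  then have "real (r k) powr (- \<zeta>) * f k \<le> C" using C by linarith
  then have "real (r k) powr \<zeta> * (real (r k) powr (- \<zeta>) * f k) \<le> real (r k) powr \<zeta> * C"
    by (intro mult_left_mono) auto
  also have "real (r k) powr \<zeta> * (real (r k) powr (- \<zeta>) * f k) = f k"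
    using r by (simp add: powr_minus)
  finally have "f k \<le> C * real (r k) powr \<zeta>" by (simp add: mult.commute)
  also have "\<dots> \<le> C * real (r k) powr (max \<zeta> 0)"
    using C r by (intro mult_left_mono powr_mono) auto
  finally show ?thesis .
qed

lemma wiener_process_0: "wiener_process M T W \<Longrightarrow> AE \<omega> in M. W 0 \<omega> = 0"
  by (simp add: wiener_process_def)

lemma (in prob_space) prob_Un_less:
  assumes "A \<in> events" "B \<in> events" "prob A < a" "prob B < b"
  shows "prob (A \<union> B) < a + b"
  using measure_Un_le[OF assms(1,2)] assms(3,4) by linarith

text \<open>The pathwise bound holds outside eight events: three large suprema, three large Wiener
  increments and two nonzero starting values. Each has probability below \<open>e / 8\<close> for
  large \<open>N\<close>.\<close>

lemma cusum_walk_bridge_in_probability: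
  fixes \<epsilon> :: "nat \<Rightarrow> 'a \<Rightarrow> real" and W1 W2 :: "nat \<Rightarrow> real \<Rightarrow> 'a \<Rightarrow> real"
  assumes M: "prob_space M"
    and errors: "\<And>i. i \<ge> 1 \<Longrightarrow> \<epsilon> i \<in> borel_measurable M"
    and \<sigma>: "\<sigma> > 0" and \<zeta>: "\<zeta> < 1/2"
    and W1: "\<And>N. N \<ge> 1 \<Longrightarrow> wiener_process M (real N / 2) (W1 N)"
    and W2: "\<And>N. N \<ge> 1 \<Longrightarrow> wiener_process M (real N / 2) (W2 N)"
    and approx1: "bounded_in_probability M (\<lambda>N \<omega>.
          SUP k \<in> {k::nat. 1 \<le> k \<and> real k \<le> real N / 2}.
            real k powr (- \<zeta>) * \<bar>(\<Sum>i = 1..k. \<epsilon> i \<omega>) - \<sigma> * W1 N (real k) \<omega>\<bar>)"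
    and approx2: "bounded_in_probability M (\<lambda>N \<omega>.
          SUP k \<in> {k::nat. real N / 2 < real k \<and> k < N}.
            real (N - k) powr (- \<zeta>) *
              \<bar>(\<Sum>i = k + 1..N. \<epsilon> i \<omega>) - \<sigma> * W2 N (real (N - k)) \<omega>\<bar>)"
    and e: "e > 0"
  obtains K where "K > 0"
    "\<forall>\<^sub>F N in sequentially. \<exists>A\<in>sets M. measure M A < e \<and> (\<forall>\<omega>\<in>space M - A. \<forall>k\<in>{1..<N}.
       \<bar>((\<Sum>i = 1..k. \<epsilon> i \<omega>) - real k / real N * (\<Sum>i = 1..N. \<epsilon> i \<omega>)) / sqrt (real N)
          - \<sigma> * walk_bridge N (W1 N) (W2 N) k \<omega>\<bar> \<le> K * (real (min k (N - k)) powr (max \<zeta> 0) / sqrt (real N)))"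
proof -
  interpret prob_space M by fact
  define I1 where "I1 N = {k::nat. 1 \<le> k \<and> real k \<le> real N / 2}" for N :: nat
  define I2 where "I2 N = {k::nat. real N / 2 < real k \<and> k < N}" for N :: nat
  define S1 where "S1 N \<omega> = (SUP k \<in> I1 N. real k powr (- \<zeta>) * \<bar>(\<Sum>i = 1..k. \<epsilon> i \<omega>) - \<sigma> * W1 N (real k) \<omega>\<bar>)" for N \<omega>
  define S2 where "S2 N \<omega> = (SUP k \<in> I2 N. real (N - k) powr (- \<zeta>) * \<bar>(\<Sum>i = k + 1..N. \<epsilon> i \<omega>) - \<sigma> * W2 N (real (N - k)) \<omega>\<bar>)" for N \<omega>
  have fin: "finite (I1 N)" "finite (I2 N)" for N
    by (rule finite_subset[of _ "{..N}"]; auto simp: I1_def I2_def)+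
  have sm: "(\<lambda>\<omega>. \<Sum>i = j..k. \<epsilon> i \<omega>) \<in> borel_measurable M" if "j \<ge> 1" for j k
    using that by (intro borel_measurable_sum errors) auto
  have S1m [measurable]: "S1 N \<in> borel_measurable M" if N: "N \<ge> 1" for N
    unfolding S1_def
  proof (rule borel_measurable_cSUP)
    fix k assume k: "k \<in> I1 N"
    have [measurable]: "W1 N (real k) \<in> borel_measurable M"
      by (rule wiener_measurable[OF W1[OF N]]) (use k in \<open>auto simp: I1_def\<close>)
    note [measurable] = sm[of 1 k]
    show "(\<lambda>\<omega>. real k powr (- \<zeta>) * \<bar>(\<Sum>i = 1..k. \<epsilon> i \<omega>) - \<sigma> * W1 N (real k) \<omega>\<bar>) \<in> borel_measurable M"
      by measurable
  qed (use fin in \<open>auto intro: countable_finite\<close>)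
  have S2m [measurable]: "S2 N \<in> borel_measurable M" if N: "N \<ge> 1" for N
    unfolding S2_def
  proof (rule borel_measurable_cSUP)
    fix k assume k: "k \<in> I2 N"
    have [measurable]: "W2 N (real (N - k)) \<in> borel_measurable M"
      by (rule wiener_measurable[OF W2[OF N]]) (use k in \<open>auto simp: I2_def\<close>)
    note [measurable] = sm[of "k + 1" N]
    show "(\<lambda>\<omega>. real (N - k) powr (- \<zeta>) * \<bar>(\<Sum>i = k + 1..N. \<epsilon> i \<omega>) - \<sigma> * W2 N (real (N - k)) \<omega>\<bar>) \<in> borel_measurable M"
      by measurable
  qed (use fin in \<open>auto intro: countable_finite\<close>)
  have e8: "e / 8 > 0" using e by simp
  have "bounded_in_probability M S1" "bounded_in_probability M S2"
    using approx1 approx2 by (simp_all add: S1_def[abs_def] S2_def[abs_def] I1_def I2_def)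
  note bip = this
  obtain C1 where C1: "\<And>C. C \<ge> C1 \<Longrightarrow> \<forall>\<^sub>F N in sequentially. prob {\<omega> \<in> space M. \<bar>S1 N \<omega>\<bar> > C} < e / 8"
    using bounded_in_probabilityD[OF M bip(1) S1m e8] by blast
  obtain C2 where C2: "\<And>C. C \<ge> C2 \<Longrightarrow> \<forall>\<^sub>F N in sequentially. prob {\<omega> \<in> space M. \<bar>S2 N \<omega>\<bar> > C} < e / 8"
    using bounded_in_probabilityD[OF M bip(2) S2m e8] by blast
  \<comment> \<open>One constant for all events. From \<open>C \<ge> 1\<close> and
    \<open>C \<ge> 16 / e\<close> the Chebyshev bound satisfies
    \<open>1 / C\<^sup>2 \<le> 1 / C \<le> e / 16\<close>.\<close>
  define C where "C = max (max C1 C2) (max 1 (16 / e))"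
  have C: "C \<ge> C1" "C \<ge> C2" "C \<ge> 1" "C > 0" by (auto simp: C_def)
  have "1 / C\<^sup>2 \<le> 1 / C"
    using C by (intro divide_left_mono) (auto simp: power2_eq_square)
  also have "16 / e \<le> C" by (simp add: C_def)
  then have "1 / C \<le> e / 16" using e C(4) by (simp add: field_simps)
  finally have Csq: "1 / C\<^sup>2 < e / 8" using e by linarith
  have nul: "prob {\<omega> \<in> space M. W \<omega> \<noteq> 0} < e / 8" if "AE \<omega> in M. W \<omega> = 0" "W \<in> borel_measurable M" for W :: "'a \<Rightarrow> real"
  proof -
    have "prob {\<omega> \<in> space M. W \<omega> \<noteq> 0} = 0"
      using that by (subst prob_eq_0) auto
    then show ?thesis using e8 by simp
  qed
  show thesis
  proof (rule that)
    show "C * (5 + 3 * \<sigma>) > 0" using C(4) \<sigma> by simp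
    \<comment> \<open>Boundedness along the shifted sequence supplies the process \<open>W'\<close>
      that controls the middle error term.\<close>
    have "\<forall>\<^sub>F N in sequentially. prob {\<omega> \<in> space M. \<bar>S1 (N + 2) \<omega>\<bar> > C} < e / 8"
      using sequentially_offset[OF C1[OF C(1)], of 2] .
    moreover note C1[OF C(1)] C2[OF C(2)] eventually_ge_at_top[of "3::nat"]
    ultimately show "\<forall>\<^sub>F N in sequentially. \<exists>A\<in>sets M. measure M A < e \<and> (\<forall>\<omega>\<in>space M - A. \<forall>k\<in>{1..<N}.
       \<bar>((\<Sum>i = 1..k. \<epsilon> i \<omega>) - real k / real N * (\<Sum>i = 1..N. \<epsilon> i \<omega>)) / sqrt (real N)
          - \<sigma> * walk_bridge N (W1 N) (W2 N) k \<omega>\<bar> \<le> C * (5 + 3 * \<sigma>) * (real (min k (N - k)) powr (max \<zeta> 0) / sqrt (real N)))"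
    proof eventually_elim
      case (elim N)
      then have N: "N \<ge> 3" "N \<ge> 1" "N + 2 \<ge> 1" by auto
      define m where "m = N div 2"
      have m: "1 \<le> m" "m + 1 < N" "real m \<le> real N / 2" "real N / 2 < real (m + 1)" "real N / 2 - real m \<le> 1"
        using N by (auto simp: m_def)
      have Nm: "real (N - (m + 1)) = real N - real m - 1" using m by (simp add: of_nat_diff)
      have Nm2: "0 \<le> real (N - (m + 1))" "real (N - (m + 1)) \<le> real N / 2" "real N / 2 - real (N - (m + 1)) \<le> 1"
        using m by (auto simp: Nm)
      let ?D4 = "\<lambda>\<omega>. W1 N (real N / 2) \<omega> - W1 N (real m) \<omega>"
      let ?D5 = "\<lambda>\<omega>. W2 N (real N / 2) \<omega> - W2 N (real (N - (m + 1))) \<omega>"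
      let ?D6 = "\<lambda>\<omega>. W1 (N + 2) (real (m + 1)) \<omega> - W1 (N + 2) (real m) \<omega>"
      have t6: "real (m + 1) \<le> real (N + 2) / 2" "real m \<le> real (m + 1)" "real (m + 1) - real m \<le> 1" using m by auto
      have [measurable]: "W1 N 0 \<in> borel_measurable M" "W2 N 0 \<in> borel_measurable M"
        "W1 N (real N / 2) \<in> borel_measurable M" "W1 N (real m) \<in> borel_measurable M"
        "W2 N (real N / 2) \<in> borel_measurable M" "W2 N (real (N - (m + 1))) \<in> borel_measurable M"
        using m Nm2 by (auto intro!: wiener_measurable[OF W1[OF N(2)]] wiener_measurable[OF W2[OF N(2)]])
      have [measurable]: "W1 (N + 2) (real (m + 1)) \<in> borel_measurable M" "W1 (N + 2) (real m) \<in> borel_measurable M"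
        by (rule wiener_measurable[OF W1[OF N(3)]]; use t6 in linarith)+
      note [measurable] = S1m[OF N(2)] S1m[OF N(3)] S2m[OF N(2)]
      have p4: "prob {\<omega> \<in> space M. \<bar>?D4 \<omega>\<bar> > C} < e / 8"
        using wiener_increment_tail[OF W1[OF N(2)] _ m(3) _ m(5) C(4)] Csq by auto
      have p5: "prob {\<omega> \<in> space M. \<bar>?D5 \<omega>\<bar> > C} < e / 8"
        using wiener_increment_tail[OF W2[OF N(2)] Nm2(1,2) _ Nm2(3) C(4)] Csq by auto
      have p6: "prob {\<omega> \<in> space M. \<bar>?D6 \<omega>\<bar> > C} < e / 8"
        using wiener_increment_tail[OF W1[OF N(3)] _ t6(2) t6(1) t6(3) C(4)] Csq by auto
      have p7: "prob {\<omega> \<in> space M. W1 N 0 \<omega> \<noteq> 0} < e / 8" and p8: "prob {\<omega> \<in> space M. W2 N 0 \<omega> \<noteq> 0} < e / 8"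
        using wiener_process_0[OF W1[OF N(2)]] wiener_process_0[OF W2[OF N(2)]] by (intro nul; simp)+
      define A1 where "A1 = {\<omega> \<in> space M. \<bar>S1 N \<omega>\<bar> > C}"
      define A2 where "A2 = {\<omega> \<in> space M. \<bar>S2 N \<omega>\<bar> > C}"
      define A3 where "A3 = {\<omega> \<in> space M. \<bar>S1 (N + 2) \<omega>\<bar> > C}"
      define A4 where "A4 = {\<omega> \<in> space M. \<bar>?D4 \<omega>\<bar> > C}"
      define A5 where "A5 = {\<omega> \<in> space M. \<bar>?D5 \<omega>\<bar> > C}"
      define A6 where "A6 = {\<omega> \<in> space M. \<bar>?D6 \<omega>\<bar> > C}"
      define A7 where "A7 = {\<omega> \<in> space M. W1 N 0 \<omega> \<noteq> 0}"
      define A8 where "A8 = {\<omega> \<in> space M. W2 N 0 \<omega> \<noteq> 0}"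
      note A_defs = A1_def A2_def A3_def A4_def A5_def A6_def A7_def A8_def
      have ev: "A1 \<in> events" "A2 \<in> events" "A3 \<in> events" "A4 \<in> events" "A5 \<in> events" "A6 \<in> events" "A7 \<in> events" "A8 \<in> events"
        unfolding A_defs by measurable
      have less: "prob A1 < e / 8" "prob A2 < e / 8" "prob A3 < e / 8" "prob A4 < e / 8" "prob A5 < e / 8" "prob A6 < e / 8" "prob A7 < e / 8" "prob A8 < e / 8"
        unfolding A_defs by (fact elim p4 p5 p6 p7 p8)+
      define A where "A = A1 \<union> A2 \<union> A3 \<union> A4 \<union> A5 \<union> A6 \<union> A7 \<union> A8"
      have Am: "A \<in> sets M" unfolding A_def by (intro sets.Un ev)
      have "prob A < e / 8 + e / 8 + e / 8 + e / 8 + e / 8 + e / 8 + e / 8 + e / 8"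
        unfolding A_def by (intro prob_Un_less sets.Un ev less)
      then have pA: "prob A < e" by simp
      show ?case
      proof (intro bexI[OF _ Am] conjI pA ballI)
        fix \<omega> k assume om: "\<omega> \<in> space M - A" and k: "k \<in> {1..<N}"
        have b: "\<bar>S1 N \<omega>\<bar> \<le> C" "\<bar>S2 N \<omega>\<bar> \<le> C" "\<bar>S1 (N + 2) \<omega>\<bar> \<le> C" "\<bar>?D4 \<omega>\<bar> \<le> C" "\<bar>?D5 \<omega>\<bar> \<le> C" "\<bar>?D6 \<omega>\<bar> \<le> C"
          "W1 N 0 \<omega> = 0" "W2 N 0 \<omega> = 0"
          using om unfolding A_def A_defs by (auto simp: not_less)
        show "\<bar>((\<Sum>i = 1..k. \<epsilon> i \<omega>) - real k / real N * (\<Sum>i = 1..N. \<epsilon> i \<omega>)) / sqrt (real N)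
          - \<sigma> * walk_bridge N (W1 N) (W2 N) k \<omega>\<bar> \<le> C * (5 + 3 * \<sigma>) * (real (min k (N - k)) powr (max \<zeta> 0) / sqrt (real N))"
        proof (rule cusum_walk_bridge_bound[where W'="\<lambda>t. W1 (N + 2) t \<omega>"])
          show "\<bar>(\<Sum>i = 1..j. \<epsilon> i \<omega>) - \<sigma> * W1 N (real j) \<omega>\<bar> \<le> C * real j powr max \<zeta> 0"
            if "1 \<le> j" "real j \<le> real N / 2" for j
            by (rule powr_weighted_SUP_le[OF fin(1)[of N], where r="\<lambda>k. k"]) (use that b(1) in \<open>auto simp: I1_def S1_def\<close>)
          show "\<bar>(\<Sum>i = 1..j. \<epsilon> i \<omega>) - \<sigma> * W1 (N + 2) (real j) \<omega>\<bar> \<le> C * real j powr max \<zeta> 0"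
            if "1 \<le> j" "real j \<le> real (N + 2) / 2" for j
            by (rule powr_weighted_SUP_le[OF fin(1)[of "N + 2"], where r="\<lambda>k. k"]) (use that b(3) in \<open>auto simp: I1_def S1_def\<close>)
          show "\<bar>(\<Sum>i = j + 1..N. \<epsilon> i \<omega>) - \<sigma> * W2 N (real (N - j)) \<omega>\<bar> \<le> C * real (N - j) powr max \<zeta> 0"
            if "real N / 2 < real j" "j < N" for j
            by (rule powr_weighted_SUP_le[OF fin(2)[of N], where r="\<lambda>k. N - k"]) (use that b(2) in \<open>auto simp: I2_def S2_def\<close>)
          show "max \<zeta> 0 \<le> 1" using \<zeta> by simp
          show "\<bar>W1 N (real N / 2) \<omega> - W1 N (real (N div 2)) \<omega>\<bar> \<le> C" "\<bar>W2 N (real N / 2) \<omega> - W2 N (real (N - (N div 2 + 1))) \<omega>\<bar> \<le> C"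
            "\<bar>W1 (N + 2) (real (N div 2 + 1)) \<omega> - W1 (N + 2) (real (N div 2)) \<omega>\<bar> \<le> C"
            using b(4,5,6) by (simp_all only: m_def)
        qed (use N(1) C(4) \<sigma> k b(7,8) in simp_all)
      qed
    qed
  qed
qed

section \<open>Convergence in distribution\<close>

text \<open>Centring cancels the mean. The sum is empty at index 0 and equals its own centring term
  at index \<open>N\<close>, so the cut in \<open>step\<close> loses nothing; \<open>t = 1\<close>
  falls into cell \<open>N + 1\<close>, where both sides are 0.\<close>

lemma cusum_normalized_eq_step:
  fixes X \<epsilon> :: "nat \<Rightarrow> 'a \<Rightarrow> real"
  assumes X: "\<And>i. i \<ge> 1 \<Longrightarrow> X i \<omega> = \<mu> + \<epsilon> i \<omega>" and N: "N \<ge> 1" and t: "t \<in> {0..1}"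
  shows "cusum_normalized X N t \<omega> =
    step N (\<lambda>k. ((\<Sum>i = 1..k. \<epsilon> i \<omega>) - real k / real N * (\<Sum>i = 1..N. \<epsilon> i \<omega>)) / sqrt (real N)) t"
proof (cases "t < 1")
  case True
  have fl: "of_int \<lfloor>(real N + 1) * t\<rfloor> = real (cell N t)" using t by (simp add: cell_def)
  have sum: "(\<Sum>i = 1..k. X i \<omega>) = real k * \<mu> + (\<Sum>i = 1..k. \<epsilon> i \<omega>)" for k
  proof -
    have "(\<Sum>i = 1..k. X i \<omega>) = (\<Sum>i = 1..k. \<mu> + \<epsilon> i \<omega>)" by (intro sum.cong refl X) auto
    then show ?thesis by (simp add: sum.distrib)
  qed
  have "cusum X N ((real N + 1) * t) \<omega> = (\<Sum>i = 1..cell N t. X i \<omega>) - real (cell N t) / real N * (\<Sum>i = 1..N. X i \<omega>)"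
    unfolding cusum_def fl by (simp add: cell_def)
  also have "\<dots> = (\<Sum>i = 1..cell N t. \<epsilon> i \<omega>) - real (cell N t) / real N * (\<Sum>i = 1..N. \<epsilon> i \<omega>)"
    unfolding sum using N by (simp add: field_simps)
  finally have "cusum_normalized X N t \<omega> =
    ((\<Sum>i = 1..cell N t. \<epsilon> i \<omega>) - real (cell N t) / real N * (\<Sum>i = 1..N. \<epsilon> i \<omega>)) / sqrt (real N)"
    using True by (simp add: cusum_normalized_def powr_minus_divide powr_half_sqrt)
  moreover have "cell N t \<le> N"
  proof -
    have "(real N + 1) * t < (real N + 1) * 1" using True by (intro mult_strict_left_mono) auto
    then have "real (cell N t) < real N + 1"
      using le_less_trans[OF cell_bounds(1)[of t N]] t by simp
    then show ?thesis by linarith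
  qed
  ultimately show ?thesis using N by (auto simp: step_def not_less_eq_eq le_Suc_eq)
next
  case False
  then have "t = 1" using t by simp
  moreover from this have "cell N t = N + 1" unfolding cell_def by (simp add: nat_add_distrib)
  ultimately show ?thesis by (simp add: cusum_normalized_def step_def)
qed

context weight_function
begin

lemma integral_cusum_eq_sum:
  fixes X \<epsilon> :: "nat \<Rightarrow> 'a \<Rightarrow> real"
  assumes "\<And>i. i \<ge> 1 \<Longrightarrow> X i \<omega> = \<mu> + \<epsilon> i \<omega>" "N \<ge> 1"
  shows "(LINT t|lebesgue_on {0..1}. \<bar>cusum_normalized X N t \<omega>\<bar> powr p / w t)
    = (\<Sum>k\<in>{1..<N}. \<bar>((\<Sum>i = 1..k. \<epsilon> i \<omega>) - real k / real N * (\<Sum>i = 1..N. \<epsilon> i \<omega>)) / sqrt (real N)\<bar> powr p * cell_mass N k)"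
proof -
  have "(LINT t|lebesgue_on {0..1}. \<bar>cusum_normalized X N t \<omega>\<bar> powr p / w t)
    = (LINT t|lebesgue_on {0..1}. step N (\<lambda>k. \<bar>((\<Sum>i = 1..k. \<epsilon> i \<omega>) - real k / real N * (\<Sum>i = 1..N. \<epsilon> i \<omega>)) / sqrt (real N)\<bar> powr p) t / w t)"
  proof (intro Bochner_Integration.integral_cong refl)
    fix t assume "t \<in> space (lebesgue_on {0..1::real})"
    then have t: "t \<in> {0..1}" by simp
    have eq: "cusum_normalized X N t \<omega> = step N (\<lambda>k. ((\<Sum>i = 1..k. \<epsilon> i \<omega>) - real k / real N * (\<Sum>i = 1..N. \<epsilon> i \<omega>)) / sqrt (real N)) t"
      by (rule cusum_normalized_eq_step) (use assms t in auto)
    show "\<bar>cusum_normalized X N t \<omega>\<bar> powr p / w t =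
      step N (\<lambda>k. \<bar>((\<Sum>i = 1..k. \<epsilon> i \<omega>) - real k / real N * (\<Sum>i = 1..N. \<epsilon> i \<omega>)) / sqrt (real N)\<bar> powr p) t / w t"
      unfolding eq by (simp add: step_def)
  qed
  then show ?thesis by (simp only: integral_step)
qed

text \<open>Since \<open>min k (N - k) \<ge> 1\<close> and \<open>\<zeta> \<le> 1/2\<close>, the error at \<open>k\<close> is at most \<open>sqrt (min k (N - k) / N)\<close>, of
  the size of the standard deviation of the bridge at \<open>k / N\<close>; for fixed \<open>k / N\<close> it tends to \<open>0\<close>.\<close>

lemma approximation_error_tendsto_0:
  assumes z: "0 \<le> \<zeta>" "\<zeta> < 1/2"
  shows "(\<lambda>N. \<Sum>k\<in>{1..<N}. (real (min k (N - k)) powr \<zeta> / sqrt (real N)) powr p * cell_mass N k) \<longlonglongrightarrow> 0"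
proof -
  have p0: "p > 0" using p by simp
  have "(\<lambda>N. \<Sum>k\<in>{1..<N}. (real (min k (N - k)) powr \<zeta> / sqrt (real N)) powr p * cell_mass N k) \<longlonglongrightarrow> (LINT t|lebesgue_on {0..1}. 0 / w t)"
  proof (rule sum_cell_mass_tendsto[where C="2 powr (p / 2)"])
    fix N k :: nat assume k: "k \<in> {1..<N}"
    define h where "h = real k / real N"
    have h: "0 < h" "h < 1" using k by (auto simp: h_def)
    define m where "m = real (min k (N - k))"
    have m: "m \<ge> 1" using k by (auto simp: m_def)
    \<comment> \<open>The smaller of \<open>h\<close> and \<open>1 - h\<close> is
      \<open>m / N\<close>, and the larger one is at least 1/2.\<close>
    have mN: "m / real N \<le> 2 * (h * (1 - h))"
    proof (cases "2 * k \<le> N")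
      case True
      then have "h * 1 \<le> h * (2 * (1 - h))" using h k by (intro mult_left_mono) (auto simp: h_def field_simps)
      moreover have "m / real N = h" using True by (simp add: m_def h_def min_def)
      ultimately show ?thesis by (simp add: algebra_simps)
    next
      case False
      then have "(1 - h) * 1 \<le> (1 - h) * (2 * h)" using h k by (intro mult_left_mono) (auto simp: h_def field_simps)
      moreover have "m / real N = 1 - h" using False k by (simp add: m_def h_def min_def of_nat_diff diff_divide_distrib)
      ultimately show ?thesis by (simp add: algebra_simps)
    qed
    have "m powr \<zeta> / sqrt (real N) \<le> m powr (1/2) / sqrt (real N)"
      using m z by (intro divide_right_mono powr_mono) auto
    also have "\<dots> = (m / real N) powr (1/2)" using m by (simp add: powr_half_sqrt real_sqrt_divide)
    finally have "(m powr \<zeta> / sqrt (real N)) powr p \<le> ((m / real N) powr (1/2)) powr p"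
      using p0 by (intro powr_mono2) auto
    also have "\<dots> = (m / real N) powr (p / 2)" by (simp add: powr_powr)
    also have "\<dots> \<le> (2 * (h * (1 - h))) powr (p / 2)" using mN m p0 by (intro powr_mono2) auto
    also have "\<dots> = 2 powr (p / 2) * (h * (1 - h)) powr (p / 2)" using h by (simp add: powr_mult)
    finally show "\<bar>(real (min k (N - k)) powr \<zeta> / sqrt (real N)) powr p\<bar>
        \<le> 2 powr (p / 2) * (real k / real N * (1 - real k / real N)) powr (p / 2)"
      by (simp add: m_def h_def)
  next
    fix t :: real
    show "(\<lambda>N. (real (min (cell N t) (N - cell N t)) powr \<zeta> / sqrt (real N)) powr p) \<longlonglongrightarrow> 0"
    proof (rule tendsto_sandwich[OF _ _ tendsto_const])
      have "(\<lambda>N. real N powr ((\<zeta> - 1/2) * p)) \<longlonglongrightarrow> 0"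
        \<comment> \<open>The exponent is negative because \<open>\<zeta> < 1/2\<close>; bounding
          the minimum by \<open>N\<close> suffices for the pointwise limit.\<close>
        using z p0 by (intro tendsto_neg_powr filterlim_real_sequentially) (auto intro!: mult_neg_pos)
      then show "(\<lambda>N. real N powr ((\<zeta> - 1/2) * p)) \<longlonglongrightarrow> 0" .
      show "\<forall>\<^sub>F N in sequentially. (real (min (cell N t) (N - cell N t)) powr \<zeta> / sqrt (real N)) powr p \<le> real N powr ((\<zeta> - 1/2) * p)"
      proof (rule always_eventually, rule allI)
        fix N
        have "real (min (cell N t) (N - cell N t)) powr \<zeta> / sqrt (real N) \<le> real N powr \<zeta> / sqrt (real N)"
          using z by (intro divide_right_mono powr_mono2) auto
        also have "\<dots> = real N powr (\<zeta> - 1/2)" by (simp add: powr_diff powr_half_sqrt)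
        finally have "(real (min (cell N t) (N - cell N t)) powr \<zeta> / sqrt (real N)) powr p \<le> (real N powr (\<zeta> - 1/2)) powr p"
          using p0 by (intro powr_mono2) auto
        then show "(real (min (cell N t) (N - cell N t)) powr \<zeta> / sqrt (real N)) powr p \<le> real N powr ((\<zeta> - 1/2) * p)"
          by (simp add: powr_powr)
      qed
    qed simp
  qed auto
  then show ?thesis by simp
qed

text \<open>The first term is a small multiple of a tight sum. The second is deterministic and, for
  the \<open>\<delta>\<close> of the coupling, vanishes by
  \<open>approximation_error_tendsto_0\<close>.\<close>

lemma riemann_sum_difference_le:
  assumes \<eta>: "0 < \<eta>" "\<eta> < 1" and K: "K \<ge> 0"
    and d: "\<And>k. k \<in> {1..<N} \<Longrightarrow> \<bar>z k - g k\<bar> \<le> K * \<delta> k" and \<delta>: "\<And>k. \<delta> k \<ge> 0"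
  shows "\<bar>(\<Sum>k\<in>{1..<N}. \<bar>z k\<bar> powr p * cell_mass N k) - (\<Sum>k\<in>{1..<N}. \<bar>g k\<bar> powr p * cell_mass N k)\<bar>
    \<le> ((1 + \<eta>) powr p - (1 - \<eta>) powr p) * (\<Sum>k\<in>{1..<N}. \<bar>g k\<bar> powr p * cell_mass N k)
      + (1 + 1 / \<eta>) powr p * K powr p * (\<Sum>k\<in>{1..<N}. \<delta> k powr p * cell_mass N k)"
proof -
  have p0: "p > 0" using p by simp
  let ?a = "(1 + \<eta>) powr p - (1 - \<eta>) powr p" and ?b = "(1 + 1 / \<eta>) powr p"
  have "\<bar>(\<Sum>k\<in>{1..<N}. \<bar>z k\<bar> powr p * cell_mass N k) - (\<Sum>k\<in>{1..<N}. \<bar>g k\<bar> powr p * cell_mass N k)\<bar>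
    = \<bar>\<Sum>k\<in>{1..<N}. (\<bar>z k\<bar> powr p - \<bar>g k\<bar> powr p) * cell_mass N k\<bar>"
    by (simp add: sum_subtractf left_diff_distrib)
  also have "\<dots> \<le> (\<Sum>k\<in>{1..<N}. \<bar>(\<bar>z k\<bar> powr p - \<bar>g k\<bar> powr p) * cell_mass N k\<bar>)"
    by (rule sum_abs)
  also have "\<dots> \<le> (\<Sum>k\<in>{1..<N}. (?a * \<bar>g k\<bar> powr p + ?b * (K powr p * \<delta> k powr p)) * cell_mass N k)"
  proof (rule sum_mono)
    fix k assume k: "k \<in> {1..<N}"
    have "\<bar>z k - g k\<bar> powr p \<le> (K * \<delta> k) powr p" using d[OF k] p0 by (intro powr_mono2) auto
    also have "\<dots> = K powr p * \<delta> k powr p" using K \<delta> by (simp add: powr_mult)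
    finally have "?b * \<bar>z k - g k\<bar> powr p \<le> ?b * (K powr p * \<delta> k powr p)" by (rule mult_left_mono) simp
    then have "\<bar>\<bar>z k\<bar> powr p - \<bar>g k\<bar> powr p\<bar> \<le> ?a * \<bar>g k\<bar> powr p + ?b * (K powr p * \<delta> k powr p)"
      using abs_powr_diff_le[of p \<eta> "z k" "g k"] p0 \<eta> by linarith
    then show "\<bar>(\<bar>z k\<bar> powr p - \<bar>g k\<bar> powr p) * cell_mass N k\<bar> \<le> (?a * \<bar>g k\<bar> powr p + ?b * (K powr p * \<delta> k powr p)) * cell_mass N k"
      using cell_mass_nonneg[of N k] by (simp add: abs_mult mult_right_mono)
  qed
  also have "\<dots> = ?a * (\<Sum>k\<in>{1..<N}. \<bar>g k\<bar> powr p * cell_mass N k) + ?b * K powr p * (\<Sum>k\<in>{1..<N}. \<delta> k powr p * cell_mass N k)"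
    by (simp add: distrib_right sum.distrib sum_distrib_left mult.assoc)
  finally show ?thesis .
qed

section \<open>Tightness and convergence of the bridge sums\<close>

lemma bridge_sum_measurable:
  assumes "brownian_bridge M B"
  shows "(\<lambda>\<omega>. \<Sum>k\<in>{1..<N}. \<bar>B (real k / real N) \<omega>\<bar> powr p * cell_mass N k) \<in> borel_measurable M"
proof (intro borel_measurable_sum borel_measurable_times borel_measurable_const)
  fix k assume "k \<in> {1..<N}"
  then have [measurable]: "B (real k / real N) \<in> borel_measurable M"
    using brownian_bridge_gaussian_rv[OF assms, of "real k / real N"] by (auto simp: gaussian_rv_def)
  show "(\<lambda>\<omega>. \<bar>B (real k / real N) \<omega>\<bar> powr p) \<in> borel_measurable M" by measurable
qed

text \<open>Markov's inequality with an expectation bounded uniformly in \<open>N\<close>. It is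
  proved for the bridge, whose moments are explicit, and reaches the Wiener sums through equality of
  laws.\<close>

lemma bridge_sum_tail:
  assumes B: "brownian_bridge M B"
  obtains c where "c > 0"
    "\<And>N R. R > 0 \<Longrightarrow> measure M {\<omega> \<in> space M. (\<Sum>k\<in>{1..<N}. \<bar>B (real k / real N) \<omega>\<bar> powr p * cell_mass N k) > R} \<le> c / R"
proof -
  interpret prob_space M using B by (simp add: brownian_bridge_def)
  have p0: "p > 0" using p by simp
  define a where "a = std_normal_abs_moment p"
  define c where "c = a * 4 powr (p / 2) * (LINT t|lebesgue_on {0..1}. (t * (1 - t)) powr (p / 2) / w t)"
  show thesis
  proof (rule that)
    have "0 \<le> c" unfolding c_def a_def using w_nonneg std_normal_abs_moment_nonneg
      by (intro mult_nonneg_nonneg Bochner_Integration.integral_nonneg) auto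
    \<comment> \<open>Adding 1 makes the constant strictly positive, so that a positive level
      \<open>R\<close> can be computed from it.\<close>
    then show "c + 1 > 0" by simp
    fix N and R :: real assume R: "R > 0"
    let ?U = "\<lambda>\<omega>. \<Sum>k\<in>{1..<N}. \<bar>B (real k / real N) \<omega>\<bar> powr p * cell_mass N k"
    have mom: "integrable M (\<lambda>\<omega>. \<bar>B (real k / real N) \<omega>\<bar> powr p)"
      "(LINT \<omega>|M. \<bar>B (real k / real N) \<omega>\<bar> powr p) = a * (real k / real N * (1 - real k / real N)) powr (p / 2)" if "k \<in> {1..<N}" for k
      using brownian_bridge_abs_moment[OF B _ p0, of "real k / real N"] that by (auto simp: a_def)
    have int: "integrable M ?U" by (intro Bochner_Integration.integrable_sum integrable_mult_left mom)
    have "expectation ?U = (\<Sum>k\<in>{1..<N}. expectation (\<lambda>\<omega>. \<bar>B (real k / real N) \<omega>\<bar> powr p * cell_mass N k))"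
      by (intro Bochner_Integration.integral_sum integrable_mult_left mom)
    also have "\<dots> = (\<Sum>k\<in>{1..<N}. a * (real k / real N * (1 - real k / real N)) powr (p / 2) * cell_mass N k)"
      by (intro sum.cong refl) (simp add: mom)
    also have "\<dots> \<le> c" unfolding c_def
      using std_normal_abs_moment_nonneg by (intro sum_cell_mass_le) (auto simp: a_def abs_mult)
    finally have E: "expectation ?U \<le> c" .
    have [measurable]: "?U \<in> borel_measurable M" by (rule bridge_sum_measurable[OF B])
    have "measure M {\<omega> \<in> space M. ?U \<omega> > R} \<le> measure M {\<omega> \<in> space M. ?U \<omega> \<ge> R}"
      by (rule finite_measure_mono, force, measurable)
    also have "\<dots> \<le> expectation ?U / R"
      by (rule integral_Markov_inequality_measure[OF int sets.top])
         (use R cell_mass_nonneg in \<open>auto intro!: sum_nonneg AE_I2\<close>)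
    also have "\<dots> \<le> (c + 1) / R" using E R by (intro divide_right_mono) auto
    finally show "measure M {\<omega> \<in> space M. ?U \<omega> > R} \<le> (c + 1) / R" .
  qed
qed

text \<open>Markov's inequality in its \<open>ennreal\<close> form, matching the nonnegative
  integrals of \<open>brownian_bridge_riemann_sum_L1\<close>.\<close>

lemma bridge_sum_in_probability:
  assumes B: "brownian_bridge M B" and d: "d > 0"
  shows "(\<lambda>N. measure M {\<omega> \<in> space M. \<bar>(\<Sum>k\<in>{1..<N}. \<bar>B (real k / real N) \<omega>\<bar> powr p * cell_mass N k)
      - (LINT t|lebesgue_on {0..1}. \<bar>B t \<omega>\<bar> powr p / w t)\<bar> > d}) \<longlonglongrightarrow> 0"
proof -
  interpret prob_space M using B by (simp add: brownian_bridge_def)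
  define D where "D N \<omega> = \<bar>(\<Sum>k\<in>{1..<N}. \<bar>B (real k / real N) \<omega>\<bar> powr p * cell_mass N k)
      - (LINT t|lebesgue_on {0..1}. \<bar>B t \<omega>\<bar> powr p / w t)\<bar>" for N \<omega>
  have [measurable]: "D N \<in> borel_measurable M" for N
    unfolding D_def by (intro borel_measurable_abs borel_measurable_diff bridge_sum_measurable[OF B]
      brownian_bridge_functional_measurable[OF B])
  have le: "ennreal (measure M {\<omega> \<in> space M. D N \<omega> > d}) \<le> ennreal (1 / d) * (\<integral>\<^sup>+\<omega>. ennreal (D N \<omega>) \<partial>M)" for N
  proof -
    have "ennreal (measure M {\<omega> \<in> space M. D N \<omega> > d}) = emeasure M {\<omega> \<in> space M. D N \<omega> > d}"
      by (simp add: emeasure_eq_measure)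
    also have "\<dots> \<le> emeasure M {\<omega> \<in> space M. 1 \<le> ennreal (1 / d) * ennreal (D N \<omega>)}"
    proof (rule emeasure_mono)
      show "{\<omega> \<in> space M. D N \<omega> > d} \<subseteq> {\<omega> \<in> space M. 1 \<le> ennreal (1 / d) * ennreal (D N \<omega>)}"
        using d by (auto simp: ennreal_mult'[symmetric] field_simps simp flip: ennreal_1 intro!: ennreal_leI)
    qed measurable
    also have "\<dots> \<le> ennreal (1 / d) * (\<integral>\<^sup>+\<omega>. ennreal (D N \<omega>) * indicator (space M) \<omega> \<partial>M)"
      by (rule nn_integral_Markov_inequality) auto
    also have "(\<integral>\<^sup>+\<omega>. ennreal (D N \<omega>) * indicator (space M) \<omega> \<partial>M) = (\<integral>\<^sup>+\<omega>. ennreal (D N \<omega>) \<partial>M)"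
      by (intro nn_integral_cong) auto
    finally show ?thesis .
  qed
  have "(\<lambda>N. ennreal (1 / d) * (\<integral>\<^sup>+\<omega>. ennreal (D N \<omega>) \<partial>M)) \<longlonglongrightarrow> ennreal (1 / d) * 0"
    unfolding D_def by (intro ennreal_tendsto_cmult brownian_bridge_riemann_sum_L1[OF B]) simp
  then have lim: "(\<lambda>N. ennreal (1 / d) * (\<integral>\<^sup>+\<omega>. ennreal (D N \<omega>) \<partial>M)) \<longlonglongrightarrow> 0" by simp
  have "(\<lambda>N. ennreal (measure M {\<omega> \<in> space M. D N \<omega> > d})) \<longlonglongrightarrow> 0"
    by (rule tendsto_sandwich[OF _ _ tendsto_const lim]) (auto intro!: always_eventually le)
  then show ?thesis by (simp add: ennreal_tendsto_0_iff D_def)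
qed

end

theorem theorem1p1:
  fixes M :: "'a measure" and M' :: "'b measure"
    and X \<epsilon> :: "nat \<Rightarrow> 'a \<Rightarrow> real"
    and W1 W2 :: "nat \<Rightarrow> real \<Rightarrow> 'a \<Rightarrow> real"
    and B :: "real \<Rightarrow> 'b \<Rightarrow> real"
    and w :: "real \<Rightarrow> real"
    and p \<mu>\<^sub>0 \<sigma> \<zeta> :: real
  assumes p: "p \<ge> 1"
    and M: "prob_space M"
    and errors: "\<And>i. i \<ge> 1 \<Longrightarrow> integrable M (\<epsilon> i)"
    and errors_mean: "\<And>i. i \<ge> 1 \<Longrightarrow> prob_space.expectation M (\<epsilon> i) = 0"
    and X: "\<And>i \<omega>. i \<ge> 1 \<Longrightarrow> \<omega> \<in> space M \<Longrightarrow> X i \<omega> = \<mu>\<^sub>0 + \<epsilon> i \<omega>"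
    and \<sigma>: "\<sigma> > 0" and \<zeta>: "\<zeta> < 1/2"
    and W1: "\<And>N. N \<ge> 1 \<Longrightarrow> wiener_process M (real N / 2) (W1 N)"
    and W2: "\<And>N. N \<ge> 1 \<Longrightarrow> wiener_process M (real N / 2) (W2 N)"
    and W_indep: "\<And>N. N \<ge> 1 \<Longrightarrow> indep_processes M (real N / 2) (W1 N) (W2 N)"
    and approx1: "bounded_in_probability M (\<lambda>N \<omega>.
          SUP k \<in> {k::nat. 1 \<le> k \<and> real k \<le> real N / 2}.
            real k powr (- \<zeta>) * \<bar>(\<Sum>i = 1..k. \<epsilon> i \<omega>) - \<sigma> * W1 N (real k) \<omega>\<bar>)"
    and approx2: "bounded_in_probability M (\<lambda>N \<omega>.
          SUP k \<in> {k::nat. real N / 2 < real k \<and> k < N}.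
            real (N - k) powr (- \<zeta>) *
              \<bar>(\<Sum>i = k + 1..N. \<epsilon> i \<omega>) - \<sigma> * W2 N (real (N - k)) \<omega>\<bar>)"
    and w_meas: "w \<in> borel_measurable (lebesgue_on {0..1})"
    and w_nonneg: "\<And>t. t \<in> {0..1} \<Longrightarrow> w t \<ge> 0"
    and w_inf: "\<And>\<delta>. 0 < \<delta> \<Longrightarrow> \<delta> < 1/2 \<Longrightarrow> (INF t \<in> {\<delta>..1 - \<delta>}. w t) > 0"
    and w_integrable: "integrable (lebesgue_on {0..1}) (\<lambda>t. (t * (1 - t)) powr (p / 2) / w t)"
    and B: "brownian_bridge M' B"
  shows "converges_in_distribution
           M (\<lambda>N \<omega>. 1 / \<sigma> powr p *
                (LINT t|lebesgue_on {0..1}. \<bar>cusum_normalized X N t \<omega>\<bar> powr p / w t))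
           M' (\<lambda>\<omega>. LINT t|lebesgue_on {0..1}. \<bar>B t \<omega>\<bar> powr p / w t)"
proof -
  interpret prob_space M by fact
  interpret weight_function w p
    by unfold_locales (use p w_meas w_nonneg w_inf w_integrable in auto)
  have p0: "p > 0" using p by simp
  have \<epsilon>m: "\<epsilon> i \<in> borel_measurable M" if "i \<ge> 1" for i using errors[OF that] by simp
  define Y where "Y N \<omega> = 1 / \<sigma> powr p * (LINT t|lebesgue_on {0..1}. \<bar>cusum_normalized X N t \<omega>\<bar> powr p / w t)" for N \<omega>
  define Z where "Z N k \<omega> = ((\<Sum>i = 1..k. \<epsilon> i \<omega>) - real k / real N * (\<Sum>i = 1..N. \<epsilon> i \<omega>)) / sqrt (real N)" for N k \<omega>
  define V where "V N \<omega> = (\<Sum>k\<in>{1..<N}. \<bar>walk_bridge N (W1 N) (W2 N) k \<omega>\<bar> powr p * cell_mass N k)" for N \<omega>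
  define U where "U N \<omega> = (\<Sum>k\<in>{1..<N}. \<bar>B (real k / real N) \<omega>\<bar> powr p * cell_mass N k)" for N \<omega>
  define \<delta> where "\<delta> N k = real (min k (N - k)) powr (max \<zeta> 0) / sqrt (real N)" for N k
  \<comment> \<open>Moving the factor \<open>1 / \<sigma> powr p\<close> into the power makes
    \<open>Z / \<sigma>\<close> the approximation of the standardised bridge.\<close>
  have Y_eq: "Y N \<omega> = (\<Sum>k\<in>{1..<N}. \<bar>Z N k \<omega> / \<sigma>\<bar> powr p * cell_mass N k)" if "N \<ge> 1" "\<omega> \<in> space M" for N \<omega>
  proof -
    have "Y N \<omega> = 1 / \<sigma> powr p * (\<Sum>k\<in>{1..<N}. \<bar>Z N k \<omega>\<bar> powr p * cell_mass N k)"
      unfolding Y_def Z_def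
      by (subst integral_cusum_eq_sum[where \<mu>="\<mu>\<^sub>0" and \<epsilon>=\<epsilon>]) (use X that in auto)
    also have "\<dots> = (\<Sum>k\<in>{1..<N}. \<bar>Z N k \<omega> / \<sigma>\<bar> powr p * cell_mass N k)"
      unfolding sum_distrib_left using \<sigma> by (intro sum.cong refl) (simp add: powr_divide)
    finally show ?thesis .
  qed
  have Zm [measurable]: "Z N k \<in> borel_measurable M" for N k
    unfolding Z_def
    by (intro borel_measurable_divide borel_measurable_diff borel_measurable_times borel_measurable_sum borel_measurable_const \<epsilon>m) auto
  have Ym: "Y N \<in> borel_measurable M" for N
  proof (cases "N \<ge> 1")
    case True
    have "(\<lambda>\<omega>. \<Sum>k\<in>{1..<N}. \<bar>Z N k \<omega> / \<sigma>\<bar> powr p * cell_mass N k) \<in> borel_measurable M" by measurable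
    then show ?thesis using Y_eq[OF True] by (subst measurable_cong) auto
  next
    \<comment> \<open>Convergence in distribution includes measurability for every \<open>N\<close>.
      At \<open>N = 0\<close> the normalising factor is \<open>0 powr (-1/2) = 0\<close>.\<close>
    case False
    then have N0: "N = 0" by simp
    have "cusum_normalized X 0 t \<omega> = 0" for t \<omega> by (auto simp: cusum_normalized_def)
    then have "Y N = (\<lambda>\<omega>. 0)" by (intro ext) (simp add: Y_def N0)
    then show ?thesis by simp
  qed
  have Vm: "V N \<in> borel_measurable M" if "N \<ge> 1" for N
    unfolding V_def
  proof (intro borel_measurable_sum borel_measurable_times borel_measurable_const)
    fix k assume "k \<in> {1..<N}"
    then have [measurable]: "walk_bridge N (W1 N) (W2 N) k \<in> borel_measurable M"
      by (intro walk_bridge_measurable W1 W2 that) auto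
    show "(\<lambda>\<omega>. \<bar>walk_bridge N (W1 N) (W2 N) k \<omega>\<bar> powr p) \<in> borel_measurable M" by measurable
  qed
  have Um: "U N \<in> borel_measurable M'" for N
    unfolding U_def by (rule bridge_sum_measurable[OF B])
  have law: "distr M borel (V N) = distr M' borel (U N)" if N: "N \<ge> 1" for N
  proof -
    define F where "F f = (\<Sum>k\<in>{1..<N}. \<bar>f k\<bar> powr p * cell_mass N k)" for f :: "nat \<Rightarrow> real"
    have "F \<in> borel_measurable (Pi\<^sub>M {1..<N} (\<lambda>_. borel))"
      unfolding F_def by measurable
    then have "distr M borel (\<lambda>\<omega>. F (\<lambda>k\<in>{1..<N}. walk_bridge N (W1 N) (W2 N) k \<omega>)) = distr M' borel (\<lambda>\<omega>. F (\<lambda>k\<in>{1..<N}. B (real k / real N) \<omega>))"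
      by (intro walk_bridge_law[OF W1[OF N] W2[OF N] W_indep[OF N] B]) (use N in auto)
    moreover have "(\<lambda>\<omega>. F (\<lambda>k\<in>{1..<N}. walk_bridge N (W1 N) (W2 N) k \<omega>)) = V N"
      unfolding F_def V_def by (intro ext sum.cong) auto
    moreover have "(\<lambda>\<omega>. F (\<lambda>k\<in>{1..<N}. B (real k / real N) \<omega>)) = U N"
      unfolding F_def U_def by (intro ext sum.cong) auto
    ultimately show ?thesis by simp
  qed
  obtain c where c: "c > 0" "\<And>N R. R > 0 \<Longrightarrow> measure M' {\<omega> \<in> space M'. U N \<omega> > R} \<le> c / R"
    unfolding U_def by (rule bridge_sum_tail[OF B]) blast
  have V_tail: "prob {\<omega> \<in> space M. V N \<omega> > R} \<le> c / R" if "N \<ge> 1" "R > 0" for N R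
  proof -
    have [measurable]: "V N \<in> borel_measurable M" "U N \<in> borel_measurable M'" using Vm Um that by auto
    have "prob {\<omega> \<in> space M. V N \<omega> > R} = measure (distr M borel (V N)) {R<..}"
      by (subst measure_distr) (auto intro!: arg_cong[where f=prob])
    also have "\<dots> = measure M' {\<omega> \<in> space M'. U N \<omega> > R}"
      unfolding law[OF that(1)] by (subst measure_distr) (auto intro!: arg_cong[where f="measure M'"])
    finally show ?thesis using c(2)[OF that(2)] by simp
  qed
  have \<delta>_lim: "(\<lambda>N. \<Sum>k\<in>{1..<N}. \<delta> N k powr p * cell_mass N k) \<longlonglongrightarrow> 0"
    unfolding \<delta>_def by (rule approximation_error_tendsto_0) (use \<zeta> in auto)
  have YV: "(\<lambda>N. prob {\<omega> \<in> space M. \<bar>Y N \<omega> - V N \<omega>\<bar> > d}) \<longlonglongrightarrow> 0" if d: "d > 0" for d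
  proof (rule LIMSEQ_I)
    fix r :: real assume r: "r > 0"
    \<comment> \<open>Order of the choices: \<open>R\<close> makes the tail of \<open>V N\<close> at
      most \<open>r / 2\<close>; then \<open>\<eta>\<close> makes its coefficient times
      \<open>R\<close> at most \<open>d / 2\<close>, as that coefficient tends to 0 at
      \<open>\<eta> = 0\<close>; then \<open>K\<close> comes from the coupling with probability
      \<open>r / 2\<close>; large \<open>N\<close> makes the deterministic term smaller than
      \<open>d / 2\<close>.\<close>
    define R where "R = 2 * c / r"
    have R: "R > 0" "c / R = r / 2" using c(1) r by (auto simp: R_def)
    have "((\<lambda>\<eta>. (1 + \<eta>) powr p - (1 - \<eta>) powr p) \<longlongrightarrow> (1 + 0) powr p - (1 - 0) powr p) (at_right 0)"
      by (intro tendsto_intros) auto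
    then have "\<forall>\<^sub>F \<eta> in at_right 0. (1 + \<eta>) powr p - (1 - \<eta>) powr p < d / (2 * R)"
      by (rule order_tendstoD(2)) (use d R in simp)
    moreover have "\<forall>\<^sub>F \<eta> in at_right (0::real). \<eta> \<in> {0<..<1}"
      by (rule eventually_at_right_real) simp
    ultimately have "\<forall>\<^sub>F \<eta> in at_right 0. 0 < \<eta> \<and> \<eta> < 1 \<and> (1 + \<eta>) powr p - (1 - \<eta>) powr p < d / (2 * R)"
      by eventually_elim auto
    then obtain \<eta> where \<eta>: "0 < \<eta>" "\<eta> < 1" "(1 + \<eta>) powr p - (1 - \<eta>) powr p < d / (2 * R)"
      using eventually_happens'[OF trivial_limit_at_right_real] by blast
    obtain K where K: "K > 0" and ev: "\<forall>\<^sub>F N in sequentially. \<exists>A\<in>sets M. measure M A < r / 2 \<and> (\<forall>\<omega>\<in>space M - A. \<forall>k\<in>{1..<N}.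
       \<bar>Z N k \<omega> - \<sigma> * walk_bridge N (W1 N) (W2 N) k \<omega>\<bar> \<le> K * \<delta> N k)"
      unfolding Z_def \<delta>_def
      by (rule cusum_walk_bridge_in_probability[OF M \<epsilon>m \<sigma> \<zeta> W1 W2 approx1 approx2, of "r / 2"]) (use r in auto)
    define L where "L = (1 + 1 / \<eta>) powr p * (K / \<sigma>) powr p"
    have "(\<lambda>N. L * (\<Sum>k\<in>{1..<N}. \<delta> N k powr p * cell_mass N k)) \<longlonglongrightarrow> L * 0"
      by (intro tendsto_mult \<delta>_lim tendsto_const)
    then have "\<forall>\<^sub>F N in sequentially. L * (\<Sum>k\<in>{1..<N}. \<delta> N k powr p * cell_mass N k) < d / 2"
      by (rule order_tendstoD(2)) (use d in simp)
    moreover note ev eventually_ge_at_top[of "1::nat"]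
    ultimately have "\<forall>\<^sub>F N in sequentially. norm (prob {\<omega> \<in> space M. \<bar>Y N \<omega> - V N \<omega>\<bar> > d} - 0) < r"
    proof eventually_elim
      case (elim N)
      then obtain A where A [measurable]: "A \<in> sets M" and pA: "prob A < r / 2"
        and AZ: "\<And>\<omega> k. \<omega> \<in> space M - A \<Longrightarrow> k \<in> {1..<N} \<Longrightarrow> \<bar>Z N k \<omega> - \<sigma> * walk_bridge N (W1 N) (W2 N) k \<omega>\<bar> \<le> K * \<delta> N k"
        by blast
      have [measurable]: "V N \<in> borel_measurable M" by (rule Vm[OF elim(3)])
      \<comment> \<open>Outside \<open>A\<close> and the tail of \<open>V N\<close>, the two terms
        of \<open>riemann_sum_difference_le\<close> are at most \<open>d / 2\<close> and below
        \<open>d / 2\<close>, so the difference cannot exceed \<open>d\<close>.\<close>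
      have sub: "{\<omega> \<in> space M. \<bar>Y N \<omega> - V N \<omega>\<bar> > d} \<subseteq> A \<union> {\<omega> \<in> space M. V N \<omega> > R}"
      proof (rule subsetI, rule ccontr)
        fix \<omega> assume "\<omega> \<in> {\<omega> \<in> space M. \<bar>Y N \<omega> - V N \<omega>\<bar> > d}" and "\<omega> \<notin> A \<union> {\<omega> \<in> space M. V N \<omega> > R}"
        then have om: "\<omega> \<in> space M" "\<omega> \<notin> A" and big: "\<bar>Y N \<omega> - V N \<omega>\<bar> > d" and VR: "V N \<omega> \<le> R" by auto
        have "\<bar>Z N k \<omega> / \<sigma> - walk_bridge N (W1 N) (W2 N) k \<omega>\<bar> \<le> K / \<sigma> * \<delta> N k" if "k \<in> {1..<N}" for k
        proof -
          have "Z N k \<omega> / \<sigma> - walk_bridge N (W1 N) (W2 N) k \<omega> = (Z N k \<omega> - \<sigma> * walk_bridge N (W1 N) (W2 N) k \<omega>) / \<sigma>"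
            using \<sigma> by (simp add: diff_divide_distrib)
          then show ?thesis using AZ[of \<omega> k] om that \<sigma> by (simp add: divide_right_mono)
        qed
        then have "\<bar>Y N \<omega> - V N \<omega>\<bar> \<le> ((1 + \<eta>) powr p - (1 - \<eta>) powr p) * V N \<omega> + L * (\<Sum>k\<in>{1..<N}. \<delta> N k powr p * cell_mass N k)"
          unfolding Y_eq[OF elim(3) om(1)] V_def L_def
          by (intro riemann_sum_difference_le \<eta>) (use K \<sigma> in \<open>auto simp: \<delta>_def\<close>)
        also have "((1 + \<eta>) powr p - (1 - \<eta>) powr p) * V N \<omega> \<le> d / (2 * R) * R"
        proof (rule mult_mono)
          show "0 \<le> V N \<omega>" unfolding V_def by (intro sum_nonneg mult_nonneg_nonneg cell_mass_nonneg) auto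
        qed (use \<eta> VR d R in auto)
        also have "d / (2 * R) * R = d / 2" using R by simp
        finally show False using big elim(1) by linarith
      qed
      have "prob {\<omega> \<in> space M. \<bar>Y N \<omega> - V N \<omega>\<bar> > d} \<le> prob (A \<union> {\<omega> \<in> space M. V N \<omega> > R})"
        by (rule finite_measure_mono[OF sub]) measurable
      also have "\<dots> \<le> prob A + prob {\<omega> \<in> space M. V N \<omega> > R}"
        by (rule measure_Un_le) measurable
      also have "\<dots> < r" using pA V_tail[OF elim(3) R(1)] R(2) by linarith
      finally show ?case by simp
    qed
    then show "\<exists>no. \<forall>n\<ge>no. norm (prob {\<omega> \<in> space M. \<bar>Y n \<omega> - V n \<omega>\<bar> > d} - 0) < r"
      by (simp add: eventually_sequentially)
  qed
  have "weak_conv_m (\<lambda>N. distr M borel (Y N)) (distr M' borel (\<lambda>\<omega>. LINT t|lebesgue_on {0..1}. \<bar>B t \<omega>\<bar> powr p / w t))"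
  proof (rule weak_conv_of_coupled[OF M _ Ym Vm Um _ law YV])
    show "prob_space M'" using B by (simp add: brownian_bridge_def)
    show "(\<lambda>\<omega>. LINT t|lebesgue_on {0..1}. \<bar>B t \<omega>\<bar> powr p / w t) \<in> borel_measurable M'"
      by (rule brownian_bridge_functional_measurable[OF B])
    show "(\<lambda>N. measure M' {\<omega> \<in> space M'. \<bar>U N \<omega> - (LINT t|lebesgue_on {0..1}. \<bar>B t \<omega>\<bar> powr p / w t)\<bar> > d}) \<longlonglongrightarrow> 0" if "d > 0" for d
      unfolding U_def by (rule bridge_sum_in_probability[OF B that])
  qed
  then show ?thesis
    unfolding converges_in_distribution_def Y_def[symmetric]
    using Ym brownian_bridge_functional_measurable[OF B] by simp
qed

end
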